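(* Let $K$ be a convex body in $\mathbb{R}^n$. Then there is a simplex $S$ containing $K$ such that $$V_n(S)\leq (C\log n)^n\, n^{\frac{n+1}{2}}\, V_n(K),$$ where $C$ is an absolute constant.
   Context: A convex body in $\mathbb{R}^n$ is a compact convex set with non-empty interior. $V_n$ denotes $n$-dimensional volume (Lebesgue measure).
   Formalization: The dimension is assumed to satisfy n ≥ 2: for n = 1 the bound has log 1 = 0 and would give V_1(S) ≤ 0, which fails for the interval K = [0,1], and for n = 0 the logarithm is undefined. *)

theory Defs
  imports "HOL-Analysis.Analysis" "HOL-Library.Function_Algebras"
begin

text \<open>
  The constant of the theorem does not depend on the dimension, so the dimension must be a term
  and not a type. Hence \<open>\<real>\<^sup>n\<close> is \<^term>\<open>topspace (Euclidean_space n)\<close>, the sequences of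
  reals that vanish from index \<open>n\<close> on, with the pointwise vector space structure below.
\<close>

instantiation "fun" :: (type, scaleR) scaleR
begin

definition scaleR_fun :: "real \<Rightarrow> ('a \<Rightarrow> 'b) \<Rightarrow> 'a \<Rightarrow> 'b"
  where "scaleR_fun c f = (\<lambda>x. c *\<^sub>R f x)"

instance ..

end

instance "fun" :: (type, real_vector) real_vector
  by standard (auto simp: scaleR_fun_def plus_fun_def fun_eq_iff scaleR_add_right scaleR_add_left)

definition convex_body :: "nat \<Rightarrow> (nat \<Rightarrow> real) set \<Rightarrow> bool"
  where "convex_body n K \<longleftrightarrow>
    compactin (Euclidean_space n) K \<and> convex K \<and> Euclidean_space n interior_of K \<noteq> {}"

text \<open>
  The library's \<open>simplex\<close> is confined to the class \<open>euclidean_space\<close>; this is its definition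
  for an \<open>n\<close>-dimensional simplex in \<open>\<real>\<^sup>n\<close>.
\<close>

definition full_simplex :: "nat \<Rightarrow> (nat \<Rightarrow> real) set \<Rightarrow> bool"
  where "full_simplex n S \<longleftrightarrow>
    (\<exists>T. T \<subseteq> topspace (Euclidean_space n) \<and> \<not> affine_dependent T \<and> card T = n + 1 \<and>
      S = convex hull T)"

text \<open>
  Lebesgue measure on the first \<open>n\<close> coordinates. Elements of the space of \<^const>\<open>PiM\<close>
  are \<^const>\<open>undefined\<close> rather than \<open>0\<close> from index \<open>n\<close> on, hence the \<^const>\<open>restrict\<close>.
\<close>

definition vol :: "nat \<Rightarrow> (nat \<Rightarrow> real) set \<Rightarrow> real"
  where "vol n A = measure (Pi\<^sub>M {..<n} (\<lambda>_. lborel)) ((\<lambda>x. restrict x {..<n}) ` A)"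

text \<open>
  \<^const>\<open>measure\<close> is \<open>0\<close> outside the \<open>\<sigma>\<close>-algebra; compact sets are measurable.
\<close>

lemma compactin_Euclidean_space_measurable:
  assumes "compactin (Euclidean_space n) A"
  shows "(\<lambda>x. restrict x {..<n}) ` A \<in> sets (Pi\<^sub>M {..<n} (\<lambda>_. lborel :: real measure))"
proof -
  let ?M = "Pi\<^sub>M {..<n} (\<lambda>_. lborel :: real measure)"
  define e :: "(nat \<Rightarrow> real) \<Rightarrow> nat \<Rightarrow> real" where "e = (\<lambda>y i. if i < n then y i else 0)"
  have sub: "A \<subseteq> {x. \<forall>i\<ge>n. x i = 0}"
    using compactin_subset_topspace[OF assms] by (simp add: topspace_Euclidean_space)
  have "compact A"
    using assms by (simp add: Euclidean_space_def compactin_subtopology euclidean_product_topology)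
  then have "A \<in> sets borel"
    by (rule borel_compact)
  moreover have "e \<in> measurable ?M borel"
  proof (rule measurable_coordinatewise_then_product)
    fix i show "(\<lambda>y. e y i) \<in> borel_measurable ?M"
      by (cases "i < n") (auto simp: e_def)
  qed
  ultimately have "e -` A \<inter> space ?M \<in> sets ?M"
    by (rule measurable_sets[rotated])
  moreover have "e -` A \<inter> space ?M = (\<lambda>x. restrict x {..<n}) ` A"
  proof (intro set_eqI iffI)
    fix y assume y: "y \<in> e -` A \<inter> space ?M"
    then have "y = restrict (e y) {..<n}"
      by (auto simp: e_def space_PiM PiE_def extensional_def fun_eq_iff)
    with y show "y \<in> (\<lambda>x. restrict x {..<n}) ` A" by blast
  next
    fix y assume "y \<in> (\<lambda>x. restrict x {..<n}) ` A"
    then obtain x where x: "x \<in> A" "y = restrict x {..<n}" by blast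
    then have "e y = x" using sub by (force simp: e_def fun_eq_iff)
    with x show "y \<in> e -` A \<inter> space ?M" by (auto simp: space_PiM)
  qed
  ultimately show ?thesis by simp
qed

lemma vol_box:
  assumes "\<And>i. i < n \<Longrightarrow> a i \<le> b i"
  shows "vol n {x \<in> topspace (Euclidean_space n). \<forall>i<n. a i \<le> x i \<and> x i \<le> b i} =
    (\<Prod>i<n. b i - a i)"
proof -
  interpret product_sigma_finite "\<lambda>_. lborel :: real measure" ..
  have eq: "(\<lambda>x. restrict x {..<n}) `
      {x \<in> topspace (Euclidean_space n). \<forall>i<n. a i \<le> x i \<and> x i \<le> b i} =
      (\<Pi>\<^sub>E i\<in>{..<n}. {a i..b i})" (is "?L = ?R")
  proof (intro set_eqI iffI)
    fix y assume "y \<in> ?R"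
    then have "y = restrict (\<lambda>i. if i < n then y i else 0) {..<n}"
      "\<forall>i<n. a i \<le> y i \<and> y i \<le> b i"
      by (auto simp: fun_eq_iff PiE_def Pi_def extensional_def)
    then show "y \<in> ?L"
      by (intro image_eqI[where x = "\<lambda>i. if i < n then y i else 0"])
         (auto simp: topspace_Euclidean_space)
  qed (auto split: if_splits)
  have "(\<Prod>i<n. ennreal (b i - a i)) = ennreal (\<Prod>i<n. b i - a i)"
    using assms by (intro prod_ennreal) simp
  moreover have "(\<Prod>i<n. b i - a i) \<ge> 0"
    using assms by (intro prod_nonneg) simp
  ultimately show ?thesis
    unfolding vol_def eq measure_def using assms
    by (subst emeasure_PiM) auto
qed

end

theory Submission
  imports Defs
begin

text \<open>
  A parallelepiped is contained in a simplex of volume at most \<open>c\<^sup>n\<close> times its own, so it is enough to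
  enclose \<open>K\<close> in a parallelepiped. The Rogers--Shephard inequality \<open>vol (K - K) \<le> 4\<^sup>n vol K\<close>
  (\<open>measure_difference_body\<close>) and the inclusion \<open>K \<subseteq> p + (K - K)\<close> for \<open>p \<in> K\<close> allow one to replace
  \<open>K\<close> by the symmetric body \<open>D = K - K\<close>.

  If \<open>y\<^sub>1, \<dots>, y\<^sub>n\<close> are points of the polar body of \<open>D\<close>, then \<open>D\<close> lies in the parallelepiped
  \<open>{x. \<forall>i. \<bar>\<langle>y\<^sub>i, x\<rangle>\<bar> \<le> 1}\<close> of volume \<open>2\<^sup>n / \<bar>det (y\<^sub>1, \<dots>, y\<^sub>n)\<bar>\<close>. Large determinants are found in
  isotropic position: a linear map turns the polar body into a body \<open>L\<close> over which the average of
  \<open>\<langle>w, y\<rangle>\<^sup>2\<close> is \<open>\<bar>w\<bar>\<^sup>2\<close> for every \<open>w\<close>. The average squared distance of a point of \<open>L\<close> to a subspace of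
  dimension \<open>m\<close> is then \<open>n - m\<close>, and choosing the points one after the other gives a determinant of
  at least \<open>\<surd>(n!)\<close> (\<open>large_parallelepiped\<close>). Isotropy also bounds the volume of \<open>L\<close> by \<open>c\<^sup>n\<close>
  (\<open>isotropic_measure_le\<close>), because at least half of \<open>L\<close> lies in the ball of radius \<open>\<surd>(2 n)\<close>.

  What remains is a lower bound for the volume of the polar of \<open>L\<close>, that is, for the volume product of
  \<open>L\<close>. The bound \<open>(c / (n log n))\<^sup>n\<close> (\<open>vprod_lower_bound\<close>) is Kuperberg's. Let \<open>A\<close> be the
  \<open>\<ell>\<^sub>2\<close>-sum of \<open>L\<close> and its polar body in \<open>\<real>\<^sup>n \<times> \<real>\<^sup>n\<close>. The section of \<open>A\<close> by the diagonal is a symmetric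
  body \<open>S\<close>, and the projection of \<open>A\<close> along the diagonal is the polar body of \<open>S\<close>, so the
  Rogers--Shephard inequality bounds the volume product of \<open>S\<close> by about \<open>2\<^sup>n\<close> times that of \<open>L\<close>.
  If \<open>L\<close> lies between two balls with ratio of radii \<open>R\<close>, the same holds for \<open>S\<close> with ratio \<open>\<surd>R\<close>. An isotropic
  body has \<open>R \<le> 4 n\<close> (\<open>isotropic_subset\<close>, \<open>isotropic_superset\<close>), so about \<open>log log n\<close> steps reach a
  body comparable to a ball, and they cost a factor of about \<open>2\<^sup>n\<close> each, hence \<open>(C log n)\<^sup>n\<close> in total.

  The dimension is a term, so volumes are measured by one family \<open>leb n\<close> of Borel measures on
  \<^typ>\<open>nat \<Rightarrow> real\<close>. Determinants are replaced by the factor by which a linear bijection scales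
  \<open>leb n\<close>; it exists because translation-invariant measures are unique (\<open>ex_scales\<close>).
\<close>

section \<open>Lebesgue measure on the first \<open>n\<close> coordinates\<close>

type_synonym rvec = "nat \<Rightarrow> real"

definition vecs :: "nat \<Rightarrow> rvec set"
  where "vecs n = {x. \<forall>i\<ge>n. x i = 0}"

text \<open>
  The elements of the product space are pushed forward to sequences that vanish from index \<open>n\<close> on, so
  that all dimensions share one type with Borel sets, pointwise operations and a product topology.
\<close>

definition leb :: "nat \<Rightarrow> rvec measure"
  where "leb n = distr (Pi\<^sub>M {..<n} (\<lambda>_. lborel)) borel (\<lambda>x i. if i < n then x i else 0)"

abbreviation lvol :: "nat \<Rightarrow> rvec set \<Rightarrow> real"
  where "lvol n \<equiv> measure (leb n)"

lemma scaleR_apply [simp]: "(c *\<^sub>R f) x = c *\<^sub>R f x" for f :: "'a \<Rightarrow> 'b::real_vector"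
  by (simp add: scaleR_fun_def)

lemma sum_fun_apply: "(\<Sum>i\<in>A. f i) x = (\<Sum>i\<in>A. f i x)" for f :: "'a \<Rightarrow> 'b \<Rightarrow> 'c::comm_monoid_add"
  by (induction A rule: infinite_finite_induct) auto

lemma subspace_vecs: "subspace (vecs n)"
  by (auto simp: subspace_def vecs_def)

lemmas vecs_add = subspace_add[OF subspace_vecs]
  and vecs_diff = subspace_diff[OF subspace_vecs]
  and vecs_scale = subspace_scale[OF subspace_vecs]
  and vecs_sum = subspace_sum[OF subspace_vecs]
  and vecs_neg = subspace_neg[OF subspace_vecs]
  and vecs_0 = subspace_0[OF subspace_vecs]

lemma vecs_eqI:
  assumes "x \<in> vecs n" "y \<in> vecs n" "\<And>i. i < n \<Longrightarrow> x i = y i"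
  shows "x = y"
proof
  fix i show "x i = y i"
    using assms by (cases "i < n") (auto simp: vecs_def)
qed

lemma closed_vecs: "closed (vecs n)"
proof -
  have "vecs n = (\<Inter>i\<in>{n..}. {x. x i = 0})" by (auto simp: vecs_def)
  moreover have "closed {x::rvec. x i = 0}" for i
    by (intro closed_Collect_eq continuous_intros continuous_on_product_coordinates)
  ultimately show ?thesis by (simp add: closed_INT)
qed

lemma continuous_on_fun_add [continuous_intros]:
  fixes f g :: "'a::topological_space \<Rightarrow> 'b \<Rightarrow> 'c::topological_monoid_add"
  assumes "continuous_on A f" "continuous_on A g"
  shows "continuous_on A (\<lambda>x. f x + g x)"
  by (intro continuous_on_coordinatewise_then_product)
    (simp; intro continuous_intros assms[THEN continuous_on_product_then_coordinatewise] assms)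

lemma continuous_on_fun_diff [continuous_intros]:
  fixes f g :: "'a::topological_space \<Rightarrow> 'b \<Rightarrow> 'c::topological_group_add"
  assumes "continuous_on A f" "continuous_on A g"
  shows "continuous_on A (\<lambda>x. f x - g x)"
  by (intro continuous_on_coordinatewise_then_product)
    (simp; intro continuous_intros assms[THEN continuous_on_product_then_coordinatewise] assms)

lemma continuous_on_fun_minus [continuous_intros]:
  fixes f :: "'a::topological_space \<Rightarrow> 'b \<Rightarrow> 'c::topological_group_add"
  assumes "continuous_on A f"
  shows "continuous_on A (\<lambda>x. - f x)"
  by (intro continuous_on_coordinatewise_then_product)
    (simp; intro continuous_intros assms[THEN continuous_on_product_then_coordinatewise] assms)

lemma continuous_on_fun_scaleR [continuous_intros]:
  fixes f :: "'a::topological_space \<Rightarrow> 'b \<Rightarrow> 'c::real_normed_vector"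
  assumes f: "continuous_on A f" and c: "continuous_on A c"
  shows "continuous_on A (\<lambda>x. c x *\<^sub>R f x)"
  by (intro continuous_on_coordinatewise_then_product)
    (simp; intro continuous_intros f[THEN continuous_on_product_then_coordinatewise] c)

lemma borel_measurable_fun_add [measurable]:
  fixes f g :: "'a \<Rightarrow> nat \<Rightarrow> real"
  assumes [measurable]: "f \<in> borel_measurable M" "g \<in> borel_measurable M"
  shows "(\<lambda>x. f x + g x) \<in> borel_measurable M"
  by (intro measurable_coordinatewise_then_product)
    (simp, intro borel_measurable_add borel_measurable_diff borel_measurable_uminus assms[THEN measurable_compose[OF _ measurable_product_coordinates]])

lemma borel_measurable_fun_diff [measurable]:
  fixes f g :: "'a \<Rightarrow> nat \<Rightarrow> real"
  assumes [measurable]: "f \<in> borel_measurable M" "g \<in> borel_measurable M"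
  shows "(\<lambda>x. f x - g x) \<in> borel_measurable M"
  by (intro measurable_coordinatewise_then_product)
    (simp, intro borel_measurable_add borel_measurable_diff borel_measurable_uminus assms[THEN measurable_compose[OF _ measurable_product_coordinates]])

lemma vecs_borel [measurable]: "vecs n \<in> sets borel"
  by (simp add: borel_closed closed_vecs)

lemma extend_by_zero_measurable [measurable]:
  "(\<lambda>x i. if i < n then x i else 0) \<in> measurable (Pi\<^sub>M {..<n} (\<lambda>_. lborel)) (borel :: rvec measure)"
proof (rule measurable_coordinatewise_then_product)
  fix i show "(\<lambda>x. if i < n then x i else 0) \<in> borel_measurable (Pi\<^sub>M {..<n} (\<lambda>_. lborel :: real measure))"
    by (cases "i < n") auto
qed

lemma sets_leb [simp, measurable_cong]: "sets (leb n) = sets borel"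
  by (simp add: leb_def)

lemma space_leb [simp]: "space (leb n) = UNIV"
  by (simp add: leb_def)

lemma AE_leb_vecs: "AE x in leb n. x \<in> vecs n"
  unfolding leb_def by (subst AE_distr_iff) (auto simp: vecs_def)

lemma vol_eq_measure_leb:
  assumes "A \<subseteq> vecs n" "A \<in> sets borel"
  shows "vol n A = lvol n A"
proof -
  let ?M = "Pi\<^sub>M {..<n} (\<lambda>_. lborel :: real measure)"
  let ?e = "\<lambda>x i. if i < n then x i else (0::real)"
  have "?e -` A \<inter> space ?M = (\<lambda>x. restrict x {..<n}) ` A"
  proof (intro set_eqI iffI)
    fix y assume y: "y \<in> ?e -` A \<inter> space ?M"
    then have "y = restrict (?e y) {..<n}"
      by (auto simp: space_PiM PiE_def extensional_def fun_eq_iff)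
    with y show "y \<in> (\<lambda>x. restrict x {..<n}) ` A" by blast
  next
    fix y assume "y \<in> (\<lambda>x. restrict x {..<n}) ` A"
    then obtain x where x: "x \<in> A" "y = restrict x {..<n}" by blast
    then have "?e y = x" using assms(1) by (force simp: fun_eq_iff vecs_def)
    with x show "y \<in> ?e -` A \<inter> space ?M" by (auto simp: space_PiM)
  qed
  then show ?thesis
    unfolding vol_def leb_def using assms by (subst measure_distr) auto
qed

lemma emeasure_leb_box:
  assumes "\<And>i. i < n \<Longrightarrow> A i \<in> sets borel"
  shows "emeasure (leb n) {x \<in> vecs n. \<forall>i<n. x i \<in> A i} = (\<Prod>i<n. emeasure lborel (A i))"
proof -
  interpret product_sigma_finite "\<lambda>_. lborel :: real measure" ..
  let ?M = "Pi\<^sub>M {..<n} (\<lambda>_. lborel :: real measure)"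
  let ?e = "\<lambda>x i. if i < n then x i else (0::real)"
  have [measurable]: "{x \<in> vecs n. \<forall>i<n. x i \<in> A i} \<in> sets borel"
  proof -
    have "{x::rvec. x i \<in> A i} \<in> sets borel" if "i < n" for i
      using measurable_sets[OF measurable_product_coordinates[of i] assms[OF that]] by (simp add: vimage_def)
    then have "(\<Inter>i\<in>{..<n}. {x::rvec. x i \<in> A i}) \<inter> vecs n \<in> sets borel"
      by (intro sets.Int) (auto intro!: sets.countable_INT'' simp: Ball_def)
    also have "(\<Inter>i\<in>{..<n}. {x::rvec. x i \<in> A i}) \<inter> vecs n = {x \<in> vecs n. \<forall>i<n. x i \<in> A i}"
      by auto
    finally show ?thesis .
  qed
  have "?e -` {x \<in> vecs n. \<forall>i<n. x i \<in> A i} \<inter> space ?M = Pi\<^sub>E {..<n} A"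
    by (auto simp: vecs_def space_PiM PiE_def)
  then show ?thesis
    unfolding leb_def using assms by (subst emeasure_distr) (auto intro!: emeasure_PiM)
qed

lemma sigma_finite_leb: "sigma_finite_measure (leb n)"
proof -
  interpret product_sigma_finite "\<lambda>_. lborel :: real measure" ..
  define B where "B k = (if k = 0 then - vecs n else {x \<in> vecs n. \<forall>i<n. x i \<in> {-real k..real k}})" for k
  have B0: "emeasure (leb n) (- vecs n) = 0"
    using AE_leb_vecs[of n] by (subst (asm) AE_iff_measurable[of "- vecs n"]) auto
  have B1: "emeasure (leb n) {x \<in> vecs n. \<forall>i<n. x i \<in> {-real k..real k}} < \<infinity>" for k
    by (subst emeasure_leb_box) (auto simp: power_less_top_ennreal)
  have "B k \<in> sets borel" for k
  proof (cases "k = 0")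
    case False
    have "B k = vecs n \<inter> (\<Inter>i\<in>{..<n}. {x. x i \<in> {-real k..real k}})"
      using False by (auto simp: B_def)
    moreover have "closed \<dots>"
      by (intro closed_Int closed_vecs closed_INT)
        (auto intro!: closed_Collect_conj closed_Collect_le continuous_intros)
    ultimately show ?thesis by simp
  qed (auto simp: B_def)
  moreover have "(\<Union>k. B k) = UNIV"
  proof -
    have "x \<in> (\<Union>k. B k)" for x
    proof (cases "x \<in> vecs n")
      case True
      obtain k :: nat where k: "1 + (\<Sum>i<n. \<bar>x i\<bar>) \<le> real k" using real_arch_simple by blast
      have "\<bar>x i\<bar> \<le> real k" if "i < n" for i
        using member_le_sum[of i "{..<n}" "\<lambda>i. \<bar>x i\<bar>"] that k by auto
      moreover have "0 \<le> (\<Sum>i<n. \<bar>x i\<bar>)" by (simp add: sum_nonneg)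
      then have "0 < real k" using k by linarith
      then have "k \<noteq> 0" by simp
      ultimately have "x \<in> B k" using True by (force simp: B_def abs_le_iff)
      then show ?thesis by blast
    qed (auto simp: B_def intro!: exI[of _ 0])
    then show ?thesis by blast
  qed
  moreover have "emeasure (leb n) (B k) \<noteq> \<infinity>" for k
    using B0 B1[of k] by (auto simp: B_def)
  ultimately show ?thesis
    unfolding sigma_finite_measure_def
    by (intro exI[of _ "range B"]) (auto simp: countable_def intro!: countable_image)
qed

lemma leb_translate:
  assumes "a \<in> vecs n"
  shows "distr (leb n) borel (\<lambda>x. x + a) = leb n"
proof -
  interpret product_sigma_finite "\<lambda>_. lborel :: real measure" ..
  let ?M = "Pi\<^sub>M {..<n} (\<lambda>_. lborel :: real measure)"
  let ?e = "\<lambda>x i. if i < n then x i else (0::real)"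
  let ?t = "\<lambda>x. \<lambda>i\<in>{..<n}. x i + a i"
  have [measurable]: "?t \<in> measurable ?M ?M" by measurable
  have "distr ?M ?M ?t = ?M"
  proof (rule PiM_eqI)
    fix A :: "nat \<Rightarrow> real set" assume A: "\<And>i. i \<in> {..<n} \<Longrightarrow> A i \<in> sets lborel"
    let ?A = "\<lambda>i. (\<lambda>x. x + a i) -` A i"
    have *: "?A i \<in> sets lborel" if "i < n" for i
      using measurable_sets[of "\<lambda>x. x + a i" borel borel "A i"] A[of i] that by auto
    have "?t -` (Pi\<^sub>E {..<n} A) \<inter> space ?M = Pi\<^sub>E {..<n} ?A"
      by (auto simp: space_PiM PiE_def extensional_def Pi_def)
    then have "emeasure (distr ?M ?M ?t) (Pi\<^sub>E {..<n} A) = emeasure ?M (Pi\<^sub>E {..<n} ?A)"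
      using A by (subst emeasure_distr) (auto intro!: sets_PiM_I_finite)
    also have "\<dots> = (\<Prod>i<n. emeasure lborel (?A i))"
      using * by (subst emeasure_PiM) auto
    also have "\<dots> = (\<Prod>i<n. emeasure lborel (A i))"
    proof (rule prod.cong)
      fix i assume i: "i \<in> {..<n}"
      have "emeasure lborel (A i) = emeasure (distr lborel borel ((+) (a i))) (A i)"
        by (simp add: lborel_distr_plus)
      also have "\<dots> = emeasure lborel (?A i)"
        using A[OF i] by (subst emeasure_distr) (auto simp: add.commute[of _ "a i"])
      finally show "emeasure lborel (?A i) = emeasure lborel (A i)" by simp
    qed simp
    finally show "emeasure (distr ?M ?M ?t) (Pi\<^sub>E {..<n} A) = (\<Prod>i<n. emeasure lborel (A i))" .
  qed auto
  then have "leb n = distr (distr ?M ?M ?t) borel ?e" by (simp add: leb_def)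
  also have "\<dots> = distr ?M borel (?e \<circ> ?t)" by (rule distr_distr) auto
  also have "?e \<circ> ?t = (\<lambda>x. x + a) \<circ> ?e"
    using assms by (auto simp: fun_eq_iff vecs_def)
  also have "distr ?M borel \<dots> = distr (leb n) borel (\<lambda>x. x + a)"
    unfolding leb_def by (rule distr_distr[symmetric]) auto
  finally show ?thesis by simp
qed

lemma nn_integral_leb_translate:
  assumes [measurable]: "f \<in> borel_measurable borel" and "a \<in> vecs n"
  shows "(\<integral>\<^sup>+x. f (x + a) \<partial>leb n) = (\<integral>\<^sup>+x. f x \<partial>leb n)"
  by (subst (2) leb_translate[OF assms(2), symmetric]) (simp add: nn_integral_distr)

section \<open>Linear bijections and their dilation factors\<close>

definition ip :: "nat \<Rightarrow> rvec \<Rightarrow> rvec \<Rightarrow> real"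
  where "ip n x y = (\<Sum>i<n. x i * y i)"

definition axis_vec :: "nat \<Rightarrow> nat \<Rightarrow> real"
  where "axis_vec k = (\<lambda>i. if i = k then 1 else 0)"

definition lin_iso :: "nat \<Rightarrow> (rvec \<Rightarrow> rvec) \<Rightarrow> bool"
  where "lin_iso n T \<longleftrightarrow>
    linear T \<and> continuous_on UNIV T \<and> bij_betw T (vecs n) (vecs n)"

definition cube :: "nat \<Rightarrow> real \<Rightarrow> rvec set"
  where "cube n a = {x \<in> vecs n. \<forall>i<n. x i \<in> {-a..a}}"

text \<open>
  \<open>c\<close> is the absolute value of the determinant of \<open>T\<close>, characterised by its effect on volumes.
\<close>

definition scales :: "nat \<Rightarrow> (rvec \<Rightarrow> rvec) \<Rightarrow> real \<Rightarrow> bool"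
  where "scales n T c \<longleftrightarrow> lin_iso n T \<and> 0 < c \<and>
    (\<forall>A \<in> sets borel. A \<subseteq> vecs n \<longrightarrow> T ` A \<in> sets borel \<and>
      emeasure (leb n) (T ` A) = ennreal c * emeasure (leb n) A)"

lemma ip_commute: "ip n x y = ip n y x"
  by (simp add: ip_def mult.commute)

lemma ip_add_left: "ip n (x + y) z = ip n x z + ip n y z"
  and ip_add_right: "ip n z (x + y) = ip n z x + ip n z y"
  and ip_diff_left: "ip n (x - y) z = ip n x z - ip n y z"
  and ip_diff_right: "ip n z (x - y) = ip n z x - ip n z y"
  and ip_scale_left: "ip n (a *\<^sub>R x) z = a * ip n x z"
  and ip_scale_right: "ip n z (a *\<^sub>R x) = a * ip n z x"
  and ip_minus_left: "ip n (- x) z = - ip n x z"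
  and ip_minus_right: "ip n z (- x) = - ip n z x"
  and ip_zero_left: "ip n 0 z = 0"
  and ip_zero_right: "ip n z 0 = 0"
  by (simp_all add: ip_def algebra_simps sum.distrib sum_subtractf sum_distrib_left sum_negf)

lemmas ip_simps = ip_add_left ip_add_right ip_diff_left ip_diff_right ip_scale_left ip_scale_right
  ip_minus_left ip_minus_right ip_zero_left ip_zero_right

lemma ip_sum_left: "ip n (\<Sum>i\<in>A. f i) z = (\<Sum>i\<in>A. ip n (f i) z)"
  for f :: "'a \<Rightarrow> nat \<Rightarrow> real"
  by (simp add: ip_def sum_fun_apply sum_distrib_left sum_distrib_right) (rule sum.swap)

lemma ip_sum_right: "ip n z (\<Sum>i\<in>A. f i) = (\<Sum>i\<in>A. ip n z (f i))"
  for f :: "'a \<Rightarrow> nat \<Rightarrow> real"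
  by (simp add: ip_def sum_fun_apply sum_distrib_left sum_distrib_right) (rule sum.swap)

lemma ip_axis_vec [simp]: "k < n \<Longrightarrow> ip n (axis_vec k) x = x k" "k < n \<Longrightarrow> ip n x (axis_vec k) = x k"
  by (simp_all add: ip_def axis_vec_def if_distrib[of "\<lambda>u. _ * u"] if_distrib[of "\<lambda>u. u * _"] cong: if_cong)

lemma ip_nonneg [simp]: "0 \<le> ip n x x"
  by (simp add: ip_def sum_nonneg)

lemma ip_eq_0_iff: "x \<in> vecs n \<Longrightarrow> ip n x x = 0 \<longleftrightarrow> x = 0"
  by (auto simp: ip_def sum_nonneg_eq_0_iff vecs_def fun_eq_iff not_less[symmetric] Ball_def)

lemma axis_vec_in [simp]: "k < n \<Longrightarrow> axis_vec k \<in> vecs n"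
  by (auto simp: axis_vec_def vecs_def)

lemma coord_expand:
  assumes "x \<in> vecs n" shows "(\<Sum>j<n. x j *\<^sub>R axis_vec j) = x"
proof (rule vecs_eqI)
  fix i assume "i < n"
  then show "(\<Sum>j<n. x j *\<^sub>R axis_vec j) i = x i"
    by (simp add: sum_fun_apply axis_vec_def if_distrib[of "\<lambda>u. _ * u"] cong: if_cong)
qed (auto intro!: vecs_sum vecs_scale assms)

lemma continuous_on_ip [continuous_intros]:
  assumes "continuous_on A f" "continuous_on A g"
  shows "continuous_on A (\<lambda>x. ip n (f x) (g x))"
  unfolding ip_def by (intro continuous_intros assms[THEN continuous_on_product_then_coordinatewise])

lemma lin_isoD:
  assumes "lin_iso n T"
  shows "linear T" "continuous_on UNIV T" "bij_betw T (vecs n) (vecs n)"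
    "inj_on T (vecs n)" "T ` vecs n = vecs n"
    "x \<in> vecs n \<Longrightarrow> T x \<in> vecs n"
  using assms by (auto simp: lin_iso_def bij_betw_def)

lemma lin_iso_measurable:
  assumes "lin_iso n T" shows "T \<in> borel_measurable borel"
  using lin_isoD(2)[OF assms] by (rule borel_measurable_continuous_onI)

lemma lin_isoI:
  assumes "linear T" "continuous_on UNIV T"
    and "\<And>x. x \<in> vecs n \<Longrightarrow> T x \<in> vecs n"
    and "\<And>x. x \<in> vecs n \<Longrightarrow> S x \<in> vecs n"
    and "\<And>x. x \<in> vecs n \<Longrightarrow> S (T x) = x"
    and "\<And>x. x \<in> vecs n \<Longrightarrow> T (S x) = x"
  shows "lin_iso n T"
  unfolding lin_iso_def
  by (intro conjI assms(1,2) bij_betw_byWitness[of _ S]) (auto simp: assms)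

lemma lin_iso_comp:
  assumes "lin_iso n T" "lin_iso n S" shows "lin_iso n (\<lambda>x. S (T x))"
proof -
  have "linear (S \<circ> T)" using assms by (intro linear_compose lin_isoD)
  moreover have "bij_betw (S \<circ> T) (vecs n) (vecs n)"
    using bij_betw_trans[OF lin_isoD(3)[OF assms(1)] lin_isoD(3)[OF assms(2)]] .
  moreover have "continuous_on UNIV (\<lambda>x. S (T x))"
    by (rule continuous_on_compose2[OF lin_isoD(2)[OF assms(2)] lin_isoD(2)[OF assms(1)]]) auto
  ultimately show ?thesis by (simp add: lin_iso_def o_def)
qed

lemma lin_iso_inverse:
  assumes "lin_iso n T"
  obtains S where "lin_iso n S" "\<And>x. x \<in> vecs n \<Longrightarrow> S (T x) = x"
    "\<And>x. x \<in> vecs n \<Longrightarrow> T (S x) = x"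
proof -
  define S' where "S' = inv_into (vecs n) T"
  define S where "S x = (\<Sum>j<n. x j *\<^sub>R S' (axis_vec j))" for x :: "nat \<Rightarrow> real"
  note T = lin_isoD[OF assms]
  have S'_in: "S' x \<in> vecs n" and TS': "T (S' x) = x" if "x \<in> vecs n" for x
    using that T(5) by (auto simp: S'_def inv_into_into f_inv_into_f)
  have S_in: "S x \<in> vecs n" for x
    unfolding S_def by (intro vecs_sum vecs_scale S'_in) auto
  have TS: "T (S x) = x" if "x \<in> vecs n" for x
  proof -
    have "T (S x) = (\<Sum>j<n. x j *\<^sub>R T (S' (axis_vec j)))"
      unfolding S_def by (simp add: linear_sum[OF T(1)] linear_cmul[OF T(1)])
    also have "\<dots> = (\<Sum>j<n. x j *\<^sub>R axis_vec j)" by (intro sum.cong) (auto simp: TS')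
    finally show ?thesis using coord_expand[OF that] by simp
  qed
  have ST: "S (T x) = x" if "x \<in> vecs n" for x
    using T(4) by (rule inj_onD) (auto simp: TS T(6) that S_in)
  have "linear S"
    by (rule linearI) (simp_all add: S_def scaleR_add_left sum.distrib scaleR_sum_right)
  moreover have "continuous_on UNIV S"
  proof (rule continuous_on_coordinatewise_then_product)
    fix i show "continuous_on UNIV (\<lambda>x. S x i)"
      unfolding S_def sum_fun_apply scaleR_apply
      by (intro continuous_intros continuous_on_product_coordinates)
  qed
  ultimately have "lin_iso n S"
    by (rule lin_isoI[where S = T]) (auto simp: S_in T ST TS)
  with ST TS show ?thesis using that by blast
qed

lemma lin_iso_adjoint:
  assumes "lin_iso n T"
  obtains S where "lin_iso n S"
    "\<And>x y. x \<in> vecs n \<Longrightarrow> y \<in> vecs n \<Longrightarrow> ip n (T x) y = ip n x (S y)"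
proof -
  define adj where "adj T y = (\<lambda>i. if i < n then ip n (T (axis_vec i)) y else 0)"
    for T :: "rvec \<Rightarrow> rvec" and y
  have adj_in: "adj T y \<in> vecs n" for T y by (auto simp: adj_def vecs_def)
  have adj_eq: "ip n (T x) y = ip n x (adj T y)"
    if "lin_iso n T" "x \<in> vecs n" for T x y
  proof -
    note T = lin_isoD[OF that(1)]
    have "T x = T (\<Sum>j<n. x j *\<^sub>R axis_vec j)" using coord_expand[OF that(2)] by simp
    also have "\<dots> = (\<Sum>j<n. x j *\<^sub>R T (axis_vec j))"
      by (simp add: linear_sum[OF T(1)] linear_cmul[OF T(1)])
    finally have "ip n (T x) y = (\<Sum>j<n. x j * ip n (T (axis_vec j)) y)"
      by (simp add: ip_sum_left ip_simps)
    then show ?thesis by (simp add: adj_def ip_def[of n x])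
  qed
  have inv: "adj T (adj S y) = y"
    if "lin_iso n T" "lin_iso n S" "\<And>x. x \<in> vecs n \<Longrightarrow> S (T x) = x" "y \<in> vecs n" for S T y
  proof (rule vecs_eqI)
    fix i assume i: "i < n"
    have "adj T (adj S y) i = ip n (axis_vec i) (adj T (adj S y))" using i by simp
    also have "\<dots> = ip n (T (axis_vec i)) (adj S y)" using adj_eq that(1) i by simp
    also have "\<dots> = ip n (S (T (axis_vec i))) y" using adj_eq[OF that(2)] lin_isoD(6)[OF that(1)] i by simp
    also have "\<dots> = y i" using that(3) i by simp
    finally show "adj T (adj S y) i = y i" .
  qed (auto simp: adj_in that)
  obtain S where S: "lin_iso n S" "\<And>x. x \<in> vecs n \<Longrightarrow> S (T x) = x"
    "\<And>x. x \<in> vecs n \<Longrightarrow> T (S x) = x"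
    using lin_iso_inverse[OF assms] by blast
  have "linear (adj T)"
    by (rule linearI) (auto simp: adj_def fun_eq_iff ip_simps)
  moreover have "continuous_on UNIV (adj T)"
  proof (rule continuous_on_coordinatewise_then_product)
    fix i show "continuous_on UNIV (\<lambda>y. adj T y i)"
      unfolding adj_def by (cases "i < n") (simp_all add: continuous_on_ip continuous_on_id)
  qed
  ultimately have "lin_iso n (adj T)"
    by (rule lin_isoI[where S = "adj S"]) (auto simp: adj_in inv assms S)
  with adj_eq[OF assms] show ?thesis using that by blast
qed

lemma cube_borel [measurable]: "cube n a \<in> sets borel"
  and cube_subset: "cube n a \<subseteq> vecs n"
proof -
  have "cube n a = vecs n \<inter> (\<Inter>i\<in>{..<n}. {x. x i \<in> {-a..a}})" by (auto simp: cube_def)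
  moreover have "closed \<dots>"
    by (intro closed_Int closed_vecs closed_INT)
      (auto intro!: closed_Collect_conj closed_Collect_le continuous_intros)
  ultimately show "cube n a \<in> sets borel" by simp
qed (auto simp: cube_def)

lemma emeasure_cube: "0 \<le> a \<Longrightarrow> emeasure (leb n) (cube n a) = ennreal ((2 * a) ^ n)"
  unfolding cube_def by (subst emeasure_leb_box) (auto simp: ennreal_power)

lemma emeasure_leb_cong:
  assumes "A \<in> sets borel" "B \<in> sets borel" "A \<inter> vecs n = B \<inter> vecs n"
  shows "emeasure (leb n) A = emeasure (leb n) B"
  by (rule emeasure_eq_AE) (use assms AE_leb_vecs[of n] in \<open>auto elim!: eventually_mono\<close>)

text \<open>
  The image measure under \<open>T\<close> is invariant under translations. For invariant measures \<open>\<lambda>\<close> and \<open>\<mu>\<close> and a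
  symmetric set \<open>B\<close>, translating first one and then the other variable in the double integral of
  \<open>1\<^sub>B(y) 1\<^sub>A(x)\<close> gives \<open>\<mu>(A) \<lambda>(B) = \<lambda>(A) \<mu>(B)\<close>, so the two measures are proportional. Here \<open>B\<close> is a cube.
\<close>

lemma ex_scales:
  assumes "lin_iso n T" shows "\<exists>c. scales n T c"
proof -
  obtain S where S: "lin_iso n S" "\<And>x. x \<in> vecs n \<Longrightarrow> S (T x) = x"
    "\<And>x. x \<in> vecs n \<Longrightarrow> T (S x) = x"
    using lin_iso_inverse[OF assms] by blast
  note [measurable] = lin_iso_measurable[OF assms] lin_iso_measurable[OF S(1)]
  note T_in = lin_isoD(6)[OF assms] and S_in = lin_isoD(6)[OF S(1)]
  note S_lin = linear_add[OF lin_isoD(1)[OF S(1)]] linear_diff[OF lin_isoD(1)[OF S(1)]]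
  let ?l = "leb n" and ?B = "cube n 1"
  interpret sigma_finite_measure "leb n" by (rule sigma_finite_leb)
  interpret pair_sigma_finite "leb n" "leb n" ..
  let ?i = "\<lambda>A x. indicator A x :: ennreal"
  have symB: "- x \<in> ?B \<longleftrightarrow> x \<in> ?B" for x
    by (auto simp: cube_def vecs_def minus_le_iff neg_le_iff_le)
  have key: "emeasure ?l (S -` A) * emeasure ?l ?B = emeasure ?l A * emeasure ?l (S -` ?B)"
    if A[measurable]: "A \<in> sets borel" for A
  proof -
    have SA: "S -` A' \<in> sets borel" if "A' \<in> sets borel" for A'
      using measurable_sets[OF lin_iso_measurable[OF S(1)] that] by simp
    have m: "emeasure ?l (S -` A') = (\<integral>\<^sup>+x. ?i A' (S x) \<partial>?l)" if "A' \<in> sets borel" for A'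
      using nn_integral_indicator[of "S -` A'" ?l] SA[OF that] by (simp add: indicator_def)
    have "emeasure ?l (S -` A) * emeasure ?l ?B = (\<integral>\<^sup>+y. ?i ?B y * (\<integral>\<^sup>+x. ?i A (S x) \<partial>?l) \<partial>?l)"
      by (subst nn_integral_multc) (auto simp: m mult.commute)
    also have "\<dots> = (\<integral>\<^sup>+y. (\<integral>\<^sup>+x. ?i ?B y * ?i A (S x + y) \<partial>?l) \<partial>?l)"
    proof (rule nn_integral_cong_AE, rule AE_mp[OF AE_leb_vecs], intro AE_I2 impI)
      fix y assume y: "y \<in> vecs n"
      have "(\<integral>\<^sup>+x. ?i A (S x) \<partial>?l) = (\<integral>\<^sup>+x. ?i A (S (x + T y)) \<partial>?l)"
        by (rule nn_integral_leb_translate[symmetric]) (auto simp: T_in y)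
      also have "\<dots> = (\<integral>\<^sup>+x. ?i A (S x + y) \<partial>?l)" by (simp add: S_lin S y)
      finally show "?i ?B y * (\<integral>\<^sup>+x. ?i A (S x) \<partial>?l) = (\<integral>\<^sup>+x. ?i ?B y * ?i A (S x + y) \<partial>?l)"
        by (subst nn_integral_cmult) auto
    qed
    also have "\<dots> = (\<integral>\<^sup>+x. (\<integral>\<^sup>+y. ?i ?B y * ?i A (S x + y) \<partial>?l) \<partial>?l)"
      by (rule Fubini'[symmetric]) measurable
    also have "\<dots> = (\<integral>\<^sup>+x. (\<integral>\<^sup>+y. ?i ?B (y - S x) * ?i A y \<partial>?l) \<partial>?l)"
    proof (rule nn_integral_cong_AE, rule AE_mp[OF AE_leb_vecs], intro AE_I2 impI)
      fix x assume x: "x \<in> vecs n"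
      have "(\<integral>\<^sup>+y. ?i ?B (y - S x) * ?i A y \<partial>?l) = (\<integral>\<^sup>+y. ?i ?B (y + S x - S x) * ?i A (y + S x) \<partial>?l)"
        by (rule nn_integral_leb_translate[symmetric]) (auto simp: S_in x)
      then show "(\<integral>\<^sup>+y. ?i ?B y * ?i A (S x + y) \<partial>?l) = (\<integral>\<^sup>+y. ?i ?B (y - S x) * ?i A y \<partial>?l)"
        by (simp add: add.commute)
    qed
    also have "\<dots> = (\<integral>\<^sup>+y. (\<integral>\<^sup>+x. ?i ?B (y - S x) * ?i A y \<partial>?l) \<partial>?l)"
      by (rule Fubini'[symmetric]) measurable
    also have "\<dots> = (\<integral>\<^sup>+y. emeasure ?l (S -` ?B) * ?i A y \<partial>?l)"
    proof (rule nn_integral_cong_AE, rule AE_mp[OF AE_leb_vecs], intro AE_I2 impI)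
      fix y assume y: "y \<in> vecs n"
      have "(\<integral>\<^sup>+x. ?i ?B (y - S x) \<partial>?l) = (\<integral>\<^sup>+x. ?i ?B (y - S (x + T y)) \<partial>?l)"
        by (rule nn_integral_leb_translate[symmetric]) (auto simp: T_in y)
      also have "\<dots> = (\<integral>\<^sup>+x. ?i ?B (S x) \<partial>?l)"
        by (simp add: S_lin S y indicator_def symB)
      finally show "(\<integral>\<^sup>+x. ?i ?B (y - S x) * ?i A y \<partial>?l) = emeasure ?l (S -` ?B) * ?i A y"
        by (subst nn_integral_multc) (auto simp: m)
    qed
    also have "\<dots> = emeasure ?l A * emeasure ?l (S -` ?B)"
      by (subst nn_integral_cmult) (auto simp: mult.commute)
    finally show ?thesis .
  qed
  \<comment> \<open>The identity for the preimage of the cube under \<open>T\<close> shows that the constant is neither \<open>0\<close> nor infinite.\<close>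
  have B: "emeasure ?l ?B = ennreal (2 ^ n)" by (simp add: emeasure_cube)
  have SB: "S -` A \<in> sets borel" if "A \<in> sets borel" for A
    using measurable_sets[OF lin_iso_measurable[OF S(1)] that] by simp
  have [measurable]: "T -` ?B \<in> sets borel"
    using measurable_sets[OF lin_iso_measurable[OF assms] cube_borel] by simp
  have "emeasure ?l (S -` (T -` ?B)) = emeasure ?l ?B"
    by (rule emeasure_leb_cong) (auto simp: S intro!: SB)
  with key[of "T -` ?B"] have eq: "ennreal (2 ^ n) * ennreal (2 ^ n) = emeasure ?l (T -` ?B) * emeasure ?l (S -` ?B)"
    by (simp add: B)
  have ne: "emeasure ?l (S -` ?B) \<noteq> 0" 
    using eq by (metis ennreal_eq_0_iff mult_eq_0_iff not_le zero_less_numeral zero_less_power)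
  have nt: "emeasure ?l (S -` ?B) \<noteq> top"
  proof
    assume t: "emeasure ?l (S -` ?B) = top"
    have "emeasure ?l (T -` ?B) \<noteq> 0" using eq 
      by (metis ennreal_eq_0_iff mult_eq_0_iff not_le zero_less_numeral zero_less_power)
    with t eq have "ennreal (2 ^ n) * ennreal (2 ^ n) = top" by (simp add: ennreal_mult_top)
    then show False by (simp add: ennreal_mult[symmetric])
  qed
  define c where "c = enn2real (emeasure ?l (S -` ?B)) / 2 ^ n"
  have c: "emeasure ?l (S -` ?B) = ennreal (c * 2 ^ n)"
    using nt by (simp add: c_def less_top)
  have cpos: "c > 0"
    using ne nt by (simp add: c_def enn2real_positive_iff less_top zero_less_iff_neq_zero)
  have "T ` A \<in> sets borel \<and> emeasure ?l (T ` A) = ennreal c * emeasure ?l A"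
    if A: "A \<in> sets borel" "A \<subseteq> vecs n" for A
  proof
    have TA: "T ` A = S -` A \<inter> vecs n"
    proof (intro set_eqI iffI)
      fix x assume "x \<in> S -` A \<inter> vecs n"
      then show "x \<in> T ` A" using S(3)[of x] by (intro image_eqI[of _ _ "S x"]) auto
    qed (use A S T_in in auto)
    show "T ` A \<in> sets borel" unfolding TA using SB[OF A(1)] by auto
    have "emeasure ?l (T ` A) = emeasure ?l (S -` A)"
      by (rule emeasure_leb_cong) (use SB[OF A(1)] in \<open>auto simp: TA\<close>)
    moreover have "emeasure ?l (S -` A) * ennreal (2 ^ n) = (ennreal c * emeasure ?l A) * ennreal (2 ^ n)"
      using key[OF A(1)] cpos by (simp add: B c ennreal_mult mult_ac)
    ultimately show "emeasure ?l (T ` A) = ennreal c * emeasure ?l A"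
      by (simp add: mult.commute[of _ "ennreal (2 ^ n)"] ennreal_mult_cancel_left)
  qed
  with assms cpos show ?thesis by (auto simp: scales_def)
qed

lemma scalesD:
  assumes "scales n T c"
  shows "lin_iso n T" "0 < c"
    "A \<in> sets borel \<Longrightarrow> A \<subseteq> vecs n \<Longrightarrow> T ` A \<in> sets borel"
    "A \<in> sets borel \<Longrightarrow> A \<subseteq> vecs n \<Longrightarrow> emeasure (leb n) (T ` A) = ennreal c * emeasure (leb n) A"
    "A \<in> sets borel \<Longrightarrow> A \<subseteq> vecs n \<Longrightarrow> lvol n (T ` A) = c * lvol n A"
  using assms by (auto simp: scales_def measure_def enn2real_mult)

lemma scales_determined:
  assumes "scales n T c" "A \<in> sets borel" "A \<subseteq> vecs n"
    and "lvol n A > 0" "lvol n (T ` A) = d * lvol n A"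
  shows "c = d"
  using scalesD(5)[OF assms(1-3)] assms(4,5) by auto

lemma measure_cube: "0 \<le> a \<Longrightarrow> lvol n (cube n a) = (2 * a) ^ n"
  by (simp add: measure_def emeasure_cube)

lemma scales_cube:
  assumes "scales n T c" "lvol n (T ` cube n 1) = d * 2 ^ n"
  shows "c = d"
  by (rule scales_determined[OF assms(1), of "cube n 1"])
    (auto simp: measure_cube cube_subset assms)

lemma scales_comp:
  assumes "scales n T c" "scales n S d" shows "scales n (\<lambda>x. S (T x)) (d * c)"
proof -
  obtain e where e: "scales n (\<lambda>x. S (T x)) e"
    using ex_scales[OF lin_iso_comp[OF scalesD(1)[OF assms(1)] scalesD(1)[OF assms(2)]]] by blast
  let ?C = "cube n 1"
  have "T ` ?C \<subseteq> vecs n"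
    using lin_isoD(6)[OF scalesD(1)[OF assms(1)]] cube_subset[of n 1] by auto
  then have "lvol n (S ` T ` ?C) = d * (c * 2 ^ n)"
    by (simp add: scalesD(5)[OF assms(2)] scalesD(3,5)[OF assms(1)] cube_subset measure_cube)
  then have "e = d * c"
    by (intro scales_cube[OF e]) (simp add: image_image mult.assoc)
  with e show ?thesis by (simp only:)
qed

lemma lin_iso_id: "lin_iso n (\<lambda>x. x)"
  by (rule lin_isoI[where S = "\<lambda>x. x"]) (simp_all add: linear_ident continuous_on_id)

lemma scales_id: "scales n (\<lambda>x. x) 1"
  using lin_iso_id by (simp add: scales_def)

lemma scales_inverse:
  assumes "scales n T c" "lin_iso n S" "\<And>x. x \<in> vecs n \<Longrightarrow> S (T x) = x"
  shows "scales n S (1 / c)"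
proof -
  obtain d where d: "scales n S d" using ex_scales[OF assms(2)] by blast
  have "(\<lambda>x. S (T x)) ` cube n 1 = cube n 1"
    using image_cong[of "cube n 1" "cube n 1" "\<lambda>x. S (T x)" "\<lambda>x. x"] assms(3) cube_subset[of n 1]
    by (simp add: subset_iff)
  then have "d * c = 1"
    by (intro scales_cube[OF scales_comp[OF assms(1) d]]) (simp add: measure_cube)
  moreover have "0 < c" by (rule scalesD(2)[OF assms(1)])
  ultimately have "d = 1 / c" by (simp add: field_simps)
  with d show ?thesis by (simp only:)
qed

text \<open>
  The maps of determinant \<open>\<plusminus>1\<close> below (reflections, and shears up to a sign) square to the identity,
  which fixes their dilation factor without any computation of a volume.
\<close>

lemma scales_involution:
  assumes "linear T" "continuous_on UNIV T" "\<And>x. x \<in> vecs n \<Longrightarrow> T x \<in> vecs n"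
    "\<And>x. x \<in> vecs n \<Longrightarrow> T (T x) = x"
  shows "scales n T 1"
proof -
  have T: "lin_iso n T" by (rule lin_isoI[where S = T]) (auto simp: assms)
  then obtain c where c: "scales n T c" using ex_scales by blast
  have "scales n T (1 / c)" by (rule scales_inverse[OF c T]) (simp add: assms)
  then have "c * lvol n (cube n 1) = 1 / c * lvol n (cube n 1)"
    using scalesD(5)[OF c, of "cube n 1"] scalesD(5)[of n T "1/c" "cube n 1"] by (simp add: cube_subset)
  then have "c * c = 1" using scalesD(2)[OF c] by (simp add: measure_cube field_simps)
  then have "c = 1" using scalesD(2)[OF c] by (metis abs_of_pos abs_square_eq_1 power2_eq_square)
  with c show ?thesis by simp
qed

lemma scales_scaleR:
  assumes "a > 0" shows "scales n (\<lambda>x. a *\<^sub>R x) (a ^ n)"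
proof -
  have "lin_iso n (\<lambda>x. a *\<^sub>R x)"
    by (rule lin_isoI[where S = "\<lambda>x. (1/a) *\<^sub>R x"])
      (use assms in \<open>auto intro!: vecs_scale linearI continuous_on_fun_scaleR continuous_on_id continuous_on_const simp: scaleR_add_right\<close>)
  then obtain c where c: "scales n (\<lambda>x. a *\<^sub>R x) c" using ex_scales by blast
  have "(\<lambda>x. a *\<^sub>R x) ` cube n 1 = cube n a"
  proof (intro set_eqI iffI)
    fix x assume "x \<in> cube n a"
    then have "(1/a) *\<^sub>R x \<in> cube n 1" using assms by (auto simp: cube_def vecs_def field_simps)
    then show "x \<in> (\<lambda>x. a *\<^sub>R x) ` cube n 1" using assms by (intro image_eqI[of _ _ "(1/a) *\<^sub>R x"]) auto
  next
    fix x assume "x \<in> (\<lambda>x. a *\<^sub>R x) ` cube n 1"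
    then obtain y where y: "y \<in> cube n 1" "x = a *\<^sub>R y" by blast
    then have "a * y i \<le> a * 1" "a * (-1) \<le> a * y i" if "i < n" for i
      using that assms by (simp_all only: mult_le_cancel_left_pos) (auto simp: cube_def)
    with y show "x \<in> cube n a" by (auto simp: cube_def vecs_def)
  qed
  then have "c = a ^ n"
    using assms by (intro scales_cube[OF c]) (simp add: measure_cube power_mult_distrib)
  with c show ?thesis by simp
qed

lemma lin_iso_coord_update:
  fixes b :: "nat \<Rightarrow> real"
  assumes "l \<noteq> 0" "m < n"
  shows "lin_iso n (\<lambda>x. x(m := l * x m + (\<Sum>j<m. b j * x j)))"
proof (rule lin_isoI[where S = "\<lambda>x. x(m := (x m - (\<Sum>j<m. b j * x j)) / l)"])
  show "linear (\<lambda>x. x(m := l * x m + (\<Sum>j<m. b j * x j)))"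
    by (rule linearI) (simp_all add: fun_eq_iff distrib_left sum.distrib sum_distrib_left mult.left_commute)
  show "continuous_on UNIV (\<lambda>x. x(m := l * x m + (\<Sum>j<m. b j * x j)))"
  proof (rule continuous_on_coordinatewise_then_product)
    fix i show "continuous_on UNIV (\<lambda>x. (x(m := l * x m + (\<Sum>j<m. b j * x j))) i)"
      by (cases "i = m"; simp; intro continuous_intros continuous_on_product_coordinates)
  qed
qed (use assms in \<open>simp_all add: vecs_def fun_eq_iff\<close>)

text \<open>
  The map is the composition of a stretching of one coordinate, whose factor is read off from a box,
  with a sheared reflection, which is an involution.
\<close>

lemma scales_coord_update:
  fixes b :: "nat \<Rightarrow> real"
  assumes "l > 0" "m < n"
  shows "scales n (\<lambda>x. x(m := l * x m + (\<Sum>j<m. b j * x j))) l"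
proof -
  let ?U = "\<lambda>l b (x::rvec). x(m := l * x m + (\<Sum>j<m. b j * x j))"
  have J: "scales n (?U (-1) b) 1"
  proof (rule scales_involution)
    have U: "lin_iso n (?U (-1) b)" using lin_iso_coord_update[of "-1" m n b] assms by simp
    show "linear (?U (-1) b)" "continuous_on UNIV (?U (-1) b)" using lin_isoD(1,2)[OF U] .
    show "?U (-1) b x \<in> vecs n" if "x \<in> vecs n" for x
      using lin_isoD(6)[OF U that] .
  qed (simp add: fun_eq_iff)
  obtain c where c: "scales n (?U (- l) (\<lambda>_. 0)) c"
    using ex_scales[OF lin_iso_coord_update[of "- l" m n "\<lambda>_. 0"]] assms by auto
  have "?U (- l) (\<lambda>_. 0) ` cube n 1 = {x \<in> vecs n. \<forall>i<n. x i \<in> (if i = m then {-l..l} else {-1..1})}"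
    (is "_ = ?R")
  proof (intro set_eqI iffI)
    fix x assume "x \<in> ?R"
    then have "x(m := - x m / l) \<in> cube n 1"
      using assms by (auto simp: cube_def vecs_def field_simps)
    then show "x \<in> ?U (- l) (\<lambda>_. 0) ` cube n 1"
      using assms by (intro image_eqI[of _ _ "x(m := - x m / l)"]) (auto simp: fun_eq_iff)
  next
    fix x assume "x \<in> ?U (- l) (\<lambda>_. 0) ` cube n 1"
    then obtain y where y: "y \<in> cube n 1" "x = ?U (- l) (\<lambda>_. 0) y" by blast
    have "l * y m \<le> l * 1" "l * (-1) \<le> l * y m"
      using assms by (simp_all only: mult_le_cancel_left_pos) (use y(1) assms in \<open>auto simp: cube_def\<close>)
    with y assms show "x \<in> ?R" by (auto simp: cube_def vecs_def)
  qed
  moreover have "emeasure (leb n) ?R = (\<Prod>i<n. if i = m then ennreal (2 * l) else 2)"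
    using assms by (subst emeasure_leb_box) (auto intro!: prod.cong simp del: prod.delta)
  moreover have "\<dots> = ennreal (\<Prod>i<n. if i = m then 2 * l else 2)"
    using assms by (subst prod_ennreal[symmetric]) (auto intro!: prod.cong)
  moreover have "(\<Prod>i<n. if i = m then 2 * l else 2) = l * 2 ^ n"
  proof -
    have "(\<Prod>i<n. if i = m then 2 * l else 2) = (\<Prod>i<n. (if i = m then l else 1) * 2)"
      by (intro prod.cong) auto
    then show ?thesis using assms by (simp add: prod.distrib)
  qed
  ultimately have "c = l" using assms by (intro scales_cube[OF c]) (simp add: measure_def)
  moreover have "(\<lambda>x. ?U (-1) b (?U (- l) (\<lambda>_. 0) x)) = ?U l b"
    by (simp add: fun_eq_iff)
  ultimately show ?thesis using scales_comp[OF c J] by (simp only: mult_1)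
qed

section \<open>Symmetric convex bodies, polarity and separation\<close>

definition eball :: "nat \<Rightarrow> real \<Rightarrow> rvec set"
  where "eball n r = {x \<in> vecs n. ip n x x \<le> r\<^sup>2}"

definition polar :: "nat \<Rightarrow> rvec set \<Rightarrow> rvec set"
  where "polar n K = {y \<in> vecs n. \<forall>x\<in>K. ip n x y \<le> 1}"

definition sym_body :: "nat \<Rightarrow> rvec set \<Rightarrow> bool"
  where "sym_body n K \<longleftrightarrow> K \<subseteq> vecs n \<and> compact K \<and> convex K \<and> (\<forall>x\<in>K. - x \<in> K) \<and>
    (\<exists>r>0. eball n r \<subseteq> K)"

lemma sym_bodyD:
  assumes "sym_body n K"
  shows "K \<subseteq> vecs n" "compact K" "convex K" "x \<in> K \<Longrightarrow> - x \<in> K" "\<exists>r>0. eball n r \<subseteq> K"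
  using assms by (auto simp: sym_body_def)

lemma ip_Cauchy_Schwarz: "(ip n x y)\<^sup>2 \<le> ip n x x * ip n y y"
  using Cauchy_Schwarz_ineq_sum[of x y "{..<n}"] by (simp add: ip_def power2_eq_square)

lemma coord_le_ip: "i < n \<Longrightarrow> (x i)\<^sup>2 \<le> ip n x x"
  unfolding ip_def power2_eq_square by (rule member_le_sum) auto

lemma compact_cube: "compact (cube n a)"
proof -
  let ?C = "\<lambda>i. if i < n then {-a..a} else {0::real}"
  have "cube n a = Pi\<^sub>E UNIV ?C"
  proof (intro set_eqI iffI)
    fix x assume "x \<in> cube n a"
    then have "x i \<in> ?C i" for i by (cases "i < n") (simp_all add: cube_def vecs_def)
    then show "x \<in> Pi\<^sub>E UNIV ?C" by (simp add: PiE_iff)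
  next
    fix x assume "x \<in> Pi\<^sub>E UNIV ?C"
    then have C: "x i \<in> ?C i" for i by (auto simp: PiE_iff)
    have "x i = 0" if "i \<ge> n" for i using C[of i] that by simp
    moreover have "x i \<in> {-a..a}" if "i < n" for i using C[of i] that by simp
    ultimately show "x \<in> cube n a" by (simp add: cube_def vecs_def)
  qed
  moreover have "compactin (product_topology (\<lambda>_. euclidean) UNIV) (Pi\<^sub>E UNIV ?C)"
    by (subst compactin_PiE) auto
  ultimately show ?thesis by (simp add: euclidean_product_topology)
qed

lemma eball_subset_cube: "0 \<le> r \<Longrightarrow> eball n r \<subseteq> cube n r"
proof
  fix x assume r: "0 \<le> r" and x: "x \<in> eball n r"
  have "\<bar>x i\<bar> \<le> r" if "i < n" for i
  proof -
    have "(x i)\<^sup>2 \<le> r\<^sup>2" using coord_le_ip[OF that, of x] x by (simp add: eball_def)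
    then show ?thesis using r by (simp add: abs_le_square_iff[symmetric])
  qed
  with x show "x \<in> cube n r" by (auto simp: cube_def eball_def abs_le_iff minus_le_iff)
qed

lemma closed_eball: "closed (eball n r)"
proof -
  have "closed {x. ip n x x \<le> r\<^sup>2}"
    by (intro closed_Collect_le continuous_on_ip continuous_on_id continuous_on_const)
  moreover have "eball n r = vecs n \<inter> {x. ip n x x \<le> r\<^sup>2}" by (auto simp: eball_def)
  ultimately show ?thesis using closed_vecs by auto
qed

lemma eball_abs: "eball n \<bar>r\<bar> = eball n r"
  by (simp add: eball_def)

lemma compact_eball: "compact (eball n r)"
  using compact_Int_closed[OF compact_cube[of n "\<bar>r\<bar>"] closed_eball[of n r]]
    eball_subset_cube[of "\<bar>r\<bar>" n] by (simp add: eball_abs Int_absorb1)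

lemma cube_subset_eball:
  assumes "0 \<le> a" shows "cube n a \<subseteq> eball n (sqrt (real n) * a)"
proof
  fix x assume x: "x \<in> cube n a"
  have "x i * x i \<le> a * a" if "i < n" for i
    using x that by (intro abs_le_square_iff[THEN iffD1, of "x i" a, unfolded power2_eq_square])
      (force simp: cube_def)
  then have "ip n x x \<le> (\<Sum>i<n. a * a)" unfolding ip_def by (intro sum_mono) auto
  moreover have "(sqrt (real n) * a)\<^sup>2 = real n * (a * a)"
    by (simp add: power_mult_distrib power2_eq_square[of a])
  ultimately show "x \<in> eball n (sqrt (real n) * a)"
    using x by (simp add: eball_def cube_def)
qed

lemma zero_in_eball [simp]: "0 \<in> eball n r"
  by (simp add: eball_def vecs_0 ip_simps)

lemma scaleR_eball:
  assumes "x \<in> eball n r" shows "a *\<^sub>R x \<in> eball n (a * r)"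
proof -
  have "a * (a * ip n x x) \<le> (a * r)\<^sup>2"
    using assms mult_left_mono[of "ip n x x" "r\<^sup>2" "a\<^sup>2"] by (simp add: eball_def power2_eq_square algebra_simps)
  with assms show ?thesis by (simp add: eball_def ip_simps vecs_scale)
qed

lemma compact_subset_eball:
  assumes "compact A" "A \<subseteq> vecs n" obtains \<rho> where "0 < \<rho>" "A \<subseteq> eball n \<rho>"
proof (cases "A = {}")
  case False
  have "continuous_on A (\<lambda>x. ip n x x)" by (intro continuous_on_ip continuous_on_id)
  then obtain m where m: "m \<in> A" "\<And>x. x \<in> A \<Longrightarrow> ip n x x \<le> ip n m m"
    using continuous_attains_sup[OF assms(1) False] by blast
  have "ip n x x \<le> (sqrt (ip n m m) + 1)\<^sup>2" if "x \<in> A" for x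
  proof -
    have "ip n x x \<le> (sqrt (ip n m m))\<^sup>2" using m(2)[OF that] by simp
    also have "\<dots> \<le> (sqrt (ip n m m) + 1)\<^sup>2" by (intro power_mono) auto
    finally show ?thesis .
  qed
  then show ?thesis using assms(2)
    by (intro that[of "sqrt (ip n m m) + 1"]) (auto simp: eball_def intro: add_nonneg_pos)
qed (use that[of 1] in auto)

lemma emeasure_compact_finite:
  assumes "compact A" "A \<subseteq> vecs n" shows "emeasure (leb n) A < top"
proof -
  obtain \<rho> where "0 < \<rho>" "A \<subseteq> eball n \<rho>" using compact_subset_eball[OF assms] .
  then have "emeasure (leb n) A \<le> emeasure (leb n) (cube n \<rho>)"
    using eball_subset_cube[of \<rho> n] by (intro emeasure_mono) auto
  also have "\<dots> < top" using \<open>0 < \<rho>\<close> by (simp add: emeasure_cube)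
  finally show ?thesis .
qed

lemma emeasure_eq_measure_compact:
  assumes "compact A" "A \<subseteq> vecs n" shows "emeasure (leb n) A = ennreal (lvol n A)"
  using emeasure_compact_finite[OF assms] by (simp add: emeasure_eq_ennreal_measure less_top)

lemma measure_mono_compact:
  assumes "A \<subseteq> B" "A \<in> sets borel" "compact B" "B \<subseteq> vecs n"
  shows "lvol n A \<le> lvol n B"
  using assms emeasure_compact_finite[OF assms(3,4)]
  by (intro measure_mono_fmeasurable) (auto simp: fmeasurable_def borel_compact)

lemma measure_eball_ge:
  assumes "0 < r" "0 < n" shows "(2 * r / sqrt (real n)) ^ n \<le> lvol n (eball n r)"
proof -
  have "cube n (r / sqrt (real n)) \<subseteq> eball n r"
    using cube_subset_eball[of "r / sqrt (real n)" n] assms by simp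
  then have "lvol n (cube n (r / sqrt (real n))) \<le> lvol n (eball n r)"
    by (intro measure_mono_compact compact_eball) (auto simp: eball_def)
  then show ?thesis using assms by (simp add: measure_cube)
qed

lemma sym_body_0: "sym_body n K \<Longrightarrow> 0 \<in> K"
  using zero_in_eball by (auto simp: sym_body_def)

lemma sym_body_scale:
  assumes "sym_body n K" "x \<in> K" "\<bar>a\<bar> \<le> 1" shows "a *\<^sub>R x \<in> K"
proof -
  have *: "b *\<^sub>R x \<in> K" if "x \<in> K" "0 \<le> b" "b \<le> 1" for b x
    using convexD[OF sym_bodyD(3)[OF assms(1)] that(1) sym_body_0[OF assms(1)], of b "1 - b"] that by simp
  show ?thesis
    using *[OF assms(2), of a] *[OF sym_bodyD(4)[OF assms(1,2)], of "- a"] assms(3)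
    by (cases "0 \<le> a") auto
qed

lemma sym_body_measure_pos:
  assumes "sym_body n K" shows "0 < lvol n K"
proof (cases "n = 0")
  case True
  have "cube 0 1 \<subseteq> eball 0 1" using cube_subset_eball[of 1 0] by (auto simp: eball_def ip_def)
  moreover have "eball 0 r = eball 0 1" for r by (auto simp: eball_def ip_def)
  ultimately have "cube n 1 \<subseteq> K" using True sym_bodyD(5)[OF assms] by auto
  then have "lvol n (cube n 1) \<le> lvol n K"
    using sym_bodyD[OF assms] by (intro measure_mono_compact) auto
  then show ?thesis using True by (simp add: measure_cube)
next
  case False
  obtain r where r: "r > 0" "eball n r \<subseteq> K" using sym_bodyD(5)[OF assms] by blast
  have "0 < (2 * r / sqrt (real n)) ^ n" using r False by simp
  also have "\<dots> \<le> lvol n (eball n r)" using r False by (intro measure_eball_ge) auto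
  also have "\<dots> \<le> lvol n K"
    using sym_bodyD[OF assms] r by (intro measure_mono_compact) (auto simp: borel_closed closed_eball)
  finally show ?thesis .
qed

text \<open>The separating functional is the displacement from \<open>z\<close> to its nearest point in \<open>C\<close>.\<close>

lemma separation:
  assumes C: "compact C" "convex C" "C \<noteq> {}" "C \<subseteq> vecs n" and z: "z \<in> vecs n" "z \<notin> C"
  obtains w where "w \<in> vecs n" "\<And>c. c \<in> C \<Longrightarrow> ip n w c < ip n w z"
proof -
  have "continuous_on C (\<lambda>y. ip n (y - z) (y - z))"
    by (intro continuous_on_ip continuous_on_fun_diff continuous_on_id continuous_on_const)
  then obtain p where p: "p \<in> C" "\<And>y. y \<in> C \<Longrightarrow> ip n (p - z) (p - z) \<le> ip n (y - z) (y - z)"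
    using continuous_attains_inf[OF C(1,3)] by blast
  define w where "w = z - p"
  have w_in: "w \<in> vecs n" using p C z by (auto simp: w_def intro: vecs_diff)
  have "w \<noteq> 0" using p z by (auto simp: w_def)
  then have w_pos: "0 < ip n w w"
    using ip_eq_0_iff[OF w_in] ip_nonneg[of n w] by linarith
  have "ip n w c < ip n w z" if c: "c \<in> C" for c
  proof -
    define s where "s = ip n w (c - p)"
    define q where "q = ip n (c - p) (c - p)"
    have "s \<le> 0"
    proof (rule ccontr)
      assume "\<not> s \<le> 0"
      then have s: "s > 0" by simp
      have q0: "q \<ge> 0" by (simp add: q_def)
      define t where "t = min 1 (s / (q + 1))"
      have t: "0 < t" "t \<le> 1" "t * q \<le> s"
      proof -
        show "0 < t" "t \<le> 1" using s q0 by (auto simp: t_def)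
        have "t * q \<le> s / (q + 1) * q" using q0 by (intro mult_right_mono) (auto simp: t_def)
        also have "\<dots> \<le> s" using s q0 by (simp add: field_simps)
        finally show "t * q \<le> s" .
      qed
      have "(1 - t) *\<^sub>R p + t *\<^sub>R c \<in> C"
        using convexD[OF C(2) p(1) c, of "1 - t" t] t by auto
      then have "ip n (p - z) (p - z) \<le> ip n ((1 - t) *\<^sub>R p + t *\<^sub>R c - z) ((1 - t) *\<^sub>R p + t *\<^sub>R c - z)"
        by (rule p(2))
      moreover have e1: "(1 - t) *\<^sub>R p + t *\<^sub>R c - z = t *\<^sub>R (c - p) - w"
        by (simp add: w_def algebra_simps fun_eq_iff)
      moreover have e2: "p - z = - w" by (simp add: w_def)
      ultimately have "ip n (- w) (- w) \<le> ip n (t *\<^sub>R (c - p) - w) (t *\<^sub>R (c - p) - w)"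
        by (simp only:)
      moreover have "ip n (- w) (- w) = ip n w w"
        by (simp only: ip_minus_left ip_minus_right minus_minus)
      moreover have "ip n (t *\<^sub>R (c - p) - w) (t *\<^sub>R (c - p) - w) = t * t * q - 2 * t * s + ip n w w"
        by (simp only: ip_diff_left[of _ _ w] ip_diff_right[of _ _ _ w] ip_scale_left ip_scale_right
          q_def s_def ip_commute[of n "c - p" w]) (simp add: algebra_simps)
      ultimately have "0 \<le> t * t * q - 2 * t * s" by simp
      also have "\<dots> = t * (t * q - 2 * s)" by (simp add: algebra_simps)
      also have "\<dots> < 0" using t s by (intro mult_pos_neg) auto
      finally show False by simp
    qed
    moreover have "ip n w z = ip n w p + ip n w w" by (simp add: w_def ip_simps)
    ultimately show ?thesis using w_pos by (simp add: s_def ip_simps)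
  qed
  with w_in show ?thesis using that by blast
qed

lemma polar_subset: "polar n K \<subseteq> vecs n"
  by (auto simp: polar_def)

lemma closed_polar: "closed (polar n K)"
proof -
  have "polar n K = vecs n \<inter> (\<Inter>x\<in>K. {y. ip n x y \<le> 1})" by (auto simp: polar_def)
  moreover have "closed {y. ip n x y \<le> 1}" for x
    by (intro closed_Collect_le continuous_on_ip continuous_on_id continuous_on_const)
  ultimately show ?thesis using closed_vecs by (auto intro!: closed_INT)
qed

lemma convex_polar: "convex (polar n K)"
proof (rule convexI)
  fix x y u v assume xy: "x \<in> polar n K" "y \<in> polar n K" and uv: "0 \<le> (u::real)" "0 \<le> v" "u + v = 1"
  have "u * ip n k x + v * ip n k y \<le> 1" if "k \<in> K" for k
    using xy that uv convex_bound_le[of "ip n k x" 1 "ip n k y" u v] by (auto simp: polar_def)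
  with xy show "u *\<^sub>R x + v *\<^sub>R y \<in> polar n K"
    by (auto simp: polar_def ip_simps intro!: vecs_add vecs_scale)
qed

lemma eball_subset_polar:
  assumes "K \<subseteq> eball n \<rho>" "\<rho> > 0" shows "eball n (1 / \<rho>) \<subseteq> polar n K"
proof
  fix y assume y: "y \<in> eball n (1 / \<rho>)"
  have "ip n x y \<le> 1" if "x \<in> K" for x
  proof -
    have "(ip n x y)\<^sup>2 \<le> ip n x x * ip n y y" by (rule ip_Cauchy_Schwarz)
    also have "\<dots> \<le> \<rho>\<^sup>2 * (1 / \<rho>)\<^sup>2"
      using y that assms by (intro mult_mono) (auto simp: eball_def)
    also have "\<dots> = 1\<^sup>2" using assms(2) by (simp add: power2_eq_square)
    finally show ?thesis by (rule power2_le_imp_le) simp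
  qed
  with y show "y \<in> polar n K" by (auto simp: polar_def eball_def)
qed

lemma polar_subset_eball:
  assumes "eball n r \<subseteq> K" "r > 0" shows "polar n K \<subseteq> eball n (1 / r)"
proof
  fix y assume y: "y \<in> polar n K"
  then have y_in: "y \<in> vecs n" by (simp add: polar_def)
  show "y \<in> eball n (1 / r)"
  proof (cases "y = 0")
    case False
    define s where "s = sqrt (ip n y y)"
    have "ip n y y \<noteq> 0" using ip_eq_0_iff[OF y_in] False by simp
    then have "ip n y y > 0" using ip_nonneg[of n y] by linarith
    then have s: "s > 0" "ip n y y = s * s" by (auto simp: s_def)
    have "(r / s) *\<^sub>R y \<in> eball n r"
      using s y_in assms by (simp add: eball_def vecs_scale ip_simps power2_eq_square)
    then have "ip n ((r / s) *\<^sub>R y) y \<le> 1" using y assms by (auto simp: polar_def)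
    then have "r * s \<le> 1" using s by (simp add: ip_simps)
    then have "s \<le> 1 / r" using assms by (simp add: field_simps)
    then have "s\<^sup>2 \<le> (1 / r)\<^sup>2" using s by (intro power_mono) auto
    with s y_in show ?thesis by (simp add: eball_def power2_eq_square)
  qed simp
qed

lemma sym_body_polar:
  assumes "sym_body n K" shows "sym_body n (polar n K)"
proof -
  obtain r where r: "r > 0" "eball n r \<subseteq> K" using sym_bodyD(5)[OF assms] by blast
  obtain \<rho> where \<rho>: "0 < \<rho>" "K \<subseteq> eball n \<rho>"
    using compact_subset_eball[OF sym_bodyD(2,1)[OF assms]] .
  have "compact (polar n K)"
    using compact_Int_closed[OF compact_eball closed_polar, of n "1 / r" n K]
      polar_subset_eball[OF r(2,1)] by (simp add: Int_absorb1)
  moreover have "- y \<in> polar n K" if "y \<in> polar n K" for y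
  proof -
    have "ip n x (- y) \<le> 1" if "x \<in> K" for x
    proof -
      have "ip n (- x) y \<le> 1" using \<open>y \<in> polar n K\<close> sym_bodyD(4)[OF assms that] by (auto simp: polar_def)
      then show ?thesis by (simp add: ip_simps)
    qed
    with that show ?thesis by (auto simp: polar_def vecs_neg)
  qed
  ultimately show ?thesis
    using polar_subset convex_polar eball_subset_polar[OF \<rho>(2,1)] \<rho>(1)
    by (auto simp: sym_body_def intro!: exI[of _ "1 / \<rho>"])
qed

text \<open>
  A point \<open>z\<close> outside \<open>K\<close> is separated from \<open>K\<close> by a functional \<open>w\<close>; scaled by a number strictly between
  the maximum of \<open>w\<close> on \<open>K\<close> and its value at \<open>z\<close>, it lies in the polar body and excludes \<open>z\<close> from the bipolar.
\<close>

lemma bipolar: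
  assumes "sym_body n K" shows "polar n (polar n K) = K"
proof (intro set_eqI iffI)
  fix x assume "x \<in> K"
  then show "x \<in> polar n (polar n K)"
    using sym_bodyD(1)[OF assms] by (auto simp: polar_def ip_commute)
next
  fix z assume z: "z \<in> polar n (polar n K)"
  then have z_in: "z \<in> vecs n" by (simp add: polar_def)
  show "z \<in> K"
  proof (rule ccontr)
    assume "z \<notin> K"
    then obtain w where w: "w \<in> vecs n" "\<And>c. c \<in> K \<Longrightarrow> ip n w c < ip n w z"
      using separation[OF sym_bodyD(2,3)[OF assms] _ sym_bodyD(1)[OF assms] z_in] sym_body_0[OF assms] by blast
    have "continuous_on K (ip n w)" by (intro continuous_on_ip continuous_on_id continuous_on_const)
    then obtain m where m: "m \<in> K" "\<And>c. c \<in> K \<Longrightarrow> ip n w c \<le> ip n w m"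
      using continuous_attains_sup[OF sym_bodyD(2)[OF assms], of "ip n w"] sym_body_0[OF assms] by blast
    define h where "h = (ip n w m + ip n w z) / 2"
    have h: "ip n w m < h" "h < ip n w z" using w(2)[OF m(1)] by (auto simp: h_def)
    have "0 \<le> ip n w m" using m(2)[OF sym_body_0[OF assms]] by (simp add: ip_simps)
    with h have "h > 0" by simp
    have "(1 / h) *\<^sub>R w \<in> polar n K"
      using w(1) m(2) h \<open>h > 0\<close> by (fastforce simp: polar_def vecs_scale ip_simps ip_commute[of n w] field_simps)
    then have "ip n ((1 / h) *\<^sub>R w) z \<le> 1" using z by (auto simp: polar_def)
    with h \<open>h > 0\<close> show False by (simp add: ip_simps field_simps)
  qed
qed

text \<open>
  The image contains a ball because the inverse map sends the unit ball to a compact, hence bounded, set.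
\<close>

lemma sym_body_image:
  assumes "lin_iso n T" "sym_body n K" shows "sym_body n (T ` K)"
proof -
  note T = lin_isoD[OF assms(1)] and K = sym_bodyD[OF assms(2)]
  obtain S where S: "lin_iso n S" "\<And>x. x \<in> vecs n \<Longrightarrow> S (T x) = x"
    "\<And>x. x \<in> vecs n \<Longrightarrow> T (S x) = x"
    using lin_iso_inverse[OF assms(1)] by blast
  obtain r where r: "r > 0" "eball n r \<subseteq> K" using K(5) by blast
  have "compact (S ` eball n 1)"
    using lin_isoD(2)[OF S(1)] by (intro compact_continuous_image compact_eball) (auto elim: continuous_on_subset)
  then obtain M where M: "0 < M" "S ` eball n 1 \<subseteq> eball n M"
    using compact_subset_eball[of "S ` eball n 1" n] lin_isoD(6)[OF S(1)] by (auto simp: eball_def)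
  have "eball n (r / M) \<subseteq> T ` K"
  proof
    fix x assume x: "x \<in> eball n (r / M)"
    then have x_in: "x \<in> vecs n" by (simp add: eball_def)
    have "(M / r) *\<^sub>R x \<in> eball n 1" using scaleR_eball[OF x, of "M / r"] M r by simp
    then have "S ((M / r) *\<^sub>R x) \<in> eball n M" using M by blast
    then have "(r / M) *\<^sub>R ((M / r) *\<^sub>R S x) \<in> eball n (r / M * M)"
      by (intro scaleR_eball) (simp add: linear_cmul[OF lin_isoD(1)[OF S(1)]])
    then have "S x \<in> K" using M r by auto
    then show "x \<in> T ` K" using S(3)[OF x_in] by (metis image_eqI)
  qed
  moreover have "compact (T ` K)"
    using T(2) K(2) by (intro compact_continuous_image) (auto elim: continuous_on_subset)
  moreover have "- T x \<in> T ` K" if "x \<in> K" for x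
    using K(4)[OF that] linear_neg[OF T(1), of x] by (metis image_eqI)
  ultimately show ?thesis
    using K T(6) M r convex_linear_image[OF T(1) K(3)]
    by (auto simp: sym_body_def intro!: exI[of _ "r / M"])
qed

lemma polar_image:
  assumes T: "lin_iso n T" and S: "lin_iso n S"
    and adj: "\<And>x y. x \<in> vecs n \<Longrightarrow> y \<in> vecs n \<Longrightarrow> ip n (T x) y = ip n x (S y)"
    and K: "K \<subseteq> vecs n"
  shows "S ` polar n (T ` K) = polar n K"
proof -
  have iff: "y \<in> polar n (T ` K) \<longleftrightarrow> S y \<in> polar n K" if "y \<in> vecs n" for y
  proof -
    have "ip n (T x) y = ip n x (S y)" if "x \<in> K" for x
      using adj[of x y] K that \<open>y \<in> vecs n\<close> by auto
    then show ?thesis using that lin_isoD(6)[OF S that] by (auto simp: polar_def)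
  qed
  show ?thesis
  proof (intro set_eqI iffI)
    fix z assume z: "z \<in> polar n K"
    then obtain y where "y \<in> vecs n" "S y = z"
      using lin_isoD(5)[OF S] polar_subset[of n K] by (metis imageE subsetD)
    with z iff show "z \<in> S ` polar n (T ` K)" by blast
  next
    fix z assume "z \<in> S ` polar n (T ` K)"
    then obtain y where "y \<in> polar n (T ` K)" "z = S y" by blast
    with iff polar_subset show "z \<in> polar n K" by blast
  qed
qed

section \<open>A Rogers--Shephard inequality\<close>

lemma emeasure_leb_affine:
  assumes "a \<in> vecs n" "0 < c" "A \<in> sets borel" "A \<subseteq> vecs n"
  shows "(\<lambda>x. a + c *\<^sub>R x) ` A \<in> sets borel"
    "emeasure (leb n) ((\<lambda>x. a + c *\<^sub>R x) ` A) = ennreal (c ^ n) * emeasure (leb n) A"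
proof -
  let ?B = "(\<lambda>x. c *\<^sub>R x) ` A"
  note s = scalesD(3,4)[OF scales_scaleR[OF assms(2)] assms(3,4)]
  have m: "(\<lambda>x. x + - a) \<in> borel_measurable borel" by measurable
  have eq: "(\<lambda>x. a + c *\<^sub>R x) ` A = (\<lambda>x. x + - a) -` ?B"
    by (auto simp: image_iff algebra_simps)
  show "(\<lambda>x. a + c *\<^sub>R x) ` A \<in> sets borel"
    unfolding eq using measurable_sets[OF m s(1)] by simp
  have "emeasure (leb n) ?B = emeasure (distr (leb n) borel (\<lambda>x. x + - a)) ?B"
    using leb_translate[OF vecs_neg[OF assms(1)]] by simp
  also have "\<dots> = emeasure (leb n) ((\<lambda>x. x + - a) -` ?B)"
    using s by (subst emeasure_distr) auto
  finally show "emeasure (leb n) ((\<lambda>x. a + c *\<^sub>R x) ` A) = ennreal (c ^ n) * emeasure (leb n) A"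
    by (simp add: eq s)
qed

lemma measure_leb_affine:
  assumes "a \<in> vecs n" "0 < c" "A \<in> sets borel" "A \<subseteq> vecs n"
  shows "lvol n ((\<lambda>x. a + c *\<^sub>R x) ` A) = c ^ n * lvol n A"
  using emeasure_leb_affine(2)[OF assms] assms(2) by (simp add: measure_def enn2real_mult)

definition differences :: "(rvec \<times> rvec) set \<Rightarrow> rvec set"
  where "differences A = {x - y | x y. (x, y) \<in> A}"

lemma compact_differences:
  assumes "compact A" shows "compact (differences A)"
proof -
  have "differences A = (\<lambda>z. fst z - snd z) ` A" by (force simp: differences_def)
  moreover have "continuous_on A (\<lambda>z. fst z - snd z)"
    by (intro continuous_on_fun_diff continuous_on_fst continuous_on_snd continuous_on_id)
  ultimately show ?thesis using assms by (simp only: compact_continuous_image)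
qed

lemma differences_subset: "A \<subseteq> vecs n \<times> vecs n \<Longrightarrow> differences A \<subseteq> vecs n"
  by (auto simp: differences_def intro!: vecs_diff)

text \<open>
  With \<open>P\<close> the set of differences and \<open>S\<close> the diagonal section, the fibre of \<open>A\<close> over \<open>(p - q) / 2\<close>, where
  \<open>(p, q) \<in> A\<close>, contains the midpoints of \<open>(p, q)\<close> and the points of the diagonal section, hence a translate of
  \<open>S / 2\<close>. Integrating \<open>2\<^sup>-\<^sup>n vol S\<close> over \<open>P / 2\<close> gives \<open>4\<^sup>-\<^sup>n vol P vol S\<close>.
\<close>

lemma Rogers_Shephard:
  fixes A :: "(rvec \<times> rvec) set"
  assumes A: "compact A" "convex A" "A \<subseteq> vecs n \<times> vecs n"
  shows "emeasure (leb n) (differences A) * emeasure (leb n) {u. (u, u) \<in> A} \<le>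
    ennreal (4 ^ n) * emeasure (leb n \<Otimes>\<^sub>M leb n) A"
proof -
  let ?l = "leb n" and ?P = "differences A" and ?S = "{u. (u, u) \<in> A}"
  interpret sigma_finite_measure "leb n" by (rule sigma_finite_leb)
  interpret pair_sigma_finite "leb n" "leb n" ..
  have P: "compact ?P" by (rule compact_differences[OF A(1)])
  have P_sub: "?P \<subseteq> vecs n" by (rule differences_subset[OF A(3)])
  have Ab: "A \<in> sets (borel \<Otimes>\<^sub>M borel)" using borel_compact[OF A(1)] by (subst borel_prod)
  have [measurable]: "?P \<in> sets borel" using borel_compact[OF P] .
  have S_b: "?S \<in> sets borel"
  proof -
    have "(\<lambda>u. (u, u)) -` A \<inter> space borel \<in> sets borel"
      by (rule measurable_sets[OF _ Ab]) measurable
    then show ?thesis by (simp add: vimage_def)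
  qed
  have S_sub: "?S \<subseteq> vecs n" using A(3) by auto
  let ?i = "\<lambda>x y. indicator A (x, y) :: ennreal"
  have i_meas [measurable]: "(\<lambda>z. indicator A z :: ennreal) \<in> borel_measurable (borel \<Otimes>\<^sub>M borel)"
    using Ab by measurable
  let ?H = "(\<lambda>x. 0 + (1/2) *\<^sub>R x) ` ?P"
  have H: "?H \<in> sets borel" "emeasure ?l ?H = ennreal ((1/2) ^ n) * emeasure ?l ?P"
    using emeasure_leb_affine[OF vecs_0, of "1/2" ?P n] P_sub by auto
  \<comment> \<open>The fibre over \<open>z\<close> is parametrised by \<open>y\<close>, as the pairs \<open>(z + y, y)\<close>.\<close>
  have sl: "ennreal ((1/2) ^ n) * emeasure ?l ?S * indicator ?H z \<le> (\<integral>\<^sup>+y. ?i (z + y) y \<partial>?l)" for z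
  proof (cases "z \<in> ?H")
    case True
    then obtain p q where pq: "(p, q) \<in> A" "z = (1/2) *\<^sub>R (p - q)" by (auto simp: differences_def)
    let ?B = "(\<lambda>u. (1/2) *\<^sub>R q + (1/2) *\<^sub>R u) ` ?S"
    have q_in: "(1/2) *\<^sub>R q \<in> vecs n" using pq A(3) by (auto intro: vecs_scale)
    note B = emeasure_leb_affine[OF q_in, of "1/2" ?S, OF _ S_b S_sub]
    have "ennreal ((1/2) ^ n) * emeasure ?l ?S = (\<integral>\<^sup>+y. indicator ?B y \<partial>?l)"
      using B by simp
    also have "\<dots> \<le> (\<integral>\<^sup>+y. ?i (z + y) y \<partial>?l)"
    proof (rule nn_integral_mono)
      fix y
      have "(z + y, y) \<in> A" if y: "y \<in> ?B"
      proof -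
        obtain s where s: "(s, s) \<in> A" "y = (1/2) *\<^sub>R q + (1/2) *\<^sub>R s" using y by auto
        have "(1/2) *\<^sub>R (p, q) + (1/2) *\<^sub>R (s, s) \<in> A"
          using convexD[OF A(2) pq(1) s(1), of "1/2" "1/2"] by simp
        also have "(1/2) *\<^sub>R (p, q) + (1/2) *\<^sub>R (s, s) = (z + y, y)"
          by (simp add: pq(2) s(2) scaleR_diff_right)
        finally show ?thesis .
      qed
      then show "indicator ?B y \<le> ?i (z + y) y" by (auto simp: indicator_def)
    qed
    finally show ?thesis using True by simp
  qed simp
  have "emeasure ?l ?P * emeasure ?l ?S
      = ennreal (4 ^ n) * (\<integral>\<^sup>+z. ennreal ((1/2) ^ n) * emeasure ?l ?S * indicator ?H z \<partial>?l)"
  proof -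
    have "(4::real) ^ n * ((1/2) ^ n * (1/2) ^ n) = 1"
      by (simp add: power_mult_distrib[symmetric])
    then have "ennreal (4 ^ n) * (ennreal ((1/2) ^ n) * ennreal ((1/2) ^ n)) = 1"
      by (simp only: ennreal_mult[symmetric] zero_le_power zero_le_numeral zero_le_divide_1_iff mult_nonneg_nonneg ennreal_1)
    then have "x = ennreal (4 ^ n) * (ennreal ((1/2) ^ n) * ennreal ((1/2) ^ n)) * x" for x by simp
    from this[of "emeasure ?l ?P * emeasure ?l ?S"]
    have "emeasure ?l ?P * emeasure ?l ?S = ennreal (4 ^ n) *
        (ennreal ((1/2) ^ n) * emeasure ?l ?S * (ennreal ((1/2) ^ n) * emeasure ?l ?P))"
      by (simp only: mult_ac)
    moreover have "(\<integral>\<^sup>+z. ennreal ((1/2) ^ n) * emeasure ?l ?S * indicator ?H z \<partial>?l)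
        = ennreal ((1/2) ^ n) * emeasure ?l ?S * emeasure ?l ?H"
      using H(1) by (intro nn_integral_cmult_indicator) simp
    ultimately show ?thesis by (simp only: H(2))
  qed
  also have "\<dots> \<le> ennreal (4 ^ n) * (\<integral>\<^sup>+z. (\<integral>\<^sup>+y. ?i (z + y) y \<partial>?l) \<partial>?l)"
    by (intro mult_left_mono nn_integral_mono sl) simp
  also have "(\<integral>\<^sup>+z. (\<integral>\<^sup>+y. ?i (z + y) y \<partial>?l) \<partial>?l) = (\<integral>\<^sup>+y. (\<integral>\<^sup>+z. ?i (z + y) y \<partial>?l) \<partial>?l)"
    by (rule Fubini'[symmetric]) measurable
  also have "\<dots> = (\<integral>\<^sup>+y. (\<integral>\<^sup>+x. ?i x y \<partial>?l) \<partial>?l)"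
  proof (rule nn_integral_cong_AE, rule AE_mp[OF AE_leb_vecs], intro AE_I2 impI)
    fix y assume "y \<in> vecs n"
    then show "(\<integral>\<^sup>+z. ?i (z + y) y \<partial>?l) = (\<integral>\<^sup>+x. ?i x y \<partial>?l)"
      by (intro nn_integral_leb_translate) measurable
  qed
  also have "\<dots> = (\<integral>\<^sup>+x. (\<integral>\<^sup>+y. ?i x y \<partial>?l) \<partial>?l)"
    by (rule Fubini') measurable
  also have "\<dots> = emeasure (?l \<Otimes>\<^sub>M ?l) A"
  proof -
    have "sets (leb n \<Otimes>\<^sub>M leb n) = sets (borel \<Otimes>\<^sub>M borel)"
      by (intro sets_pair_measure_cong sets_leb)
    then have "A \<in> sets (leb n \<Otimes>\<^sub>M leb n)" using Ab by (simp only:)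
    from sigma_finite_measure.emeasure_pair_measure[OF sigma_finite_leb this]
    show ?thesis by (simp only:)
  qed
  finally show ?thesis .
qed

text \<open>
  The square \<open>K \<times> K\<close> has diagonal section \<open>K\<close>.
\<close>

lemma measure_difference_body:
  assumes K: "compact K" "convex K" "K \<subseteq> vecs n" and pos: "0 < lvol n K"
  shows "lvol n (differences (K \<times> K)) \<le> 4 ^ n * lvol n K"
proof -
  interpret sigma_finite_measure "leb n" by (rule sigma_finite_leb)
  let ?D = "differences (K \<times> K)"
  have D: "compact ?D" "?D \<subseteq> vecs n"
    using compact_differences[OF compact_Times[OF K(1,1)]] K(3) differences_subset[of "K \<times> K" n] by auto
  have "{u. (u, u) \<in> K \<times> K} = K" by auto
  then have "emeasure (leb n) ?D * emeasure (leb n) K \<le> ennreal (4 ^ n) * emeasure (leb n \<Otimes>\<^sub>M leb n) (K \<times> K)"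
    using Rogers_Shephard[OF compact_Times[OF K(1,1)] convex_Times[OF K(2,2)]] K(3) by auto
  also have "emeasure (leb n \<Otimes>\<^sub>M leb n) (K \<times> K) = emeasure (leb n) K * emeasure (leb n) K"
    using borel_compact[OF K(1)] by (intro emeasure_pair_measure_Times) auto
  finally have "lvol n ?D * lvol n K \<le> 4 ^ n * (lvol n K * lvol n K)"
    by (simp add: emeasure_eq_measure_compact[OF D] emeasure_eq_measure_compact[OF K(1,3)] ennreal_mult[symmetric])
  then show ?thesis using pos by simp
qed

section \<open>The volume product\<close>

definition vprod :: "nat \<Rightarrow> rvec set \<Rightarrow> real"
  where "vprod n K = lvol n K * lvol n (polar n K)"

text \<open>
  The set of pairs with \<open>\<parallel>x\<parallel>\<^sub>K\<^sup>2 + \<parallel>y\<parallel>\<^sub>M\<^sup>2 \<le> 1\<close> for the norms with unit balls \<open>K\<close> and \<open>M\<close>, as a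
  continuous image of a compact set.
\<close>

definition l2_sum :: "rvec set \<Rightarrow> rvec set \<Rightarrow> (rvec \<times> rvec) set"
  where "l2_sum K M = {(a *\<^sub>R x, sqrt (1 - a\<^sup>2) *\<^sub>R y) | a x y. a \<in> {0..1} \<and> x \<in> K \<and> y \<in> M}"

lemma l2_sumI:
  assumes "0 \<le> a" "0 \<le> b" "a\<^sup>2 + b\<^sup>2 \<le> 1" "x \<in> K" "y \<in> M" "sym_body n M"
  shows "(a *\<^sub>R x, b *\<^sub>R y) \<in> l2_sum K M"
proof -
  define c where "c = sqrt (1 - a\<^sup>2)"
  have "a\<^sup>2 \<le> 1" using assms(3) zero_le_power2[of b] by linarith
  then have a1: "a \<le> 1" using power2_le_imp_le[of a 1] by simp
  have bc: "b \<le> c" unfolding c_def using assms by (intro real_le_rsqrt) simp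
  have "\<exists>y'\<in>M. b *\<^sub>R y = c *\<^sub>R y'"
  proof (cases "c = 0")
    case True
    then show ?thesis using bc assms by (intro bexI[of _ y]) auto
  next
    case False
    then have "c > 0" using bc assms(2) by simp
    then show ?thesis
      using sym_body_scale[OF assms(6,5), of "b / c"] bc assms(2) by (intro bexI[of _ "(b / c) *\<^sub>R y"]) auto
  qed
  then show ?thesis using assms a1 by (auto simp: l2_sum_def c_def)
qed

lemma l2_sumE:
  assumes "z \<in> l2_sum K M"
  obtains a b x y where "0 \<le> a" "0 \<le> b" "a\<^sup>2 + b\<^sup>2 = 1" "x \<in> K" "y \<in> M" "z = (a *\<^sub>R x, b *\<^sub>R y)"
proof -
  obtain a x y where *: "a \<in> {0..1}" "x \<in> K" "y \<in> M" "z = (a *\<^sub>R x, sqrt (1 - a\<^sup>2) *\<^sub>R y)"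
    using assms by (auto simp: l2_sum_def)
  have "a\<^sup>2 \<le> 1" using *(1) by (simp add: power_le_one)
  then show ?thesis using * by (intro that[of a "sqrt (1 - a\<^sup>2)" x y]) auto
qed

lemma compact_l2_sum:
  assumes "compact K" "compact M" shows "compact (l2_sum K M)"
proof -
  let ?f = "\<lambda>t::real \<times> rvec \<times> rvec.
    (fst t *\<^sub>R fst (snd t), sqrt (1 - (fst t)\<^sup>2) *\<^sub>R snd (snd t))"
  have "l2_sum K M = ?f ` ({0..1} \<times> K \<times> M)" by (force simp: l2_sum_def)
  moreover have "continuous_on ({0..1} \<times> K \<times> M) ?f"
    by (intro continuous_on_Pair continuous_on_fun_scaleR continuous_intros)
  moreover have "compact ({0..1::real} \<times> K \<times> M)"
    by (intro compact_Times assms compact_Icc)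
  ultimately show ?thesis by (simp only: compact_continuous_image)
qed

lemma convex_cone_combination:
  fixes K :: "rvec set"
  assumes "convex K" "x \<in> K" "y \<in> K" "0 \<le> a" "0 \<le> b"
  shows "\<exists>z\<in>K. a *\<^sub>R x + b *\<^sub>R y = (a + b) *\<^sub>R z"
proof (cases "a + b = 0")
  case True
  then have "a = 0" "b = 0" using assms by auto
  then show ?thesis using assms by (intro bexI[of _ x]) auto
next
  case False
  then have "a / (a + b) + b / (a + b) = 1" by (simp add: add_divide_distrib[symmetric])
  then have "(a / (a + b)) *\<^sub>R x + (b / (a + b)) *\<^sub>R y \<in> K"
    using assms by (intro convexD) auto
  then show ?thesis using False
    by (intro bexI[of _ "(a / (a + b)) *\<^sub>R x + (b / (a + b)) *\<^sub>R y"]) (auto simp: scaleR_add_right)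
qed

lemma convex_l2_sum:
  assumes "convex K" "sym_body n M" shows "convex (l2_sum K M)"
proof (rule convexI)
  fix z z' :: "rvec \<times> rvec" and u v :: real
  assume z: "z \<in> l2_sum K M" "z' \<in> l2_sum K M" and uv: "0 \<le> u" "0 \<le> v" "u + v = 1"
  obtain a b x y where 1: "0 \<le> a" "0 \<le> b" "a\<^sup>2 + b\<^sup>2 = 1" "x \<in> K" "y \<in> M" "z = (a *\<^sub>R x, b *\<^sub>R y)"
    using z(1) by (rule l2_sumE)
  obtain a' b' x' y' where 2: "0 \<le> a'" "0 \<le> b'" "a'\<^sup>2 + b'\<^sup>2 = 1" "x' \<in> K" "y' \<in> M" "z' = (a' *\<^sub>R x', b' *\<^sub>R y')"
    using z(2) by (rule l2_sumE)
  obtain x'' where x'': "x'' \<in> K" "(u * a) *\<^sub>R x + (v * a') *\<^sub>R x' = (u * a + v * a') *\<^sub>R x''"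
    using convex_cone_combination[OF assms(1) 1(4) 2(4), of "u * a" "v * a'"] 1 2 uv by auto
  obtain y'' where y'': "y'' \<in> M" "(u * b) *\<^sub>R y + (v * b') *\<^sub>R y' = (u * b + v * b') *\<^sub>R y''"
    using convex_cone_combination[OF sym_bodyD(3)[OF assms(2)] 1(5) 2(5), of "u * b" "v * b'"] 1 2 uv by auto
  have "(u * a + v * a')\<^sup>2 + (u * b + v * b')\<^sup>2 =
      u\<^sup>2 * (a\<^sup>2 + b\<^sup>2) + v\<^sup>2 * (a'\<^sup>2 + b'\<^sup>2) + 2 * (u * v) * (a * a' + b * b')"
    by (simp add: power2_eq_square algebra_simps)
  also have "\<dots> \<le> u\<^sup>2 + v\<^sup>2 + 2 * (u * v) * 1"
  proof -
    have "0 \<le> (a - a')\<^sup>2 + (b - b')\<^sup>2" by simp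
    then have "a * a' + b * b' \<le> 1" using 1(3) 2(3) by (simp add: power2_eq_square algebra_simps)
    then have "2 * (u * v) * (a * a' + b * b') \<le> 2 * (u * v) * 1"
      using uv by (intro mult_left_mono) auto
    then show ?thesis using 1(3) 2(3) by simp
  qed
  also have "\<dots> = (u + v)\<^sup>2" by (simp add: power2_eq_square algebra_simps)
  finally have "(u * a + v * a')\<^sup>2 + (u * b + v * b')\<^sup>2 \<le> 1" using uv by simp
  then have "((u * a + v * a') *\<^sub>R x'', (u * b + v * b') *\<^sub>R y'') \<in> l2_sum K M"
    using 1 2 uv x'' y'' assms(2) by (intro l2_sumI) auto
  then show "u *\<^sub>R z + v *\<^sub>R z' \<in> l2_sum K M"
    using x''(2) y''(2) by (simp add: 1(6) 2(6))
qed

lemma one_plus_inverse_power_le_3: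
  assumes "0 < n" shows "(1 + 1 / real n) ^ n \<le> 3"
proof -
  have "(1 + 1 / real n) ^ n \<le> (exp (1 / real n)) ^ n"
    by (intro power_mono) (auto simp: add.commute exp_ge_add_one_self)
  also have "\<dots> = exp 1" using assms by (simp add: exp_of_nat_mult[symmetric])
  also have "\<dots> \<le> 3" by (rule exp_le)
  finally show ?thesis .
qed

text \<open>
  The \<open>\<ell>\<^sub>2\<close>-sum is much smaller than the product, by a factor of about \<open>2\<^sup>-\<^sup>n\<close>. Cut it into the \<open>n\<close> pieces where
  \<open>a\<^sup>2\<close> lies in \<open>[j / n, (j + 1) / n]\<close>: the piece is contained in \<open>\<surd>((j + 1) / n) K \<times> \<surd>(1 - j / n) M\<close>, and by
  the inequality of the means the product of the two factors is at most \<open>(1 + 1 / n) / 2\<close>.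
\<close>

lemma emeasure_l2_sum_le:
  assumes K: "sym_body n K" and M: "sym_body n M" and n: "0 < n"
  shows "emeasure (leb n \<Otimes>\<^sub>M leb n) (l2_sum K M) \<le>
    ennreal (3 * real n / 2 ^ n * (lvol n K * lvol n M))"
proof -
  interpret sigma_finite_measure "leb n" by (rule sigma_finite_leb)
  define c where "c j = sqrt ((real j + 1) / n)" for j :: nat
  define d where "d j = sqrt (1 - real j / n)" for j :: nat
  let ?K = "\<lambda>j. (\<lambda>x. 0 + c j *\<^sub>R x) ` K" and ?M = "\<lambda>j. (\<lambda>x. 0 + d j *\<^sub>R x) ` M"
  let ?k = "lvol n K" and ?m = "lvol n M"
  have Kb: "K \<in> sets borel" "M \<in> sets borel"
    using sym_bodyD(2) K M by (auto intro: borel_compact)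
  note KE = sym_bodyD(1)[OF K] and ME = sym_bodyD(1)[OF M]
  have cd: "0 < c j" "0 < d j" if "j < n" for j using that n by (auto simp: c_def d_def field_simps)
  have cover: "l2_sum K M \<subseteq> (\<Union>j<n. ?K j \<times> ?M j)"
  proof
    fix z assume "z \<in> l2_sum K M"
    then obtain a b x y where ab: "0 \<le> a" "0 \<le> b" "a\<^sup>2 + b\<^sup>2 = 1" "x \<in> K" "y \<in> M" "z = (a *\<^sub>R x, b *\<^sub>R y)"
      by (rule l2_sumE)
    \<comment> \<open>The minimum assigns the end point \<open>a = 1\<close> to the last piece.\<close>
    define j where "j = min (n - 1) (nat \<lfloor>real n * a\<^sup>2\<rfloor>)"
    have a2: "a\<^sup>2 \<le> 1" using ab(3) zero_le_power2[of b] by linarith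
    have j: "j < n" using n by (auto simp: j_def)
    have le: "real j \<le> real n * a\<^sup>2"
    proof -
      have "real j \<le> real (nat \<lfloor>real n * a\<^sup>2\<rfloor>)"
        unfolding j_def of_nat_le_iff by (rule min.cobounded2)
      also have "\<dots> \<le> real n * a\<^sup>2" by simp
      finally show ?thesis .
    qed
    have ge: "real n * a\<^sup>2 \<le> real j + 1"
    proof (cases "nat \<lfloor>real n * a\<^sup>2\<rfloor> \<le> n - 1")
      case True
      then have "real j = real (nat \<lfloor>real n * a\<^sup>2\<rfloor>)" by (simp add: j_def)
      then show ?thesis by simp
    next
      case False
      then have "real j + 1 = real n" using n by (simp add: j_def)
      then show ?thesis using a2 by (simp add: mult_left_le)
    qed
    have "a\<^sup>2 \<le> (real j + 1) / n" using ge n by (simp add: field_simps)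
    then have "a \<le> c j" unfolding c_def by (rule real_le_rsqrt)
    then have "(a / c j) *\<^sub>R x \<in> K" using cd[OF j] ab K by (intro sym_body_scale[of n]) auto
    moreover have "real j / n \<le> a\<^sup>2" using le n by (simp add: field_simps)
    then have "b\<^sup>2 \<le> 1 - real j / n" using ab(3) by linarith
    then have "b \<le> d j" unfolding d_def by (rule real_le_rsqrt)
    then have "(b / d j) *\<^sub>R y \<in> M" using cd[OF j] ab M by (intro sym_body_scale[of n]) auto
    moreover have "a *\<^sub>R x = 0 + c j *\<^sub>R ((a / c j) *\<^sub>R x)" "b *\<^sub>R y = 0 + d j *\<^sub>R ((b / d j) *\<^sub>R y)"
      using cd[OF j] by auto
    ultimately have "z \<in> ?K j \<times> ?M j" unfolding ab(6) by blast
    with j show "z \<in> (\<Union>j<n. ?K j \<times> ?M j)" by blast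
  qed
  have meas: "?K j \<in> sets borel" "?M j \<in> sets borel" if "j < n" for j
    using emeasure_leb_affine(1)[OF vecs_0] cd[OF that] Kb KE ME by blast+
  have piece: "emeasure (leb n \<Otimes>\<^sub>M leb n) (?K j \<times> ?M j) \<le> ennreal (3 / 2 ^ n * (?k * ?m))" if j: "j < n" for j
  proof -
    have "emeasure (leb n \<Otimes>\<^sub>M leb n) (?K j \<times> ?M j) = emeasure (leb n) (?K j) * emeasure (leb n) (?M j)"
      using meas[OF j] by (intro emeasure_pair_measure_Times) auto
    also have "emeasure (leb n) (?K j) = ennreal (c j ^ n * ?k)"
      using emeasure_leb_affine(2)[OF vecs_0 cd(1)[OF j] Kb(1) KE] cd[OF j]
      by (simp only: emeasure_eq_measure_compact[OF sym_bodyD(2,1)[OF K]] ennreal_mult'' measure_nonneg)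
    also have "emeasure (leb n) (?M j) = ennreal (d j ^ n * ?m)"
      using emeasure_leb_affine(2)[OF vecs_0 cd(2)[OF j] Kb(2) ME] cd[OF j]
      by (simp only: emeasure_eq_measure_compact[OF sym_bodyD(2,1)[OF M]] ennreal_mult'' measure_nonneg)
    also have "ennreal (c j ^ n * ?k) * ennreal (d j ^ n * ?m) = ennreal ((c j * d j) ^ n * (?k * ?m))"
      using cd[OF j] by (simp add: ennreal_mult[symmetric] power_mult_distrib mult_ac)
    also have "\<dots> \<le> ennreal (3 / 2 ^ n * (?k * ?m))"
    proof (intro ennreal_leI mult_right_mono)
      have "c j * d j \<le> (1 + 1 / real n) / 2"
      proof -
        have "c j * d j \<le> ((c j)\<^sup>2 + (d j)\<^sup>2) / 2"
          using sum_squares_bound[of "c j" "d j"] by simp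
        also have "(c j)\<^sup>2 + (d j)\<^sup>2 = 1 + 1 / real n"
          using j n by (simp add: c_def d_def add_divide_distrib)
        finally show ?thesis .
      qed
      then have "(c j * d j) ^ n \<le> ((1 + 1 / real n) / 2) ^ n" using cd[OF j] by (intro power_mono) auto
      also have "\<dots> \<le> 3 / 2 ^ n"
        using one_plus_inverse_power_le_3[OF n] by (simp add: power_divide divide_right_mono)
      finally show "(c j * d j) ^ n \<le> 3 / 2 ^ n" .
    qed auto
    finally show ?thesis .
  qed
  have "emeasure (leb n \<Otimes>\<^sub>M leb n) (l2_sum K M) \<le> emeasure (leb n \<Otimes>\<^sub>M leb n) (\<Union>j<n. ?K j \<times> ?M j)"
    using meas by (intro emeasure_mono cover) auto
  also have "\<dots> \<le> (\<Sum>j<n. emeasure (leb n \<Otimes>\<^sub>M leb n) (?K j \<times> ?M j))"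
    using meas by (intro emeasure_subadditive_finite) auto
  also have "\<dots> \<le> (\<Sum>j<n. ennreal (3 / 2 ^ n * (?k * ?m)))"
    by (intro sum_mono piece) auto
  also have "\<dots> = ennreal (3 * real n / 2 ^ n * (?k * ?m))"
    by (subst sum_ennreal) (auto simp: mult_ac)
  finally show ?thesis .
qed

text \<open>
  If \<open>u = a k = b m\<close> with \<open>k \<in> K\<close>, \<open>m\<close> in the polar body and \<open>a\<^sup>2 + b\<^sup>2 = 1\<close>, then
  \<open>\<bar>u\<bar>\<^sup>2 = a b \<langle>k, m\<rangle> \<le> 1 / 2\<close>. So the outer radius becomes absolute while the inner one only loses a
  factor \<open>\<surd>2\<close>, and the ratio of the radii drops from \<open>s\<^sup>2\<close> to \<open>s\<close>.
\<close>

lemma sym_body_l2_section: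
  assumes K: "sym_body n K" and s: "0 < s" "eball n (1 / s) \<subseteq> K" "K \<subseteq> eball n s"
  shows "sym_body n {u. (u, u) \<in> l2_sum K (polar n K)}" (is "sym_body n ?S")
    "eball n (1 / (sqrt 2 * s)) \<subseteq> {u. (u, u) \<in> l2_sum K (polar n K)}"
    "{u. (u, u) \<in> l2_sum K (polar n K)} \<subseteq> eball n (1 / sqrt 2)"
proof -
  let ?M = "polar n K"
  have M: "sym_body n ?M" by (rule sym_body_polar[OF K])
  let ?A = "l2_sum K ?M"
  have sub: "?S \<subseteq> vecs n"
    using sym_bodyD(1)[OF K] by (auto elim!: l2_sumE intro!: vecs_scale)
  have "compact (?A \<inter> {z. fst z = snd z})"
    by (intro compact_Int_closed compact_l2_sum sym_bodyD(2)[OF K] sym_bodyD(2)[OF M] closed_Collect_eq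
        continuous_on_fst continuous_on_snd continuous_on_id)
  then have "compact (fst ` (?A \<inter> {z. fst z = snd z}))"
    by (intro compact_continuous_image continuous_on_fst continuous_on_id)
  also have "fst ` (?A \<inter> {z. fst z = snd z}) = ?S" by (force simp: image_iff)
  finally have "compact ?S" .
  moreover have "convex ?S"
  proof (rule convexI)
    fix x y :: "nat \<Rightarrow> real" and u v :: real
    assume "x \<in> ?S" "y \<in> ?S" and uv: "0 \<le> u" "0 \<le> v" "u + v = 1"
    then have "u *\<^sub>R (x, x) + v *\<^sub>R (y, y) \<in> ?A"
      by (intro convexD convex_l2_sum[OF sym_bodyD(3)[OF K] M]) auto
    then show "u *\<^sub>R x + v *\<^sub>R y \<in> ?S" by simp
  qed
  moreover have "- x \<in> ?S" if "x \<in> ?S" for x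
  proof -
    have "(x, x) \<in> ?A" using that by simp
    then obtain a b k m where *: "0 \<le> a" "0 \<le> b" "a\<^sup>2 + b\<^sup>2 = 1" "k \<in> K" "m \<in> ?M" "(x, x) = (a *\<^sub>R k, b *\<^sub>R m)"
      by (rule l2_sumE)
    have "(a *\<^sub>R (- k), b *\<^sub>R (- m)) \<in> ?A"
      using * sym_bodyD(4)[OF K] sym_bodyD(4)[OF M] M by (intro l2_sumI[where n = n]) auto
    moreover have "a *\<^sub>R (- k) = - x" "b *\<^sub>R (- m) = - x"
      using *(6) scaleR_minus_right[of a k] scaleR_minus_right[of b m] by (metis prod.inject)+
    ultimately show ?thesis by (simp only: mem_Collect_eq)
  qed
  moreover show ball: "eball n (1 / (sqrt 2 * s)) \<subseteq> ?S"
  proof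
    fix x assume x: "x \<in> eball n (1 / (sqrt 2 * s))"
    have "sqrt 2 *\<^sub>R x \<in> eball n (1 / s)" using scaleR_eball[OF x, of "sqrt 2"] by simp
    then have "sqrt 2 *\<^sub>R x \<in> K" "sqrt 2 *\<^sub>R x \<in> ?M"
      using s eball_subset_polar[OF s(3,1)] by auto
    then have "((1 / sqrt 2) *\<^sub>R (sqrt 2 *\<^sub>R x), (1 / sqrt 2) *\<^sub>R (sqrt 2 *\<^sub>R x)) \<in> ?A"
      using M by (intro l2_sumI[where n = n]) (auto simp: power_divide)
    then show "x \<in> ?S" by simp
  qed
  ultimately show "sym_body n ?S"
    using sub s unfolding sym_body_def
    by (intro conjI ballI exI[of _ "1 / (sqrt 2 * s)"]) auto
  show "?S \<subseteq> eball n (1 / sqrt 2)"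
  proof
    fix x assume x: "x \<in> ?S"
    then have "(x, x) \<in> ?A" by simp
    then obtain a b k m where **: "0 \<le> a" "0 \<le> b" "a\<^sup>2 + b\<^sup>2 = 1" "k \<in> K" "m \<in> ?M"
        "(x, x) = (a *\<^sub>R k, b *\<^sub>R m)"
      by (rule l2_sumE)
    then have *: "0 \<le> a" "0 \<le> b" "a\<^sup>2 + b\<^sup>2 = 1" "k \<in> K" "m \<in> ?M" "x = a *\<^sub>R k" "x = b *\<^sub>R m"
      by auto
    have "ip n x x = ip n (a *\<^sub>R k) (b *\<^sub>R m)" using *(6,7) by simp
    also have "\<dots> = a * b * ip n k m" by (simp add: ip_simps)
    also have "\<dots> \<le> a * b * 1" using * by (intro mult_left_mono) (auto simp: polar_def)
    also have "\<dots> \<le> (a\<^sup>2 + b\<^sup>2) / 2" using sum_squares_bound[of a b] by simp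
    finally show "x \<in> eball n (1 / sqrt 2)"
      using x sub *(3) by (auto simp: eball_def power_divide)
  qed
qed

text \<open>
  For a functional \<open>w\<close> that separates \<open>z\<close> from the projection, let \<open>\<alpha>\<close> and \<open>\<beta>\<close> be its maxima on \<open>K\<close> and on the
  polar body. Its maximum on the projection is \<open>h = \<surd>(\<alpha>\<^sup>2 + \<beta>\<^sup>2)\<close>. Since \<open>w / \<alpha>\<close> lies in the polar body and
  \<open>w / \<beta>\<close> in \<open>K\<close>, the point \<open>w / h\<close> belongs to the section, which bounds \<open>\<langle>w, z\<rangle>\<close> by \<open>h\<close> for \<open>z\<close> in
  the polar of the section.
\<close>

lemma polar_l2_section_subset:
  assumes K: "sym_body n K"
  shows "polar n {u. (u, u) \<in> l2_sum K (polar n K)} \<subseteq> differences (l2_sum K (polar n K))"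
proof
  let ?M = "polar n K"
  have M: "sym_body n ?M" by (rule sym_body_polar[OF K])
  let ?A = "l2_sum K ?M"
  let ?P = "differences ?A"
  fix z assume z: "z \<in> polar n {u. (u, u) \<in> ?A}"
  then have z_in: "z \<in> vecs n" by (simp add: polar_def)
  have diffI: "a *\<^sub>R k + b *\<^sub>R m \<in> ?P" if "0 \<le> a" "0 \<le> b" "a\<^sup>2 + b\<^sup>2 \<le> 1" "k \<in> K" "m \<in> ?M" for a b k m
  proof -
    have "(a *\<^sub>R k, b *\<^sub>R (- m)) \<in> ?A"
      using that sym_bodyD(4)[OF M] M by (intro l2_sumI[where n = n]) auto
    then have "a *\<^sub>R k - b *\<^sub>R (- m) \<in> ?P" unfolding differences_def by blast
    then show ?thesis by simp
  qed
  show "z \<in> ?P"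
  proof (rule ccontr)
    assume nz: "z \<notin> ?P"
    have A_sub: "?A \<subseteq> vecs n \<times> vecs n"
      using sym_bodyD(1)[OF K] sym_bodyD(1)[OF M] by (auto elim!: l2_sumE intro!: vecs_scale)
    have "compact ?P"
      by (intro compact_differences compact_l2_sum sym_bodyD(2)[OF K] sym_bodyD(2)[OF M])
    moreover have "convex ?P"
    proof (rule convexI)
      fix x y :: "nat \<Rightarrow> real" and u v :: real
      assume "x \<in> ?P" "y \<in> ?P" and uv: "0 \<le> u" "0 \<le> v" "u + v = 1"
      then obtain p q p' q' where pq: "(p, q) \<in> ?A" "(p', q') \<in> ?A" "x = p - q" "y = p' - q'"
        by (auto simp: differences_def)
      have "u *\<^sub>R (p, q) + v *\<^sub>R (p', q') \<in> ?A"
        by (intro convexD convex_l2_sum[OF sym_bodyD(3)[OF K] M] pq uv)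
      then have "(u *\<^sub>R p + v *\<^sub>R p', u *\<^sub>R q + v *\<^sub>R q') \<in> ?A" by simp
      then have "(u *\<^sub>R p + v *\<^sub>R p') - (u *\<^sub>R q + v *\<^sub>R q') \<in> ?P" unfolding differences_def by blast
      also have "(u *\<^sub>R p + v *\<^sub>R p') - (u *\<^sub>R q + v *\<^sub>R q') = u *\<^sub>R x + v *\<^sub>R y"
        by (simp add: pq scaleR_diff_right)
      finally show "u *\<^sub>R x + v *\<^sub>R y \<in> ?P" .
    qed
    moreover have "0 \<in> ?P" using diffI[of 0 0 0 0] sym_body_0[OF K] sym_body_0[OF M] by simp
    ultimately obtain w where w: "w \<in> vecs n" "\<And>p. p \<in> ?P \<Longrightarrow> ip n w p < ip n w z"
      using separation[where C = ?P and n = n and z = z] differences_subset[OF A_sub] z_in nz by blast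
    have w0: "w \<noteq> 0" using w(2)[OF \<open>0 \<in> ?P\<close>] by (auto simp: ip_simps)
    then have ww: "0 < ip n w w"
      using ip_eq_0_iff[OF w(1)] ip_nonneg[of n w] by linarith
    have support: "\<exists>h>0. \<exists>l\<in>L. ip n w l = h \<and> (1 / h) *\<^sub>R w \<in> polar n L" if L: "sym_body n L" for L
    proof -
      have "continuous_on L (ip n w)" by (intro continuous_on_ip continuous_on_id continuous_on_const)
      then obtain l where l: "l \<in> L" "\<And>c. c \<in> L \<Longrightarrow> ip n w c \<le> ip n w l"
        using continuous_attains_sup[OF sym_bodyD(2)[OF L], of "ip n w"] sym_body_0[OF L] by blast
      obtain r where r: "r > 0" "eball n r \<subseteq> L" using sym_bodyD(5)[OF L] by blast
      have "(r / sqrt (ip n w w)) *\<^sub>R w \<in> eball n r"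
        using ww w(1) by (simp add: eball_def vecs_scale ip_simps power2_eq_square)
      then have "ip n w ((r / sqrt (ip n w w)) *\<^sub>R w) \<le> ip n w l" using r l(2) by blast
      moreover have "0 < ip n w ((r / sqrt (ip n w w)) *\<^sub>R w)" using ww r by (simp add: ip_simps)
      ultimately have h: "0 < ip n w l" by linarith
      have "(1 / ip n w l) *\<^sub>R w \<in> polar n L"
        using w(1) h l(2) by (auto simp: polar_def vecs_scale ip_simps ip_commute[of n _ w])
      with h l show ?thesis by blast
    qed
    obtain \<alpha> k where \<alpha>: "\<alpha> > 0" "k \<in> K" "ip n w k = \<alpha>" "(1 / \<alpha>) *\<^sub>R w \<in> ?M"
      using support[OF K] by blast
    obtain \<beta> m where \<beta>: "\<beta> > 0" "m \<in> ?M" "ip n w m = \<beta>" "(1 / \<beta>) *\<^sub>R w \<in> K"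
      using support[OF M] bipolar[OF K] by auto
    define h where "h = sqrt (\<alpha>\<^sup>2 + \<beta>\<^sup>2)"
    have h2: "h\<^sup>2 = \<alpha>\<^sup>2 + \<beta>\<^sup>2" by (simp add: h_def)
    have h: "h > 0" using \<alpha> \<beta> by (simp add: h_def add_pos_pos)
    have unit: "(\<alpha> / h)\<^sup>2 + (\<beta> / h)\<^sup>2 \<le> 1"
      using h by (simp add: power_divide add_divide_distrib[symmetric] h2[symmetric])
    have "(\<alpha> / h) *\<^sub>R k + (\<beta> / h) *\<^sub>R m \<in> ?P" using unit \<alpha> \<beta> h by (intro diffI) auto
    then have "ip n w ((\<alpha> / h) *\<^sub>R k + (\<beta> / h) *\<^sub>R m) < ip n w z" by (rule w(2))
    moreover have "ip n w ((\<alpha> / h) *\<^sub>R k + (\<beta> / h) *\<^sub>R m) = (\<alpha>\<^sup>2 + \<beta>\<^sup>2) / h"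
      by (simp add: ip_simps \<alpha>(3) \<beta>(3) power2_eq_square add_divide_distrib)
    moreover have "(\<alpha>\<^sup>2 + \<beta>\<^sup>2) / h = h" using h unfolding h2[symmetric] by (simp add: power2_eq_square)
    ultimately have "h < ip n w z" by simp
    have "((\<beta> / h) *\<^sub>R ((1 / \<beta>) *\<^sub>R w), (\<alpha> / h) *\<^sub>R ((1 / \<alpha>) *\<^sub>R w)) \<in> ?A"
      using unit \<alpha> \<beta> h M by (intro l2_sumI[where n = n]) (auto simp: add.commute)
    then have "((1 / h) *\<^sub>R w, (1 / h) *\<^sub>R w) \<in> ?A" using \<alpha> \<beta> by simp
    then have "ip n ((1 / h) *\<^sub>R w) z \<le> 1" using z by (auto simp: polar_def)
    then have "ip n w z \<le> h" using h by (simp add: ip_simps)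
    with \<open>h < ip n w z\<close> show False by simp
  qed
qed

lemma vprod_l2_section_le:
  assumes K: "sym_body n K" and n: "0 < n" and s: "0 < s" "eball n (1 / s) \<subseteq> K" "K \<subseteq> eball n s"
  shows "vprod n {u. (u, u) \<in> l2_sum K (polar n K)} \<le> 3 * real n * 2 ^ n * vprod n K"
proof -
  let ?M = "polar n K"
  have M: "sym_body n ?M" by (rule sym_body_polar[OF K])
  let ?A = "l2_sum K ?M"
  let ?S = "{u. (u, u) \<in> ?A}" and ?P = "differences ?A"
  have S: "sym_body n ?S" by (rule sym_body_l2_section(1)[OF K s])
  have A: "compact ?A" "convex ?A" "?A \<subseteq> vecs n \<times> vecs n"
    using sym_bodyD(1)[OF K] sym_bodyD(1)[OF M]
    by (auto elim!: l2_sumE intro!: vecs_scale compact_l2_sum convex_l2_sum[where n = n]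
        sym_bodyD(2,3)[OF K] sym_bodyD(2)[OF M] M)
  have P: "compact ?P" "?P \<subseteq> vecs n"
    by (intro compact_differences differences_subset A)+
  have "emeasure (leb n) ?P * emeasure (leb n) ?S \<le> ennreal (4 ^ n) * emeasure (leb n \<Otimes>\<^sub>M leb n) ?A"
    by (rule Rogers_Shephard[OF A])
  also have "\<dots> \<le> ennreal (4 ^ n) * ennreal (3 * real n / 2 ^ n * vprod n K)"
    unfolding vprod_def by (intro mult_left_mono emeasure_l2_sum_le K M n) auto
  also have "\<dots> = ennreal (3 * real n * (4 ^ n / 2 ^ n) * vprod n K)"
    by (simp add: ennreal_mult''[symmetric] vprod_def mult_ac)
  also have "(4::real) ^ n / 2 ^ n = 2 ^ n" by (simp add: power_divide[symmetric])
  finally have "lvol n ?P * lvol n ?S \<le> 3 * real n * 2 ^ n * vprod n K"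
    by (simp add: emeasure_eq_measure_compact[OF P] emeasure_eq_measure_compact[OF sym_bodyD(2,1)[OF S]]
        ennreal_mult''[symmetric] vprod_def)
  moreover have "lvol n (polar n ?S) \<le> lvol n ?P"
    by (intro measure_mono_compact polar_l2_section_subset K P)
      (simp add: borel_closed closed_polar)
  then have "lvol n ?S * lvol n (polar n ?S) \<le> lvol n ?S * lvol n ?P"
    by (intro mult_left_mono) auto
  ultimately show ?thesis by (simp add: vprod_def mult.commute)
qed

lemma vprod_scale:
  assumes K: "sym_body n K" and c: "0 < c"
  shows "sym_body n ((\<lambda>x. c *\<^sub>R x) ` K)" "vprod n ((\<lambda>x. c *\<^sub>R x) ` K) = vprod n K"
proof -
  have c': "0 < 1 / c" using c by simp
  note T = scales_scaleR[OF c, of n] and S = scales_scaleR[OF c', of n]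
  show "sym_body n ((\<lambda>x. c *\<^sub>R x) ` K)" by (rule sym_body_image[OF scalesD(1)[OF T] K])
  have "(\<lambda>x. c *\<^sub>R x) ` polar n ((\<lambda>x. c *\<^sub>R x) ` K) = polar n K"
    by (rule polar_image[OF scalesD(1)[OF T] scalesD(1)[OF T] _ sym_bodyD(1)[OF K]]) (simp add: ip_simps)
  then have "lvol n (polar n K) = c ^ n * lvol n (polar n ((\<lambda>x. c *\<^sub>R x) ` K))"
    using scalesD(5)[OF T, of "polar n ((\<lambda>x. c *\<^sub>R x) ` K)"]
    by (simp add: borel_closed closed_polar polar_subset)
  moreover have "lvol n ((\<lambda>x. c *\<^sub>R x) ` K) = c ^ n * lvol n K"
    using sym_bodyD(1,2)[OF K] by (intro scalesD(5)[OF T] borel_compact)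
  ultimately show "vprod n ((\<lambda>x. c *\<^sub>R x) ` K) = vprod n K" by (simp add: vprod_def)
qed

text \<open>
  Kuperberg's iteration. Each step scales the body so that its radii are \<open>1 / \<surd>R\<close> and \<open>\<surd>R\<close> and passes to the
  diagonal section, which replaces \<open>R\<close> by \<open>\<surd>R\<close>. Once \<open>R \<le> 2\<close>, the inscribed balls of the body and of its
  polar suffice.
\<close>

lemma vprod_lower_bound:
  assumes "sym_body n K" "0 < n" "0 < a" "0 < R" "eball n a \<subseteq> K" "K \<subseteq> eball n (a * R)" "R \<le> 2 ^ 2 ^ k"
  shows "(2 / real n) ^ n \<le> (3 * real n * 2 ^ n) ^ k * vprod n K"
  using assms
proof (induction k arbitrary: K a R)
  case 0
  have aR: "0 < a * R" using 0 by simp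
  have "(2 / real n) ^ n \<le> (4 / (real n * R)) ^ n"
    using 0 by (intro power_mono) (auto simp: field_simps)
  also have "\<dots> = (2 * a / sqrt (real n) * (2 * (1 / (a * R)) / sqrt (real n))) ^ n"
    using 0 by (simp add: field_simps)
  also have "\<dots> = (2 * a / sqrt (real n)) ^ n * (2 * (1 / (a * R)) / sqrt (real n)) ^ n"
    by (rule power_mult_distrib)
  also have "\<dots> \<le> lvol n K * lvol n (polar n K)"
  proof (intro mult_mono)
    show "(2 * a / sqrt (real n)) ^ n \<le> lvol n K"
      using measure_eball_ge[OF 0(3,2)] measure_mono_compact[OF 0(5) _ sym_bodyD(2,1)[OF 0(1)]]
      by (simp add: borel_closed closed_eball)
    have "0 < 1 / (a * R)" using aR by simp
    note P = sym_body_polar[OF 0(1)]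
    show "(2 * (1 / (a * R)) / sqrt (real n)) ^ n \<le> lvol n (polar n K)"
      using measure_eball_ge[OF \<open>0 < 1 / (a * R)\<close> 0(2)]
        measure_mono_compact[OF eball_subset_polar[OF 0(6) aR] _ sym_bodyD(2,1)[OF P]]
      by (simp add: borel_closed closed_eball)
  qed (use 0 in auto)
  finally show ?case by (simp add: vprod_def)
next
  case (Suc k)
  define s where "s = sqrt R"
  have s: "0 < s" "R = s * s" using Suc.prems by (auto simp: s_def)
  define c where "c = 1 / (a * s)"
  have c: "0 < c" using Suc.prems s by (simp add: c_def)
  let ?K = "(\<lambda>x. c *\<^sub>R x) ` K"
  note K' = vprod_scale[OF Suc.prems(1) c]
  have sub1: "eball n (1 / s) \<subseteq> ?K"
  proof
    fix x assume x: "x \<in> eball n (1 / s)"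
    have "(1 / c) *\<^sub>R x \<in> eball n (1 / c * (1 / s))" by (rule scaleR_eball[OF x])
    also have "1 / c * (1 / s) = a" using s Suc.prems by (simp add: c_def)
    finally have "(1 / c) *\<^sub>R x \<in> K" using Suc.prems by blast
    then show "x \<in> ?K" using c by (intro image_eqI[of _ _ "(1 / c) *\<^sub>R x"]) auto
  qed
  have sub2: "?K \<subseteq> eball n s"
  proof
    fix x assume "x \<in> ?K"
    then obtain y where y: "y \<in> K" "x = c *\<^sub>R y" by blast
    have "c *\<^sub>R y \<in> eball n (c * (a * R))" using y Suc.prems by (intro scaleR_eball) auto
    moreover have "c * (a * R) = s" using s Suc.prems by (simp add: c_def)
    ultimately show "x \<in> eball n s" unfolding y(2) by (simp only:)
  qed
  let ?S = "{u. (u, u) \<in> l2_sum ?K (polar n ?K)}"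
  note S = sym_body_l2_section[OF K'(1) s(1) sub1 sub2]
  have "s\<^sup>2 \<le> (2 ^ 2 ^ k)\<^sup>2"
    using Suc.prems(7) s by (simp add: power2_eq_square power_add[symmetric] mult_2)
  then have "s \<le> 2 ^ 2 ^ k" by (rule power2_le_imp_le) simp
  then have "(2 / real n) ^ n \<le> (3 * real n * 2 ^ n) ^ k * vprod n ?S"
    using s S by (intro Suc.IH[of ?S "1 / (sqrt 2 * s)" s] Suc.prems(2)) auto
  also have "\<dots> \<le> (3 * real n * 2 ^ n) ^ k * (3 * real n * 2 ^ n * vprod n ?K)"
    by (intro mult_left_mono vprod_l2_section_le[OF K'(1) Suc.prems(2) s(1) sub1 sub2]) simp
  finally show ?case by (simp add: K'(2) mult_ac)
qed

section \<open>Averages over a body\<close>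

definition avg :: "nat \<Rightarrow> rvec set \<Rightarrow> (rvec \<Rightarrow> real) \<Rightarrow> real"
  where "avg n L f = (\<integral>x. indicator L x * f x \<partial>leb n) / lvol n L"

definition isotropic :: "nat \<Rightarrow> rvec set \<Rightarrow> bool"
  where "isotropic n L \<longleftrightarrow> sym_body n L \<and>
    (\<forall>i<n. \<forall>j<n. avg n L (\<lambda>x. x i * x j) = (if i = j then 1 else 0))"

lemma integrable_on_body:
  assumes "sym_body n L" "continuous_on UNIV f"
  shows "integrable (leb n) (\<lambda>x. indicator L x * f x :: real)"
proof -
  note L = sym_bodyD[OF assms(1)]
  have "compact (f ` L)"
    using assms(2) L(2) by (intro compact_continuous_image) (auto elim: continuous_on_subset)
  then have "bounded (f ` L)" by (rule compact_imp_bounded)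
  then obtain B where B: "\<And>x. x \<in> L \<Longrightarrow> norm (f x) \<le> B" unfolding bounded_iff by blast
  have [measurable]: "f \<in> borel_measurable borel" using assms(2) by (rule borel_measurable_continuous_onI)
  have "integrable (leb n) (\<lambda>x. indicator L x *\<^sub>R f x)"
    using B emeasure_compact_finite[OF L(2,1)] borel_compact[OF L(2)]
    by (intro integrableI_bounded_set_indicator[where B = B]) auto
  then show ?thesis by simp
qed

lemma avg_add:
  assumes "sym_body n L" "continuous_on UNIV f" "continuous_on UNIV g"
  shows "avg n L (\<lambda>x. f x + g x) = avg n L f + avg n L g"
  using integrable_on_body[OF assms(1,2)] integrable_on_body[OF assms(1,3)]
  by (simp add: avg_def distrib_left Bochner_Integration.integral_add add_divide_distrib)

lemma avg_cmult: "avg n L (\<lambda>x. c * f x) = c * avg n L f"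
proof -
  have "(\<lambda>x. indicator L x * (c * f x)) = (\<lambda>x. c * (indicator L x * f x))" by (simp add: mult_ac)
  then show ?thesis by (simp add: avg_def)
qed

lemma avg_sum:
  assumes "sym_body n L" "\<And>i. i \<in> I \<Longrightarrow> continuous_on UNIV (f i)"
  shows "avg n L (\<lambda>x. \<Sum>i\<in>I. f i x) = (\<Sum>i\<in>I. avg n L (f i))"
proof -
  have "(\<integral>x. indicator L x * (\<Sum>i\<in>I. f i x) \<partial>leb n) = (\<Sum>i\<in>I. \<integral>x. indicator L x * f i x \<partial>leb n)"
    unfolding sum_distrib_left
    by (rule Bochner_Integration.integral_sum) (intro integrable_on_body assms)
  then show ?thesis by (simp add: avg_def sum_divide_distrib)
qed

lemma avg_lower_bound:
  assumes "sym_body n L" "continuous_on UNIV f" "\<And>x. x \<in> L \<Longrightarrow> 0 \<le> f x"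
    "H \<in> sets borel" "H \<subseteq> L" "\<And>x. x \<in> H \<Longrightarrow> t \<le> f x"
  shows "t * lvol n H \<le> avg n L f * lvol n L"
proof -
  note L = sym_bodyD[OF assms(1)]
  have fin: "emeasure (leb n) H < top"
    using emeasure_mono[OF assms(5), of "leb n"] emeasure_compact_finite[OF L(2,1)] borel_compact[OF L(2)]
    by (auto intro: le_less_trans)
  have "t * lvol n H = (\<integral>x. t * indicator H x \<partial>leb n)"
    using fin assms(4) by simp
  also have "\<dots> \<le> (\<integral>x. indicator L x * f x \<partial>leb n)"
  proof (rule integral_mono)
    show "integrable (leb n) (\<lambda>x. t * indicator H x)"
      using fin assms(4) by (intro integrable_mult_right) (auto simp: less_top)
    show "integrable (leb n) (\<lambda>x. indicator L x * f x)" by (rule integrable_on_body[OF assms(1,2)])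
    show "t * indicator H x \<le> indicator L x * f x" for x
      using assms(3,5,6) by (auto simp: indicator_def)
  qed
  also have "\<dots> = avg n L f * lvol n L"
    using sym_body_measure_pos[OF assms(1)] by (simp add: avg_def)
  finally show ?thesis .
qed

lemma avg_attained:
  assumes "sym_body n L" "continuous_on UNIV f" obtains x where "x \<in> L" "avg n L f \<le> f x"
proof -
  note L = sym_bodyD[OF assms(1)]
  have "continuous_on L f" using assms(2) by (auto elim: continuous_on_subset)
  then obtain m where m: "m \<in> L" "\<And>x. x \<in> L \<Longrightarrow> f x \<le> f m"
    using continuous_attains_sup[OF L(2), of f] sym_body_0[OF assms(1)] by blast
  have "(\<integral>x. indicator L x * f x \<partial>leb n) \<le> (\<integral>x. indicator L x * f m \<partial>leb n)"
    using m(2) by (intro integral_mono integrable_on_body[OF assms(1)] assms(2) continuous_on_const)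
      (auto simp: indicator_def)
  also have "\<dots> = f m * lvol n L"
    by simp
  finally have "avg n L f \<le> f m"
    using sym_body_measure_pos[OF assms(1)] by (simp add: avg_def divide_le_eq)
  with m(1) show ?thesis using that by blast
qed

text \<open>
  Change of variables for a linear bijection, in a form that yields integrals as well as volumes.
\<close>

lemma leb_eq_density_distr:
  assumes "scales n T c"
  shows "leb n = density (distr (leb n) borel T) (\<lambda>_. ennreal c)"
proof (rule measure_eqI)
  fix A assume "A \<in> sets (leb n)"
  then have A: "A \<in> sets borel" by simp
  note T = lin_isoD[OF scalesD(1)[OF assms]]
  have m: "T \<in> borel_measurable borel" by (rule lin_iso_measurable[OF scalesD(1)[OF assms]])
  have TA: "T -` A \<in> sets borel" using measurable_sets[OF m A] by simp
  have eq: "T ` (T -` A \<inter> vecs n) = A \<inter> vecs n"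
  proof -
    have "x \<in> T ` (T -` A \<inter> vecs n)" if x: "x \<in> A" "x \<in> vecs n" for x
    proof -
      obtain y where "y \<in> vecs n" "x = T y" using T(5) x(2) by blast
      with x show ?thesis by auto
    qed
    then show ?thesis using T(6) by auto
  qed
  have "emeasure (leb n) A = emeasure (leb n) (A \<inter> vecs n)"
    using A by (intro emeasure_leb_cong) auto
  also have "\<dots> = ennreal c * emeasure (leb n) (T -` A \<inter> vecs n)"
    using scalesD(4)[OF assms, of "T -` A \<inter> vecs n"] TA by (simp add: eq)
  also have "emeasure (leb n) (T -` A \<inter> vecs n) = emeasure (leb n) (T -` A)"
    using TA by (intro emeasure_leb_cong) auto
  also have "\<dots> = emeasure (distr (leb n) borel T) A"
    using A m by (subst emeasure_distr) auto
  also have "ennreal c * \<dots> = emeasure (density (distr (leb n) borel T) (\<lambda>_. ennreal c)) A"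
    using A by (subst emeasure_density_const) auto
  finally show "emeasure (leb n) A = emeasure (density (distr (leb n) borel T) (\<lambda>_. ennreal c)) A" .
qed simp

lemma avg_image:
  assumes "lin_iso n T" "sym_body n L" "continuous_on UNIV f"
  shows "avg n (T ` L) f = avg n L (\<lambda>x. f (T x))"
proof -
  obtain c where c: "scales n T c" using ex_scales[OF assms(1)] by blast
  have m [measurable]: "T \<in> borel_measurable borel" by (rule lin_iso_measurable[OF assms(1)])
  note T = lin_isoD[OF assms(1)]
  note L = sym_bodyD[OF assms(2)]
  have Lb: "L \<in> sets borel" by (rule borel_compact[OF L(2)])
  have TLb: "T ` L \<in> sets borel" by (rule scalesD(3)[OF c Lb L(1)])
  have [measurable]: "f \<in> borel_measurable borel" using assms(3) by (rule borel_measurable_continuous_onI)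
  have gm: "(\<lambda>x. indicator (T ` L) x * f x) \<in> borel_measurable borel"
    using TLb by measurable
  have "(\<integral>x. indicator (T ` L) x * f x \<partial>leb n)
      = (\<integral>x. indicator (T ` L) x * f x \<partial>density (distr (leb n) borel T) (\<lambda>_. ennreal c))"
    using leb_eq_density_distr[OF c] by simp
  also have "\<dots> = (\<integral>x. c *\<^sub>R (indicator (T ` L) x * f x) \<partial>distr (leb n) borel T)"
    using gm scalesD(2)[OF c] by (intro integral_density) auto
  also have "\<dots> = (\<integral>x. c *\<^sub>R (indicator (T ` L) (T x) * f (T x)) \<partial>leb n)"
    using gm by (intro integral_distr) auto
  also have "\<dots> = (\<integral>x. c * (indicator L x * f (T x)) \<partial>leb n)"
  proof (rule integral_cong_AE)
    show "(\<lambda>x. c *\<^sub>R (indicator (T ` L) (T x) * f (T x))) \<in> borel_measurable (leb n)"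
      using measurable_compose[OF m gm] by simp
    show "(\<lambda>x. c * (indicator L x * f (T x))) \<in> borel_measurable (leb n)"
      using Lb by measurable
    have "c *\<^sub>R (indicator (T ` L) (T x) * f (T x)) = c * (indicator L x * f (T x))" if "x \<in> vecs n" for x
      using inj_on_image_mem_iff[OF T(4) that L(1)] by (simp add: indicator_def)
    then show "AE x in leb n. c *\<^sub>R (indicator (T ` L) (T x) * f (T x)) = c * (indicator L x * f (T x))"
      by (rule AE_mp[OF AE_leb_vecs AE_I2[OF impI]])
  qed
  finally show ?thesis
    using scalesD(5)[OF c Lb L(1)] scalesD(2)[OF c] by (simp add: avg_def)
qed

section \<open>Isotropic position\<close>

text \<open>
  The body contains a box on which the coordinate is bounded away from \<open>0\<close>.
\<close>

lemma avg_coord_square_pos: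
  assumes L: "sym_body n L" and m: "m < n" shows "0 < avg n L (\<lambda>x. x m * x m)"
proof -
  obtain r where r: "0 < r" "eball n r \<subseteq> L" using sym_bodyD(5)[OF L] by blast
  define d where "d = r / sqrt (real n) / 2"
  have d: "0 < d" using r m by (simp add: d_def)
  have "cube n (2 * d) \<subseteq> eball n (sqrt (real n) * (2 * d))" using d by (intro cube_subset_eball) simp
  also have "sqrt (real n) * (2 * d) = r" using m by (simp add: d_def)
  finally have sub: "cube n (2 * d) \<subseteq> L" using r by blast
  define H where "H = {x \<in> vecs n. \<forall>i<n. x i \<in> (if i = m then {d..2*d} else {-2*d..2*d})}"
  have H: "H = cube n (2 * d) \<inter> {x. d \<le> x m}"
  proof (intro set_eqI iffI)
    fix x assume x: "x \<in> H"
    have "x i \<in> {-(2 * d)..2 * d}" if "i < n" for i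
    proof -
      have "x i \<in> (if i = m then {d..2*d} else {-2*d..2*d})" using x that by (simp add: H_def)
      then show ?thesis using d by (cases "i = m") auto
    qed
    moreover have "x m \<in> {d..2*d}" using x m by (auto simp: H_def)
    ultimately show "x \<in> cube n (2 * d) \<inter> {x. d \<le> x m}" using x by (simp add: cube_def H_def)
  next
    fix x assume "x \<in> cube n (2 * d) \<inter> {x. d \<le> x m}"
    then show "x \<in> H" by (simp add: H_def cube_def)
  qed
  have "closed {x::rvec. d \<le> x m}"
    by (intro closed_Collect_le continuous_on_const continuous_on_product_coordinates)
  then have Hb: "H \<in> sets borel" unfolding H by (intro sets.Int cube_borel borel_closed)
  have "emeasure (leb n) H = (\<Prod>i<n. emeasure lborel (if i = m then {d..2*d} else {-2*d..2*d}))"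
    unfolding H_def by (rule emeasure_leb_box) auto
  also have "\<dots> = (\<Prod>i<n. ennreal (if i = m then d else 4 * d))"
    using d by (intro prod.cong) auto
  also have "\<dots> = ennreal (\<Prod>i<n. if i = m then d else 4 * d)" using d by (intro prod_ennreal) auto
  finally have "lvol n H = (\<Prod>i<n. if i = m then d else 4 * d)"
    using d by (simp add: measure_def prod_nonneg)
  moreover have "0 < (\<Prod>i<n. if i = m then d else 4 * d)" using d by (intro prod_pos) auto
  ultimately have Hpos: "0 < lvol n H" by simp
  have "d * d * lvol n H \<le> avg n L (\<lambda>x. x m * x m) * lvol n L"
  proof (rule avg_lower_bound[OF L _ _ Hb])
    show "continuous_on UNIV (\<lambda>x::rvec. x m * x m)"
      by (intro continuous_on_mult continuous_on_product_coordinates)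
    show "d * d \<le> x m * x m" if "x \<in> H" for x using that d by (auto simp: H intro!: mult_mono)
  qed (use sub in \<open>auto simp: H\<close>)
  moreover have "0 < d * d * lvol n H" using d Hpos by simp
  ultimately have "0 < avg n L (\<lambda>x. x m * x m) * lvol n L" by linarith
  then show ?thesis using sym_body_measure_pos[OF L] by (simp add: zero_less_mult_iff)
qed

lemma continuous_on_lin_iso_coord:
  assumes "lin_iso n T" shows "continuous_on UNIV (\<lambda>x. T x i)"
  using continuous_on_product_then_coordinatewise[OF lin_isoD(2)[OF assms]] .

text \<open>Gram--Schmidt orthonormalisation of the coordinate functions in \<open>L\<^sup>2\<close> of the body.\<close>

lemma Gram_Schmidt_body:
  assumes L: "sym_body n L"
  shows "m \<le> n \<Longrightarrow> \<exists>T. lin_iso n T \<and> (\<forall>i<m. \<forall>j<m. avg n L (\<lambda>x. T x i * T x j) = (if i = j then 1 else 0))"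
proof (induction m)
  case 0
  show ?case using lin_iso_id by (intro exI[of _ "\<lambda>x. x"]) auto
next
  case (Suc m)
  then obtain T where T: "lin_iso n T"
    and on: "\<And>i j. i < m \<Longrightarrow> j < m \<Longrightarrow> avg n L (\<lambda>x. T x i * T x j) = (if i = j then 1 else 0)"
    by auto
  have m: "m < n" using Suc by simp
  define a where "a j = avg n L (\<lambda>x. T x m * T x j)" for j
  define g where "g x = T x m + (\<Sum>j<m. - a j * T x j)" for x
  note ct = continuous_on_lin_iso_coord[OF T]
  have cg: "continuous_on UNIV g"
    unfolding g_def by (intro continuous_on_add continuous_on_sum continuous_on_mult ct continuous_on_const)
  have gT: "avg n L (\<lambda>x. g x * T x i) = 0" if i: "i < m" for i
  proof -
    have "avg n L (\<lambda>x. g x * T x i) = avg n L (\<lambda>x. T x m * T x i + (\<Sum>j<m. - a j * (T x j * T x i)))"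
      by (simp add: g_def distrib_right sum_distrib_right mult.assoc)
    also have "\<dots> = a i + avg n L (\<lambda>x. \<Sum>j<m. - a j * (T x j * T x i))"
      unfolding a_def[of i]
      by (intro avg_add[OF L] continuous_on_sum continuous_on_mult ct continuous_on_const)
    also have "avg n L (\<lambda>x. \<Sum>j<m. - a j * (T x j * T x i)) = (\<Sum>j<m. avg n L (\<lambda>x. - a j * (T x j * T x i)))"
      by (intro avg_sum[OF L] continuous_on_mult ct continuous_on_const)
    also have "\<dots> = (\<Sum>j<m. if j = i then - a j else 0)"
      unfolding avg_cmult using on i by (intro sum.cong) auto
    finally show ?thesis using i by simp
  qed
  \<comment> \<open>In the coordinates \<open>V (T x)\<close> the residual \<open>g\<close> is the coordinate number \<open>m\<close>, so it does not vanish on average.\<close>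
  define V where "V = (\<lambda>x::rvec. x(m := 1 * x m + (\<Sum>j<m. - a j * x j)))"
  have V: "lin_iso n V" unfolding V_def using m by (intro lin_iso_coord_update) auto
  have VT: "lin_iso n (\<lambda>x. V (T x))" by (rule lin_iso_comp[OF T V])
  define q where "q = avg n L (\<lambda>x. g x * g x)"
  have "0 < avg n ((\<lambda>x. V (T x)) ` L) (\<lambda>x. x m * x m)"
    by (rule avg_coord_square_pos[OF sym_body_image[OF VT L] m])
  also have "\<dots> = avg n L (\<lambda>x. V (T x) m * V (T x) m)"
    by (rule avg_image[OF VT L]) (intro continuous_on_mult continuous_on_product_coordinates)
  also have "\<dots> = q" by (simp add: q_def V_def g_def)
  finally have q: "0 < q" .
  define s where "s = sqrt q"
  have s: "0 < s" "s * s = q" using q by (auto simp: s_def)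
  define U where "U = (\<lambda>x::rvec. x(m := (1 / s) * x m + (\<Sum>j<m. (- a j / s) * x j)))"
  have U: "lin_iso n U" unfolding U_def using m s by (intro lin_iso_coord_update) auto
  have U_m: "U (T x) m = (1 / s) * g x" for x
    by (simp add: U_def g_def distrib_left sum_distrib_left sum_divide_distrib)
  have U_i: "U (T x) i = T x i" if "i < m" for x i using that by (simp add: U_def)
  have "avg n L (\<lambda>x. U (T x) i * U (T x) j) = (if i = j then 1 else 0)" if ij: "i < Suc m" "j < Suc m" for i j
  proof -
    consider "i < m" "j < m" | "i = m" "j < m" | "i < m" "j = m" | "i = m" "j = m"
      using ij by (auto simp: less_Suc_eq)
    then show ?thesis
    proof cases
      case 1 then show ?thesis by (simp add: U_i on)
    next
      case 2
      then have "avg n L (\<lambda>x. U (T x) i * U (T x) j) = avg n L (\<lambda>x. (1 / s) * (g x * T x j))"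
        by (simp only: U_m U_i mult.assoc)
      also have "\<dots> = 0" unfolding avg_cmult using gT[OF 2(2)] by simp
      finally show ?thesis using 2 by simp
    next
      case 3
      then have "avg n L (\<lambda>x. U (T x) i * U (T x) j) = avg n L (\<lambda>x. (1 / s) * (g x * T x i))"
        by (simp only: U_m U_i mult_ac)
      also have "\<dots> = 0" unfolding avg_cmult using gT[OF 3(1)] by simp
      finally show ?thesis using 3 by simp
    next
      case 4
      then have "avg n L (\<lambda>x. U (T x) i * U (T x) j) = avg n L (\<lambda>x. (1 / s * (1 / s)) * (g x * g x))"
        by (simp only: U_m mult_ac)
      also have "\<dots> = 1" unfolding avg_cmult using s q by (simp add: q_def[symmetric])
      finally show ?thesis using 4 by simp
    qed
  qed
  then show ?case using lin_iso_comp[OF T U] by blast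
qed

lemma isotropic_position:
  assumes L: "sym_body n L" obtains T where "lin_iso n T" "isotropic n (T ` L)"
proof -
  obtain T where T: "lin_iso n T"
    "\<And>i j. i < n \<Longrightarrow> j < n \<Longrightarrow> avg n L (\<lambda>x. T x i * T x j) = (if i = j then 1 else 0)"
    using Gram_Schmidt_body[OF L, of n] by auto
  have "avg n (T ` L) (\<lambda>x. x i * x j) = avg n L (\<lambda>x. T x i * T x j)" for i j
    by (rule avg_image[OF T(1) L]) (intro continuous_on_mult continuous_on_product_coordinates)
  then have "isotropic n (T ` L)"
    using T sym_body_image[OF T(1) L] by (simp add: isotropic_def)
  with T(1) show ?thesis using that by blast
qed

lemma isotropic_avg_square:
  assumes "isotropic n L" shows "avg n L (\<lambda>x. (ip n w x)\<^sup>2) = ip n w w"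
proof -
  have L: "sym_body n L" using assms by (simp add: isotropic_def)
  have c: "continuous_on UNIV (\<lambda>x::rvec. (w i * w j) * (x i * x j))" for i j
    by (intro continuous_on_mult continuous_on_product_coordinates continuous_on_const)
  have "avg n L (\<lambda>x. (ip n w x)\<^sup>2) = avg n L (\<lambda>x. \<Sum>i<n. \<Sum>j<n. (w i * w j) * (x i * x j))"
    by (simp add: ip_def power2_eq_square sum_product mult_ac)
  also have "\<dots> = (\<Sum>i<n. \<Sum>j<n. (w i * w j) * avg n L (\<lambda>x. x i * x j))"
  proof -
    have "avg n L (\<lambda>x. \<Sum>i<n. \<Sum>j<n. (w i * w j) * (x i * x j))
        = (\<Sum>i<n. avg n L (\<lambda>x. \<Sum>j<n. (w i * w j) * (x i * x j)))"
      by (intro avg_sum[OF L] continuous_on_sum c)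
    also have "\<dots> = (\<Sum>i<n. \<Sum>j<n. avg n L (\<lambda>x. (w i * w j) * (x i * x j)))"
      by (intro sum.cong avg_sum[OF L] c refl)
    finally show ?thesis unfolding avg_cmult .
  qed
  also have "\<dots> = (\<Sum>i<n. \<Sum>j<n. if i = j then w i * w j else 0)"
    using assms by (intro sum.cong) (auto simp: isotropic_def)
  also have "\<dots> = ip n w w" by (simp add: ip_def)
  finally show ?thesis .
qed

text \<open>
  The maximum of \<open>\<langle>w, y\<rangle>\<^sup>2\<close> over the body is at least its average \<open>\<bar>w\<bar>\<^sup>2\<close>, so no functional separates a point of
  the unit ball from the body.
\<close>

lemma isotropic_subset:
  assumes "isotropic n L" shows "eball n 1 \<subseteq> L"
proof
  fix z assume z: "z \<in> eball n 1"
  have L: "sym_body n L" using assms by (simp add: isotropic_def)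
  have z_in: "z \<in> vecs n" using z by (simp add: eball_def)
  show "z \<in> L"
  proof (rule ccontr)
    assume "z \<notin> L"
    then obtain w where w: "w \<in> vecs n" "\<And>c. c \<in> L \<Longrightarrow> ip n w c < ip n w z"
      using separation[OF sym_bodyD(2,3)[OF L] _ sym_bodyD(1)[OF L] z_in] sym_body_0[OF L] by blast
    have "continuous_on UNIV (\<lambda>x. (ip n w x)\<^sup>2)"
      by (intro continuous_on_power continuous_on_ip continuous_on_id continuous_on_const)
    then obtain y where y: "y \<in> L" "avg n L (\<lambda>x. (ip n w x)\<^sup>2) \<le> (ip n w y)\<^sup>2"
      by (rule avg_attained[OF L])
    have "ip n w y < ip n w z" "- ip n w y < ip n w z"
      using w(2)[OF y(1)] w(2)[OF sym_bodyD(4)[OF L y(1)]] by (auto simp: ip_simps)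
    then have "\<bar>ip n w y\<bar> < \<bar>ip n w z\<bar>" by linarith
    then have "(ip n w y)\<^sup>2 < (ip n w z)\<^sup>2" by (simp only: not_le[symmetric] abs_le_square_iff not_False_eq_True)
    also have "\<dots> \<le> ip n w w * ip n z z" by (rule ip_Cauchy_Schwarz)
    also have "\<dots> \<le> ip n w w * 1" using z by (intro mult_left_mono) (auto simp: eball_def)
    finally show False using y(2) isotropic_avg_square[OF assms, of w] by simp
  qed
qed

lemma power_one_minus_inverse_ge:
  assumes "2 \<le> n" shows "1 / 6 \<le> (1 - 1 / real n) ^ n"
proof -
  define k where "k = n - 1"
  have k: "0 < k" "n = Suc k" using assms by (auto simp: k_def)
  have "(1 + 1 / real k) ^ n = (1 + 1 / real k) * (1 + 1 / real k) ^ k" by (simp add: k(2))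
  also have "\<dots> \<le> 2 * 3"
    using one_plus_inverse_power_le_3[OF k(1)] k by (intro mult_mono) auto
  finally have le: "(1 + 1 / real k) ^ n \<le> 6" by simp
  have pos: "0 < (1 + 1 / real k) ^ n" using k by (intro zero_less_power) (simp add: add_pos_nonneg)
  have "(1 - 1 / real n) = 1 / (1 + 1 / real k)" using k by (simp add: field_simps)
  then have "(1 - 1 / real n) ^ n = 1 / (1 + 1 / real k) ^ n" by (simp add: power_one_over)
  then show ?thesis using le pos by (simp add: frac_le)
qed

text \<open>
  A point \<open>y\<close> far from the origin would make the body long in the direction of \<open>y\<close>: the half
  \<open>{x. \<langle>y, x\<rangle> \<ge> 0}\<close> of the body, contracted towards \<open>y\<close> with ratio \<open>1 - 1 / n\<close>, stays in the body, keeps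
  at least a sixth of its volume, and \<open>\<langle>y, x\<rangle> \<ge> \<bar>y\<bar>\<^sup>2 / n\<close> on it. The average of \<open>\<langle>y, x\<rangle>\<^sup>2\<close> is
  only \<open>\<bar>y\<bar>\<^sup>2\<close>, whence \<open>\<bar>y\<bar>\<^sup>2 \<le> 12 n\<^sup>2\<close>.
\<close>

lemma isotropic_superset:
  assumes iso: "isotropic n L" and n: "2 \<le> n" shows "L \<subseteq> eball n (4 * real n)"
proof
  fix y assume y: "y \<in> L"
  have L: "sym_body n L" using iso by (simp add: isotropic_def)
  note LD = sym_bodyD[OF L]
  have Lb: "L \<in> sets borel" by (rule borel_compact[OF LD(2)])
  have y_in: "y \<in> vecs n" using y LD(1) by blast
  define \<rho> where "\<rho> = ip n y y"
  have \<rho>0: "0 \<le> \<rho>" by (simp add: \<rho>_def)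
  define H where "H = L \<inter> {x. 0 \<le> ip n y x}"
  have "closed {x. 0 \<le> ip n y x}"
    by (intro closed_Collect_le continuous_on_ip continuous_on_id continuous_on_const)
  then have Hb: "H \<in> sets borel" unfolding H_def by (rule sets.Int[OF Lb borel_closed])
  have H_sub: "H \<subseteq> vecs n" using LD(1) by (auto simp: H_def)
  have H_fin: "emeasure (leb n) A < top" if "A \<subseteq> L" "A \<in> sets borel" for A
    using emeasure_mono[OF that(1), of "leb n"] emeasure_compact_finite[OF LD(2,1)] Lb
    by (auto intro: le_less_trans)
  have neg: "scales n (\<lambda>x. - x) 1"
    by (rule scales_involution)
      (auto intro!: linearI continuous_on_fun_minus continuous_on_id vecs_neg)
  have half: "lvol n L \<le> 2 * lvol n H"
  proof -
    have "x \<in> H \<union> (\<lambda>x. - x) ` H" if "x \<in> L" for x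
    proof (cases "0 \<le> ip n y x")
      case False
      then have "- x \<in> H" using LD(4)[OF that] by (simp add: H_def ip_simps)
      then show ?thesis by (metis UnI2 image_eqI minus_minus)
    qed (use that in \<open>auto simp: H_def\<close>)
    moreover have "(\<lambda>x. - x) ` H \<subseteq> L" using LD(4) by (auto simp: H_def)
    ultimately have "L = H \<union> (\<lambda>x. - x) ` H" by (auto simp: H_def)
    moreover have "lvol n (H \<union> (\<lambda>x. - x) ` H) \<le> lvol n H + lvol n ((\<lambda>x. - x) ` H)"
      using Hb scalesD(3)[OF neg Hb H_sub] by (intro measure_Un_le) auto
    ultimately show ?thesis using scalesD(5)[OF neg Hb H_sub] by simp
  qed
  define t where "t = 1 / real n"
  have t: "0 < t" "t < 1" using n by (auto simp: t_def)
  define H' where "H' = (\<lambda>x. t *\<^sub>R y + (1 - t) *\<^sub>R x) ` H"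
  have ty: "t *\<^sub>R y \<in> vecs n" by (intro vecs_scale y_in)
  have H'b: "H' \<in> sets borel"
    unfolding H'_def using t Hb H_sub by (intro emeasure_leb_affine(1)[OF ty]) auto
  have H'm: "lvol n H' = (1 - t) ^ n * lvol n H"
    unfolding H'_def using t Hb H_sub by (intro measure_leb_affine[OF ty]) auto
  have H'_sub: "H' \<subseteq> L"
    using convexD[OF LD(3) y, of _ t "1 - t"] t by (auto simp: H'_def H_def)
  have "(t * \<rho>)\<^sup>2 * lvol n H' \<le> avg n L (\<lambda>x. (ip n y x)\<^sup>2) * lvol n L"
  proof (rule avg_lower_bound[OF L _ _ H'b H'_sub])
    show "continuous_on UNIV (\<lambda>x. (ip n y x)\<^sup>2)"
      by (intro continuous_on_power continuous_on_ip continuous_on_id continuous_on_const)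
    show "(t * \<rho>)\<^sup>2 \<le> (ip n y x)\<^sup>2" if x: "x \<in> H'" for x
    proof (rule power_mono)
      obtain h where h: "h \<in> H" "x = t *\<^sub>R y + (1 - t) *\<^sub>R h" using x by (auto simp: H'_def)
      have "0 \<le> (1 - t) * ip n y h" using h t by (auto simp: H_def)
      then show "t * \<rho> \<le> ip n y x" by (simp add: h(2) ip_simps \<rho>_def)
    qed (use t \<rho>0 in auto)
  qed simp
  then have 1: "(t * \<rho>)\<^sup>2 * ((1 - t) ^ n * lvol n H) \<le> \<rho> * lvol n L"
    using isotropic_avg_square[OF iso, of y] by (simp add: H'm \<rho>_def)
  have "(t * \<rho>)\<^sup>2 * (1 / 6 * (lvol n L / 2)) \<le> (t * \<rho>)\<^sup>2 * ((1 - t) ^ n * lvol n H)"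
    using half power_one_minus_inverse_ge[OF n] t by (intro mult_left_mono mult_mono) (auto simp: t_def)
  with 1 have "(t * \<rho>)\<^sup>2 / 12 * lvol n L \<le> \<rho> * lvol n L" by simp
  then have "(t * \<rho>)\<^sup>2 / 12 \<le> \<rho>" using sym_body_measure_pos[OF L] by simp
  then have "\<rho> * \<rho> \<le> \<rho> * (12 * (real n)\<^sup>2)"
    using n by (simp add: t_def power2_eq_square field_simps)
  then have "\<rho> \<le> 12 * (real n)\<^sup>2"
    using \<rho>0 by (cases "\<rho> = 0") auto
  also have "\<dots> \<le> (4 * real n)\<^sup>2" by (simp add: power_mult_distrib)
  finally show "y \<in> eball n (4 * real n)" using y_in by (simp add: eball_def \<rho>_def)
qed

section \<open>Volume bounds by an exponential integral\<close>

lemma nn_integral_exp_abs: "(\<integral>\<^sup>+t. ennreal (exp (- \<bar>t\<bar>)) \<partial>lborel) \<le> 2"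
proof -
  let ?g = "\<lambda>t::real. ennreal (exp (- t)) * indicator {0..} t"
  have g: "(\<integral>\<^sup>+t. ?g t \<partial>lborel) = ennreal (0 - (- exp (- 0)))"
  proof (rule nn_integral_FTC_atLeast)
    show "((\<lambda>t::real. - exp (- t)) has_real_derivative exp (- t)) (at t)" for t
      by (auto intro!: derivative_eq_intros)
    show "((\<lambda>t::real. - exp (- t)) \<longlongrightarrow> 0) at_top"
      using tendsto_minus[OF filterlim_compose[OF exp_at_bot filterlim_uminus_at_bot_at_top]] by simp
  qed auto
  have "(\<integral>\<^sup>+t. ?g (- t) \<partial>lborel) = (\<integral>\<^sup>+t. ?g t \<partial>distr lborel borel uminus)"
    by (subst nn_integral_distr) auto
  then have g': "(\<integral>\<^sup>+t. ?g (- t) \<partial>lborel) = 1" using g by (simp add: lborel_distr_uminus)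
  have "(\<integral>\<^sup>+t. ennreal (exp (- \<bar>t\<bar>)) \<partial>lborel) \<le> (\<integral>\<^sup>+t. ?g t + ?g (- t) \<partial>lborel)"
    by (intro nn_integral_mono) (auto simp: indicator_def abs_if)
  also have "\<dots> = (\<integral>\<^sup>+t. ?g t \<partial>lborel) + (\<integral>\<^sup>+t. ?g (- t) \<partial>lborel)"
    by (rule nn_integral_add) auto
  also have "\<dots> = 2" using g g' by simp
  finally show ?thesis .
qed

text \<open>
  Markov's inequality for the density \<open>exp (- \<bar>x\<^sub>1\<bar> - \<dots> - \<bar>x\<^sub>n\<bar>)\<close> of total mass at most \<open>2\<^sup>n\<close>. It
  bounds the volumes of both the isotropic body and the circumscribed simplex.
\<close>

lemma emeasure_l1_ball_le:
  assumes A: "A \<in> sets borel" "\<And>x. x \<in> A \<Longrightarrow> (\<Sum>i<n. \<bar>x i\<bar>) \<le> s * real n"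
  shows "emeasure (leb n) A \<le> ennreal ((2 * exp s) ^ n)"
proof -
  interpret product_sigma_finite "\<lambda>_. lborel :: real measure" ..
  let ?M = "Pi\<^sub>M {..<n} (\<lambda>_. lborel :: real measure)"
  let ?f = "\<lambda>x::rvec. \<Prod>i<n. ennreal (exp (- \<bar>x i\<bar>))"
  have fm: "?f \<in> borel_measurable borel" by measurable
  have "(\<integral>\<^sup>+x. ?f x \<partial>leb n) = (\<integral>\<^sup>+x. ?f (\<lambda>i. if i < n then x i else 0) \<partial>?M)"
    unfolding leb_def using fm by (subst nn_integral_distr) auto
  also have "\<dots> = (\<integral>\<^sup>+x. ?f x \<partial>?M)" by (intro nn_integral_cong prod.cong) auto
  also have "\<dots> = (\<Prod>i<n. (\<integral>\<^sup>+t. ennreal (exp (- \<bar>t\<bar>)) \<partial>lborel))"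
    by (rule product_nn_integral_prod) auto
  finally have "(\<integral>\<^sup>+x. ?f x \<partial>leb n) = (\<integral>\<^sup>+t. ennreal (exp (- \<bar>t\<bar>)) \<partial>lborel) ^ n" by simp
  moreover obtain c where c: "(\<integral>\<^sup>+t. ennreal (exp (- \<bar>t\<bar>)) \<partial>lborel) = ennreal c" "0 \<le> c" "c \<le> 2"
    using nn_integral_exp_abs
    by (cases "\<integral>\<^sup>+t. ennreal (exp (- \<bar>t\<bar>)) \<partial>lborel") (auto simp: top_unique simp flip: ennreal_numeral)
  ultimately have "(\<integral>\<^sup>+x. ?f x \<partial>leb n) = ennreal (c ^ n)" by (simp add: ennreal_power)
  also have "\<dots> \<le> ennreal (2 ^ n)" using c by (intro ennreal_leI power_mono)
  finally have I: "(\<integral>\<^sup>+x. ?f x \<partial>leb n) \<le> 2 ^ n" by (simp add: ennreal_power[symmetric])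
  have "emeasure (leb n) A = (\<integral>\<^sup>+x. indicator A x \<partial>leb n)" using A by simp
  also have "\<dots> \<le> (\<integral>\<^sup>+x. ennreal (exp s ^ n) * ?f x \<partial>leb n)"
  proof (rule nn_integral_mono)
    fix x
    have "?f x = ennreal (exp (- (\<Sum>i<n. \<bar>x i\<bar>)))"
      by (subst prod_ennreal) (auto simp: exp_sum sum_negf[symmetric])
    moreover have "exp s ^ n = exp (s * real n)" by (simp add: exp_of_nat_mult[symmetric] mult.commute)
    ultimately have "ennreal (exp s ^ n) * ?f x = ennreal (exp (s * real n - (\<Sum>i<n. \<bar>x i\<bar>)))"
      by (simp add: ennreal_mult[symmetric] exp_diff exp_minus divide_inverse)
    moreover have "1 \<le> exp (s * real n - (\<Sum>i<n. \<bar>x i\<bar>))" if "x \<in> A" using A(2)[OF that] by simp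
    ultimately show "indicator A x \<le> ennreal (exp s ^ n) * ?f x"
      by (auto simp: indicator_def)
  qed
  also have "\<dots> = ennreal (exp s ^ n) * (\<integral>\<^sup>+x. ?f x \<partial>leb n)"
    by (rule nn_integral_cmult) auto
  also have "\<dots> \<le> ennreal (exp s ^ n) * 2 ^ n" by (intro mult_left_mono I) auto
  also have "\<dots> = ennreal ((2 * exp s) ^ n)"
    by (simp add: power_mult_distrib ennreal_mult mult.commute ennreal_power[symmetric])
  finally show ?thesis .
qed

text \<open>
  The average of \<open>\<bar>x\<bar>\<^sup>2\<close> is \<open>n\<close>, so at least half of the body satisfies \<open>\<bar>x\<bar>\<^sup>2 \<le> 2 n\<close>, and
  there the sum of the \<open>\<bar>x\<^sub>i\<bar>\<close> is at most \<open>\<surd>2 n\<close>.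
\<close>

lemma isotropic_measure_le:
  assumes iso: "isotropic n L" and n: "0 < n"
  shows "lvol n L \<le> 2 * (2 * exp (sqrt 2)) ^ n"
proof -
  have L: "sym_body n L" using iso by (simp add: isotropic_def)
  note LD = sym_bodyD[OF L]
  have Lb: "L \<in> sets borel" by (rule borel_compact[OF LD(2)])
  have "avg n L (\<lambda>x. ip n x x) = avg n L (\<lambda>x. \<Sum>i<n. x i * x i)" by (simp add: ip_def)
  also have "\<dots> = (\<Sum>i<n. avg n L (\<lambda>x. x i * x i))"
    by (intro avg_sum[OF L] continuous_on_mult continuous_on_product_coordinates)
  also have "\<dots> = real n" using iso by (simp add: isotropic_def)
  finally have avg: "avg n L (\<lambda>x. ip n x x) = real n" .
  define G where "G = L \<inter> {x. ip n x x \<le> 2 * real n}"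
  have "closed {x. ip n x x \<le> 2 * real n}"
    by (intro closed_Collect_le continuous_on_ip continuous_on_id continuous_on_const)
  then have Gb: "G \<in> sets borel" unfolding G_def by (rule sets.Int[OF Lb borel_closed])
  have "2 * real n * lvol n (L - G) \<le> avg n L (\<lambda>x. ip n x x) * lvol n L"
    using Lb Gb by (intro avg_lower_bound[OF L]) (auto simp: G_def intro!: continuous_on_ip continuous_on_id)
  then have "lvol n (L - G) \<le> lvol n L / 2"
    using n by (simp add: avg)
  moreover have "lvol n (L - G) = lvol n L - lvol n G"
    using Lb Gb emeasure_compact_finite[OF LD(2,1)] by (intro measure_Diff) (auto simp: G_def)
  ultimately have half: "lvol n L \<le> 2 * lvol n G" by simp
  have "emeasure (leb n) G \<le> ennreal ((2 * exp (sqrt 2)) ^ n)"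
  proof (rule emeasure_l1_ball_le[OF Gb])
    fix x assume x: "x \<in> G"
    have "(\<Sum>i<n. \<bar>x i\<bar>)\<^sup>2 \<le> real n * (\<Sum>i<n. \<bar>x i\<bar>\<^sup>2)"
      using Cauchy_Schwarz_ineq_sum[of "\<lambda>_. 1" "\<lambda>i. \<bar>x i\<bar>" "{..<n}"] by simp
    also have "\<dots> = real n * ip n x x" by (simp add: ip_def power2_eq_square)
    also have "\<dots> \<le> real n * (2 * real n)" using x by (intro mult_left_mono) (auto simp: G_def)
    also have "\<dots> = (sqrt 2 * real n)\<^sup>2" by (simp add: power2_eq_square)
    finally show "(\<Sum>i<n. \<bar>x i\<bar>) \<le> sqrt 2 * real n" by (rule power2_le_imp_le) simp
  qed
  then have "lvol n G \<le> (2 * exp (sqrt 2)) ^ n"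
    by (simp add: measure_def enn2real_leI)
  with half show ?thesis by simp
qed

section \<open>Choosing a large parallelepiped\<close>

text \<open>
  The reflection in the hyperplane orthogonal to \<open>w\<close>. For \<open>w = 0\<close> division by zero makes it the identity.
\<close>

definition reflect :: "nat \<Rightarrow> rvec \<Rightarrow> rvec \<Rightarrow> rvec"
  where "reflect n w x = x - (2 * ip n w x / ip n w w) *\<^sub>R w"

lemma reflect_apply: "reflect n w x i = x i - 2 * ip n w x / ip n w w * w i"
  by (simp add: reflect_def)

lemma scales_reflect:
  assumes "w \<in> vecs n" shows "scales n (reflect n w) 1"
proof (rule scales_involution)
  show "linear (reflect n w)"
    by (rule linearI) (simp_all add: reflect_def fun_eq_iff ip_simps add_divide_distrib algebra_simps)
  show "continuous_on UNIV (reflect n w)"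
  proof (rule continuous_on_coordinatewise_then_product)
    fix i show "continuous_on UNIV (\<lambda>x. reflect n w x i)"
      unfolding reflect_apply divide_inverse
      by (intro continuous_on_diff continuous_on_mult continuous_on_ip continuous_on_id continuous_on_const
          continuous_on_product_coordinates)
  qed
  show "reflect n w x \<in> vecs n" if "x \<in> vecs n" for x
    unfolding reflect_def by (intro vecs_diff vecs_scale assms that)
  show "reflect n w (reflect n w x) = x" for x
  proof (cases "ip n w w = 0")
    case False
    then have "ip n w (reflect n w x) = - ip n w x" by (simp add: reflect_def ip_simps)
    then show ?thesis by (simp add: fun_eq_iff reflect_apply)
  qed (simp add: reflect_def fun_eq_iff)
qed

text \<open>
  One Householder reflection turns the last \<open>n - m\<close> rows \<open>q\<close> so that \<open>y\<close> becomes orthogonal to all of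
  them but the first.
\<close>

lemma rotate_rows:
  assumes q: "\<And>i. m \<le> i \<Longrightarrow> i < n \<Longrightarrow> q i \<in> vecs n"
    and on: "\<And>i j. m \<le> i \<Longrightarrow> i < n \<Longrightarrow> m \<le> j \<Longrightarrow> j < n \<Longrightarrow> ip n (q i) (q j) = (if i = j then 1 else 0)"
    and m: "m < n"
  obtains w q' where "w \<in> vecs n" "\<And>i. i < m \<Longrightarrow> w i = 0"
    "\<And>i. m \<le> i \<Longrightarrow> i < n \<Longrightarrow> q' i \<in> vecs n"
    "\<And>i j. m \<le> i \<Longrightarrow> i < n \<Longrightarrow> m \<le> j \<Longrightarrow> j < n \<Longrightarrow> ip n (q' i) (q' j) = (if i = j then 1 else 0)"
    "\<And>u i. (\<And>j. m \<le> j \<Longrightarrow> j < n \<Longrightarrow> ip n u (q j) = 0) \<Longrightarrow> ip n u (q' i) = 0 \<or> \<not> (m \<le> i \<and> i < n)"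
    "\<And>z x i. (\<And>j. m \<le> j \<Longrightarrow> j < n \<Longrightarrow> z j = ip n (q j) x) \<Longrightarrow> m \<le> i \<Longrightarrow> i < n \<Longrightarrow> reflect n w z i = ip n (q' i) x"
    "\<And>i. m \<le> i \<Longrightarrow> i < n \<Longrightarrow> ip n y (q' i) = (if i = m then sqrt (\<Sum>k\<in>{m..<n}. (ip n y (q k))\<^sup>2) else 0)"
proof -
  define a where "a i = ip n y (q i)" for i
  define s where "s = sqrt (\<Sum>k\<in>{m..<n}. (a k)\<^sup>2)"
  have s2: "s * s = (\<Sum>k\<in>{m..<n}. (a k)\<^sup>2)" by (simp add: s_def sum_nonneg)
  define w where "w i = (if m \<le> i \<and> i < n then a i - (if i = m then s else 0) else 0)" for i
  define W where "W = ip n w w"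
  define g where "g = (\<Sum>k\<in>{m..<n}. w k *\<^sub>R q k)"
  define q' where "q' i = q i - (2 * w i / W) *\<^sub>R g" for i
  have w_in: "w \<in> vecs n" by (simp add: w_def vecs_def)
  have w_low: "w i = 0" if "i < m" for i using that by (simp add: w_def)
  have g_in: "g \<in> vecs n" unfolding g_def by (intro vecs_sum vecs_scale q) auto
  have ip_w: "ip n w z = (\<Sum>k\<in>{m..<n}. w k * z k)" for z
  proof -
    have "ip n w z = (\<Sum>k\<in>{m..<n} \<union> {..<m}. w k * z k)"
      unfolding ip_def using m by (intro sum.cong) auto
    also have "\<dots> = (\<Sum>k\<in>{m..<n}. w k * z k)"
      by (intro sum.mono_neutral_right) (auto simp: w_low)
    finally show ?thesis .
  qed
  have gq: "ip n g (q i) = w i" if "m \<le> i" "i < n" for i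
  proof -
    have "ip n g (q i) = (\<Sum>k\<in>{m..<n}. if k = i then w k else 0)"
      unfolding g_def ip_sum_left ip_scale_left using on that by (intro sum.cong) auto
    then show ?thesis using that by simp
  qed
  have gg: "ip n g g = W"
  proof -
    have "ip n g g = (\<Sum>k\<in>{m..<n}. w k * ip n g (q k))"
      by (subst (2) g_def) (simp add: ip_sum_right ip_scale_right)
    also have "\<dots> = W" unfolding W_def ip_w by (intro sum.cong) (auto simp: gq)
    finally show ?thesis .
  qed
  have q'_in: "q' i \<in> vecs n" if "m \<le> i" "i < n" for i
    unfolding q'_def by (intro vecs_diff vecs_scale q that g_in)
  have q'_on: "ip n (q' i) (q' j) = (if i = j then 1 else 0)"
    if i: "m \<le> i" "i < n" and j: "m \<le> j" "j < n" for i j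
  proof -
    have "ip n (q' i) (q' j) = ip n (q i) (q j) - 2 * w j / W * w i - 2 * w i / W * w j
        + 2 * w i / W * (2 * w j / W * W)"
      unfolding q'_def using gq[OF i] gq[OF j]
      by (simp add: ip_simps ip_commute[of n "q i" g] gg algebra_simps)
    also have "\<dots> = ip n (q i) (q j)" by (cases "W = 0") (simp_all add: field_simps)
    finally show ?thesis using on[OF i j] by simp
  qed
  have orth: "ip n u (q' i) = 0"
    if "\<And>j. m \<le> j \<Longrightarrow> j < n \<Longrightarrow> ip n u (q j) = 0" "m \<le> i" "i < n" for u i
  proof -
    have "ip n u g = 0" unfolding g_def ip_sum_right ip_scale_right using that(1) by (intro sum.neutral) auto
    then show ?thesis using that by (simp add: q'_def ip_simps)
  qed
  have refl: "reflect n w z i = ip n (q' i) x"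
    if z: "\<And>j. m \<le> j \<Longrightarrow> j < n \<Longrightarrow> z j = ip n (q j) x" and i: "m \<le> i" "i < n" for z x i
  proof -
    have "ip n w z = (\<Sum>k\<in>{m..<n}. w k * ip n (q k) x)" unfolding ip_w using z by (intro sum.cong) auto
    also have "\<dots> = ip n g x" by (simp add: g_def ip_sum_left ip_scale_left)
    finally show ?thesis using z[OF i] by (simp add: reflect_apply q'_def ip_simps W_def)
  qed
  have yq': "ip n y (q' i) = (if i = m then s else 0)" if i: "m \<le> i" "i < n" for i
  proof -
    have yg: "ip n y g = s * s - s * a m"
    proof -
      have "ip n y g = (\<Sum>k\<in>{m..<n}. w k * a k)" by (simp add: g_def ip_sum_right ip_scale_right a_def)
      also have "\<dots> = (\<Sum>k\<in>{m..<n}. (a k)\<^sup>2 - (if k = m then s * a m else 0))"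
        by (intro sum.cong) (auto simp: w_def power2_eq_square algebra_simps)
      also have "\<dots> = s * s - s * a m" using m by (simp add: sum_subtractf s2)
      finally show ?thesis .
    qed
    have W2: "W = 2 * (s * s - s * a m)"
    proof -
      have "W = (\<Sum>k\<in>{m..<n}. (a k)\<^sup>2 - (if k = m then 2 * s * a m - s * s else 0))"
        unfolding W_def ip_w by (intro sum.cong) (auto simp: w_def power2_eq_square algebra_simps)
      also have "\<dots> = 2 * (s * s - s * a m)" using m by (simp add: sum_subtractf s2)
      finally show ?thesis .
    qed
    have ai: "a i = w i + (if i = m then s else 0)" using i by (simp add: w_def)
    show ?thesis
    proof (cases "W = 0")
      case True
      then have "w = 0" using ip_eq_0_iff[OF w_in] by (simp add: W_def)
      then have "w i = 0" by simp
      then show ?thesis using True ai by (simp add: q'_def ip_simps a_def[symmetric])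
    next
      case False
      have "ip n y (q' i) = a i - 2 * w i / W * ip n y g"
        by (simp add: q'_def ip_simps a_def)
      also have "ip n y g = W / 2" using W2 yg by simp
      finally show ?thesis using False ai by simp
    qed
  qed
  show ?thesis
    by (rule that[of w q'])
      (use w_in w_low q'_in q'_on orth refl yq' in \<open>auto simp: s_def a_def\<close>)
qed

text \<open>
  The state after \<open>m\<close> of the points have been chosen: the first \<open>m\<close> rows of \<open>W\<close> are points of the body, the others
  are an orthonormal basis of the orthogonal complement of these points. The bound on \<open>c\<close> records a product of
  squared distances.
\<close>

definition chosen_rows where
  "chosen_rows n L m W c Y q \<longleftrightarrow> scales n W c \<and> (\<Prod>k<m. real (n - k)) \<le> c\<^sup>2 \<and>
    (\<forall>i<m. Y i \<in> L) \<and> (\<forall>i<m. \<forall>x\<in>vecs n. W x i = ip n (Y i) x) \<and>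
    (\<forall>i. m \<le> i \<and> i < n \<longrightarrow> q i \<in> vecs n \<and> (\<forall>x\<in>vecs n. W x i = ip n (q i) x)) \<and>
    (\<forall>i j. m \<le> i \<and> i < n \<and> m \<le> j \<and> j < n \<longrightarrow> ip n (q i) (q j) = (if i = j then 1 else 0)) \<and>
    (\<forall>i j. i < m \<and> m \<le> j \<and> j < n \<longrightarrow> ip n (Y i) (q j) = 0)"

text \<open>
  In isotropic position some point \<open>y\<close> of the body has squared distance at least \<open>n - m\<close> from the span of the
  points chosen so far. After a reflection that makes \<open>y\<close> orthogonal to all remaining rows but the first, replacing this
  row by \<open>y\<close> is an elementary map, which multiplies the factor of \<open>W\<close> by the distance.
\<close>

lemma large_rows:
  assumes iso: "isotropic n L"
  shows "m \<le> n \<Longrightarrow> \<exists>W c Y q. chosen_rows n L m W c Y q"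
proof (induction m)
  case 0
  have "ip n (axis_vec i) (axis_vec j) = (if i = j then 1 else 0)" if "i < n" for i j
    using that by (simp add: axis_vec_def[of j])
  then have "chosen_rows n L 0 (\<lambda>x. x) 1 (\<lambda>_. 0) axis_vec"
    using scales_id by (simp add: chosen_rows_def)
  then show ?case by blast
next
  case (Suc m)
  have m: "m < n" using Suc.prems by simp
  have L: "sym_body n L" using iso by (simp add: isotropic_def)
  obtain W c Y q where st: "chosen_rows n L m W c Y q" using Suc by auto
  have W: "scales n W c" and c: "(\<Prod>k<m. real (n - k)) \<le> c\<^sup>2"
    using st unfolding chosen_rows_def by blast+
  have Y: "Y i \<in> L" if "i < m" for i
    using st that unfolding chosen_rows_def by blast
  have WY: "W x i = ip n (Y i) x" if "i < m" "x \<in> vecs n" for i x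
    using st that unfolding chosen_rows_def by blast
  have q: "q i \<in> vecs n" if "m \<le> i" "i < n" for i
    using st that unfolding chosen_rows_def by blast
  have Wq: "W x i = ip n (q i) x" if "m \<le> i" "i < n" "x \<in> vecs n" for i x
    using st that unfolding chosen_rows_def by blast
  have on: "ip n (q i) (q j) = (if i = j then 1 else 0)" if "m \<le> i" "i < n" "m \<le> j" "j < n" for i j
    using st that unfolding chosen_rows_def by blast
  have Yq: "ip n (Y i) (q j) = 0" if "i < m" "m \<le> j" "j < n" for i j
    using st that unfolding chosen_rows_def by blast
  have "continuous_on UNIV (\<lambda>x. \<Sum>k\<in>{m..<n}. (ip n (q k) x)\<^sup>2)"
    by (intro continuous_on_sum continuous_on_power continuous_on_ip continuous_on_id continuous_on_const)
  then obtain y where y: "y \<in> L"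
    "avg n L (\<lambda>x. \<Sum>k\<in>{m..<n}. (ip n (q k) x)\<^sup>2) \<le> (\<Sum>k\<in>{m..<n}. (ip n (q k) y)\<^sup>2)"
    by (rule avg_attained[OF L])
  have "avg n L (\<lambda>x. \<Sum>k\<in>{m..<n}. (ip n (q k) x)\<^sup>2) = (\<Sum>k\<in>{m..<n}. avg n L (\<lambda>x. (ip n (q k) x)\<^sup>2))"
    by (intro avg_sum[OF L] continuous_on_power continuous_on_ip continuous_on_id continuous_on_const)
  also have "\<dots> = (\<Sum>k\<in>{m..<n}. 1)" using on by (intro sum.cong) (auto simp: isotropic_avg_square[OF iso])
  also have "\<dots> = real (n - m)" by simp
  finally have dist: "real (n - m) \<le> (\<Sum>k\<in>{m..<n}. (ip n y (q k))\<^sup>2)"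
    using y(2) by (simp add: ip_commute[of n y])
  have y_in: "y \<in> vecs n" using y(1) sym_bodyD(1)[OF L] by blast
  obtain w q' where w: "w \<in> vecs n" "\<And>i. i < m \<Longrightarrow> w i = 0"
    and q': "\<And>i. m \<le> i \<Longrightarrow> i < n \<Longrightarrow> q' i \<in> vecs n"
    and on': "\<And>i j. m \<le> i \<Longrightarrow> i < n \<Longrightarrow> m \<le> j \<Longrightarrow> j < n \<Longrightarrow> ip n (q' i) (q' j) = (if i = j then 1 else 0)"
    and orth: "\<And>u i. (\<And>j. m \<le> j \<Longrightarrow> j < n \<Longrightarrow> ip n u (q j) = 0) \<Longrightarrow> ip n u (q' i) = 0 \<or> \<not> (m \<le> i \<and> i < n)"
    and refl: "\<And>z x i. (\<And>j. m \<le> j \<Longrightarrow> j < n \<Longrightarrow> z j = ip n (q j) x) \<Longrightarrow> m \<le> i \<Longrightarrow> i < n \<Longrightarrow> reflect n w z i = ip n (q' i) x"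
    and yq': "\<And>i. m \<le> i \<Longrightarrow> i < n \<Longrightarrow> ip n y (q' i) = (if i = m then sqrt (\<Sum>k\<in>{m..<n}. (ip n y (q k))\<^sup>2) else 0)"
    using rotate_rows[where q = q and m = m and n = n and y = y, OF q on m] by blast
  define s where "s = sqrt (\<Sum>k\<in>{m..<n}. (ip n y (q k))\<^sup>2)"
  have s: "real (n - m) \<le> s\<^sup>2" using dist by (simp add: s_def sum_nonneg)
  have s0: "0 < s"
  proof -
    have "0 < s\<^sup>2" using s m by linarith
    moreover have "0 \<le> s" by (simp add: s_def sum_nonneg)
    ultimately show ?thesis by (cases "s = 0") auto
  qed
  define V where "V = (\<lambda>x. reflect n w (W x))"
  have V: "scales n V c" using scales_comp[OF W scales_reflect[OF w(1)]] by (simp add: V_def)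
  have V_low: "V x i = ip n (Y i) x" if "i < m" "x \<in> vecs n" for x i
    using that WY w(2) by (simp add: V_def reflect_apply)
  have V_high: "V x i = ip n (q' i) x" if "m \<le> i" "i < n" "x \<in> vecs n" for x i
    unfolding V_def using that Wq by (intro refl) auto
  have Yq': "ip n (Y i) (q' j) = 0" if "i < m" "m \<le> j" "j < n" for i j
    using orth[of "Y i" j] Yq that by auto
  have V_q': "V (q' i) = axis_vec i" if i: "m \<le> i" "i < n" for i
  proof (rule vecs_eqI)
    show "V (q' i) \<in> vecs n" by (rule lin_isoD(6)[OF scalesD(1)[OF V] q'[OF i]])
    fix j assume j: "j < n"
    show "V (q' i) j = axis_vec i j"
    proof (cases "j < m")
      case True
      then show ?thesis using V_low q' Yq' i by (simp add: axis_vec_def)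
    next
      case False
      then show ?thesis using V_high[of j "q' i"] q' on'[of j i] i j by (simp add: axis_vec_def)
    qed
  qed (use i in simp)
  obtain S :: "rvec \<Rightarrow> rvec" where S: "lin_iso n S" "\<And>x. x \<in> vecs n \<Longrightarrow> S (V x) = x"
    "\<And>x. x \<in> vecs n \<Longrightarrow> V (S x) = x"
    using lin_iso_inverse[OF scalesD(1)[OF V]] by metis
  obtain S' :: "rvec \<Rightarrow> rvec" where S': "lin_iso n S'"
    "\<And>x z. x \<in> vecs n \<Longrightarrow> z \<in> vecs n \<Longrightarrow> ip n (S x) z = ip n x (S' z)"
    using lin_iso_adjoint[OF S(1)] by metis
  \<comment> \<open>\<open>b\<close> holds the coefficients of \<open>y\<close> in terms of the rows of \<open>V\<close>.\<close>
  define b where "b = S' y"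
  have b: "ip n y x = ip n b (V x)" if "x \<in> vecs n" for x
  proof -
    have "V x \<in> vecs n" by (rule lin_isoD(6)[OF scalesD(1)[OF V] that])
    then have "ip n (S (V x)) y = ip n (V x) b" unfolding b_def by (rule S'(2)) (rule y_in)
    then show ?thesis using S(2)[OF that] by (simp add: ip_commute)
  qed
  have b_high: "b i = (if i = m then s else 0)" if "m \<le> i" "i < n" for i
  proof -
    have "b i = ip n y (q' i)" using b[OF q'[OF that]] V_q'[OF that] that by simp
    then show ?thesis using yq'[OF that] by (simp only: s_def)
  qed
  have b_sum: "ip n b z = s * z m + (\<Sum>j<m. b j * z j)" for z
  proof -
    have "ip n b z = (\<Sum>j\<in>{m..<n} \<union> {..<m}. b j * z j)"
      unfolding ip_def using m by (intro sum.cong) auto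
    also have "\<dots> = (\<Sum>j\<in>{m..<n}. b j * z j) + (\<Sum>j<m. b j * z j)"
      by (rule sum.union_disjoint) auto
    also have "(\<Sum>j\<in>{m..<n}. b j * z j) = (\<Sum>j\<in>{m..<n}. if j = m then s * z m else 0)"
      by (intro sum.cong) (auto simp: b_high)
    also have "\<dots> = s * z m" using m by simp
    finally show ?thesis .
  qed
  define U where "U = (\<lambda>z::rvec. z(m := s * z m + (\<Sum>j<m. b j * z j)))"
  have U: "scales n U s" unfolding U_def by (rule scales_coord_update[OF s0 m])
  have UV: "scales n (\<lambda>x. U (V x)) (s * c)" by (rule scales_comp[OF V U])
  define Y' where "Y' = Y(m := y)"
  have "(\<Prod>k<Suc m. real (n - k)) \<le> c\<^sup>2 * s\<^sup>2"
    unfolding prod.lessThan_Suc using c s by (intro mult_mono) auto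
  then have "(\<Prod>k<Suc m. real (n - k)) \<le> (s * c)\<^sup>2" by (simp add: power_mult_distrib mult.commute)
  moreover have "\<forall>i<Suc m. Y' i \<in> L" using Y y by (simp add: Y'_def less_Suc_eq)
  moreover have "\<forall>i<Suc m. \<forall>x\<in>vecs n. U (V x) i = ip n (Y' i) x"
    using V_low b b_sum by (simp add: U_def Y'_def less_Suc_eq)
  moreover have "\<forall>i. Suc m \<le> i \<and> i < n \<longrightarrow> q' i \<in> vecs n \<and> (\<forall>x\<in>vecs n. U (V x) i = ip n (q' i) x)"
    using q' V_high by (simp add: U_def)
  moreover have "\<forall>i j. Suc m \<le> i \<and> i < n \<and> Suc m \<le> j \<and> j < n \<longrightarrow> ip n (q' i) (q' j) = (if i = j then 1 else 0)"
    using on' by simp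
  moreover have "\<forall>i j. i < Suc m \<and> Suc m \<le> j \<and> j < n \<longrightarrow> ip n (Y' i) (q' j) = 0"
    using Yq' yq' by (simp add: Y'_def less_Suc_eq)
  ultimately have "chosen_rows n L (Suc m) (\<lambda>x. U (V x)) (s * c) Y' q'"
    using UV unfolding chosen_rows_def by blast
  then show ?case by blast
qed

text \<open>
  When all \<open>n\<close> rows of \<open>W\<close> are points of \<open>L\<close>, symmetry of \<open>L\<close> gives \<open>\<bar>\<langle>y\<^sub>i, x\<rangle>\<bar> \<le> 1\<close> for every \<open>x\<close> in the polar body.
\<close>

lemma large_parallelepiped:
  assumes iso: "isotropic n L"
  obtains W c where "scales n W c" "fact n \<le> c\<^sup>2" "W ` polar n L \<subseteq> cube n 1"
proof -
  obtain W c Y q where st: "chosen_rows n L n W c Y q" using large_rows[OF iso order_refl] by blast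
  have W: "scales n W c" and c: "(\<Prod>k<n. real (n - k)) \<le> c\<^sup>2"
    using st unfolding chosen_rows_def by blast+
  have Y: "Y i \<in> L" if "i < n" for i
    using st that unfolding chosen_rows_def by blast
  have WY: "W x i = ip n (Y i) x" if "i < n" "x \<in> vecs n" for i x
    using st that unfolding chosen_rows_def by blast
  have L: "sym_body n L" using iso by (simp add: isotropic_def)
  have "(\<Prod>k<n. real (n - k)) = fact n"
    by (simp add: fact_prod_rev atLeast0LessThan)
  moreover have "W ` polar n L \<subseteq> cube n 1"
  proof clarify
    fix x assume x: "x \<in> polar n L"
    then have x_in: "x \<in> vecs n" by (simp add: polar_def)
    have "W x i \<in> {-1..1}" if "i < n" for i
    proof -
      have "ip n (Y i) x \<le> 1" "ip n (- Y i) x \<le> 1"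
        using x Y[OF that] sym_bodyD(4)[OF L Y[OF that]] by (auto simp: polar_def)
      then show ?thesis using WY[OF that x_in] by (simp add: ip_simps)
    qed
    then show "W x \<in> cube n 1"
      using lin_isoD(6)[OF scalesD(1)[OF W] x_in] by (simp add: cube_def)
  qed
  ultimately show ?thesis using W c that by simp
qed

section \<open>The circumscribed simplex\<close>

text \<open>
  The hyperplane \<open>x\<^sub>1 + \<dots> + x\<^sub>n = n\<close> through the corner \<open>(1, \<dots>, 1)\<close> of the cube cuts a simplex off the
  orthant with apex \<open>(-1, \<dots>, -1)\<close>. These are its vertices; the index \<open>k = n\<close> gives the apex.
\<close>

definition vertex :: "nat \<Rightarrow> nat \<Rightarrow> nat \<Rightarrow> real"
  where "vertex n k = (\<lambda>i. if i < n then (if i = k then 2 * real n - 1 else -1) else 0)"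

definition corner_simplex :: "nat \<Rightarrow> rvec set"
  where "corner_simplex n = {x \<in> vecs n. (\<forall>i<n. - 1 \<le> x i) \<and> (\<Sum>i<n. x i) \<le> real n}"

lemma vertex_in: "vertex n k \<in> vecs n"
  by (simp add: vertex_def vecs_def)

lemma vertex_combination:
  assumes "i < n"
  shows "(\<Sum>k\<le>n. u k *\<^sub>R vertex n k) i = 2 * real n * u i - (\<Sum>k\<le>n. u k)"
proof -
  have "(\<Sum>k\<le>n. u k *\<^sub>R vertex n k) i = (\<Sum>k\<le>n. (if k = i then 2 * real n * u i else 0) - u k)"
    unfolding sum_fun_apply using assms by (intro sum.cong) (auto simp: vertex_def algebra_simps)
  then show ?thesis using assms by (simp add: sum_subtractf)
qed

lemma corner_simplex_eq_hull: "0 < n \<Longrightarrow> corner_simplex n = convex hull (vertex n ` {..n})"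
proof (intro subset_antisym subsetI)
  fix x assume n: "0 < n" and x: "x \<in> corner_simplex n"
  define u where "u k = (if k < n then (x k + 1) / (2 * real n) else 1 - (\<Sum>k<n. (x k + 1) / (2 * real n)))" for k
  have sum_u: "(\<Sum>k\<le>n. u k) = 1"
    by (simp add: u_def lessThan_Suc_atMost[symmetric])
  have "(\<Sum>k<n. (x k + 1) / (2 * real n)) \<le> 1"
  proof -
    have "(\<Sum>k<n. (x k + 1) / (2 * real n)) = ((\<Sum>k<n. x k) + real n) / (2 * real n)"
      by (simp add: sum_divide_distrib[symmetric] sum.distrib)
    also have "\<dots> \<le> 1" using x n by (simp add: corner_simplex_def)
    finally show ?thesis .
  qed
  then have "0 \<le> u k" for k using x n by (auto simp: u_def corner_simplex_def)
  then have "(\<Sum>k\<le>n. u k *\<^sub>R vertex n k) \<in> convex hull (vertex n ` {..n})"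
    by (intro convex_sum sum_u convex_convex_hull) (auto intro!: hull_inc)
  also have "(\<Sum>k\<le>n. u k *\<^sub>R vertex n k) = x"
  proof (rule vecs_eqI)
    fix i assume i: "i < n"
    then show "(\<Sum>k\<le>n. u k *\<^sub>R vertex n k) i = x i"
      unfolding vertex_combination[OF i] sum_u by (simp add: u_def)
  qed (use x in \<open>auto simp: corner_simplex_def intro!: vecs_sum vecs_scale vertex_in\<close>)
  finally show "x \<in> convex hull (vertex n ` {..n})" .
next
  fix x assume n: "0 < n" and x: "x \<in> convex hull (vertex n ` {..n})"
  have "convex (corner_simplex n)"
  proof (rule convexI)
    fix x y :: "nat \<Rightarrow> real" and u v :: real
    assume xy: "x \<in> corner_simplex n" "y \<in> corner_simplex n" and uv: "0 \<le> u" "0 \<le> v" "u + v = 1"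
    have "- 1 \<le> u * x i + v * y i" if "i < n" for i
      using xy that uv convex_bound_le[of "- x i" 1 "- y i" u v] by (simp add: corner_simplex_def)
    moreover have "(\<Sum>i<n. u * x i + v * y i) \<le> real n"
      using xy uv convex_bound_le[of "\<Sum>i<n. x i" "real n" "\<Sum>i<n. y i" u v]
      by (simp add: corner_simplex_def sum.distrib sum_distrib_left[symmetric])
    ultimately show "u *\<^sub>R x + v *\<^sub>R y \<in> corner_simplex n"
      using xy by (simp add: corner_simplex_def vecs_add vecs_scale)
  qed
  moreover have "vertex n k \<in> corner_simplex n" if "k \<le> n" for k
  proof -
    have "(\<Sum>i<n. vertex n k i) = (\<Sum>i<n. (if i = k then 2 * real n else 0) - 1)"
      by (intro sum.cong) (auto simp: vertex_def)
    also have "\<dots> \<le> real n" by (simp add: sum_subtractf)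
    finally show ?thesis using vertex_in[of n k] n by (simp add: corner_simplex_def) (simp add: vertex_def)
  qed
  ultimately have "convex hull (vertex n ` {..n}) \<subseteq> corner_simplex n"
    by (intro hull_minimal) auto
  with x show "x \<in> corner_simplex n" by blast
qed

lemma full_simplex_image:
  assumes n: "0 < n" and T: "lin_iso n T" and p: "p \<in> vecs n"
  shows "full_simplex n ((\<lambda>x. p + T x) ` corner_simplex n)"
proof -
  note TD = lin_isoD[OF T]
  define v where "v k = p + T (vertex n k)" for k
  have zero: "u k = 0" if k: "k \<le> n" and u: "(\<Sum>k\<le>n. u k) = 0" "(\<Sum>k\<le>n. u k *\<^sub>R v k) = 0" for u k
  proof -
    define z where "z = (\<Sum>k\<le>n. u k *\<^sub>R vertex n k)"
    have z_in: "z \<in> vecs n" unfolding z_def by (intro vecs_sum vecs_scale vertex_in)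
    have "(\<Sum>k\<le>n. u k *\<^sub>R v k) = (\<Sum>k\<le>n. u k) *\<^sub>R p + T z"
      by (simp add: v_def z_def scaleR_add_right sum.distrib linear_sum[OF TD(1)] linear_cmul[OF TD(1)] scaleR_sum_left)
    then have "T z = T 0" using u linear_0[OF TD(1)] by simp
    then have "z = 0" using TD(4) z_in vecs_0 by (auto dest: inj_onD)
    then have u0: "u i = 0" if "i < n" for i
      using vertex_combination[OF that, of u] u(1) n by (simp add: z_def)
    have "(\<Sum>k\<le>n. u k) = u n" using u0 by (simp add: lessThan_Suc_atMost[symmetric])
    then show ?thesis using u0 u(1) k by (cases "k = n") auto
  qed
  have inj: "inj_on v {..n}"
  proof (rule inj_onI)
    fix k l assume kl: "k \<in> {..n}" "l \<in> {..n}" "v k = v l"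
    then have "vertex n k = vertex n l"
      using TD(4) vertex_in by (auto simp: v_def dest: inj_onD)
    then have "vertex n k i = vertex n l i" for i by simp
    from this[of k] this[of l] show "k = l" using kl n by (auto simp: vertex_def split: if_split_asm)
  qed
  have "\<not> affine_dependent (v ` {..n})"
  proof
    assume "affine_dependent (v ` {..n})"
    then obtain U where U: "sum U (v ` {..n}) = 0" "\<exists>w\<in>v ` {..n}. U w \<noteq> 0" "(\<Sum>w\<in>v ` {..n}. U w *\<^sub>R w) = 0"
      using affine_dependent_explicit_finite[of "v ` {..n}"] by auto
    have 1: "(\<Sum>k\<le>n. U (v k)) = 0" using U(1) by (simp add: sum.reindex[OF inj])
    have 2: "(\<Sum>k\<le>n. U (v k) *\<^sub>R v k) = 0"
      using U(3) unfolding sum.reindex[OF inj] by (simp only: o_def)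
    have "U (v k) = 0" if "k \<le> n" for k
      using zero[OF that, of "\<lambda>k. U (v k)"] 1 2 by simp
    with U(2) show False by auto
  qed
  moreover have "v ` {..n} \<subseteq> topspace (Euclidean_space n)"
  proof -
    have "v k \<in> vecs n" for k unfolding v_def by (intro vecs_add p TD(6) vertex_in)
    then show ?thesis by (auto simp: topspace_Euclidean_space vecs_def)
  qed
  moreover have "card (v ` {..n}) = n + 1" by (simp add: card_image[OF inj])
  moreover have "(\<lambda>x. p + T x) ` corner_simplex n = convex hull (v ` {..n})"
  proof -
    have "convex hull (v ` {..n}) = convex hull ((\<lambda>x. p + x) ` T ` vertex n ` {..n})"
      by (simp add: v_def image_image)
    also have "\<dots> = (\<lambda>x. p + x) ` T ` (convex hull (vertex n ` {..n}))"
      by (simp only: convex_hull_translation convex_hull_linear_image[OF TD(1)])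
    finally show ?thesis using corner_simplex_eq_hull[OF n] by (simp add: image_image)
  qed
  ultimately show ?thesis unfolding full_simplex_def by blast
qed

lemma corner_simplex_borel: "corner_simplex n \<in> sets borel"
proof -
  have "corner_simplex n = vecs n \<inter> (\<Inter>i\<in>{..<n}. {x. - 1 \<le> x i}) \<inter> {x. (\<Sum>i<n. x i) \<le> real n}"
    by (auto simp: corner_simplex_def)
  moreover have "closed {x::rvec. - 1 \<le> x i}" for i
    by (intro closed_Collect_le continuous_on_const continuous_on_product_coordinates)
  moreover have "closed {x::rvec. (\<Sum>i<n. x i) \<le> real n}"
    by (intro closed_Collect_le continuous_on_sum continuous_on_const continuous_on_product_coordinates)
  ultimately show ?thesis using closed_vecs by (auto intro!: borel_closed closed_Int closed_INT)
qed

lemma corner_simplex_subset: "corner_simplex n \<subseteq> vecs n"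
  by (auto simp: corner_simplex_def)

lemma cube_subset_corner_simplex: "cube n 1 \<subseteq> corner_simplex n"
proof
  fix x assume x: "x \<in> cube n 1"
  then have "(\<Sum>i<n. x i) \<le> (\<Sum>i<n. 1)" by (intro sum_mono) (auto simp: cube_def)
  with x show "x \<in> corner_simplex n" by (simp add: cube_def corner_simplex_def)
qed

text \<open>
  Translated by \<open>(1, \<dots>, 1)\<close>, the simplex consists of points with non-negative coordinates of sum at most \<open>2 n\<close>.
\<close>

lemma measure_corner_simplex_le: "lvol n (corner_simplex n) \<le> (2 * exp 2) ^ n"
proof -
  define a :: "nat \<Rightarrow> real" where "a i = (if i < n then 1 else 0)" for i
  have a: "a \<in> vecs n" by (simp add: a_def vecs_def)
  let ?A = "(\<lambda>x. a + 1 *\<^sub>R x) ` corner_simplex n"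
  note A = emeasure_leb_affine[OF a zero_less_one corner_simplex_borel corner_simplex_subset]
  have "emeasure (leb n) ?A \<le> ennreal ((2 * exp 2) ^ n)"
  proof (rule emeasure_l1_ball_le[OF A(1)])
    fix y assume "y \<in> ?A"
    then obtain x where x: "x \<in> corner_simplex n" "y = a + 1 *\<^sub>R x" by blast
    have "(\<Sum>i<n. \<bar>y i\<bar>) = (\<Sum>i<n. 1 + x i)"
      using x by (intro sum.cong) (auto simp: a_def corner_simplex_def)
    also have "\<dots> \<le> 2 * real n" using x by (simp add: sum.distrib corner_simplex_def)
    finally show "(\<Sum>i<n. \<bar>y i\<bar>) \<le> 2 * real n" .
  qed
  then have "emeasure (leb n) (corner_simplex n) \<le> ennreal ((2 * exp 2) ^ n)"
    using A(2) by simp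
  then show ?thesis by (simp add: measure_def enn2real_leI)
qed

section \<open>Convex bodies\<close>

lemma convex_body_contains_cube:
  assumes "convex_body n K"
  obtains p d where "p \<in> K" "0 < d" "\<And>x. x \<in> cube n d \<Longrightarrow> p + x \<in> K"
proof -
  obtain p U where U: "openin (Euclidean_space n) U" "p \<in> U" "U \<subseteq> K"
    using assms by (auto simp: convex_body_def interior_of_def)
  then obtain V where V: "openin (powertop_real UNIV) V" "U = V \<inter> vecs n"
    by (auto simp: Euclidean_space_def openin_subtopology vecs_def)
  then obtain X where X: "p \<in> Pi\<^sub>E UNIV X" "\<And>i. open (X i)" "Pi\<^sub>E UNIV X \<subseteq> V"
    using product_topology_open_contains_basis[OF V(1), of p] U(2) by auto
  have "\<exists>e>0. \<forall>y. \<bar>y - p i\<bar> < e \<longrightarrow> y \<in> X i" for i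
    using X(1,2) by (force simp: open_dist dist_real_def)
  then obtain e where e: "\<And>i. 0 < e i" "\<And>i y. \<bar>y - p i\<bar> < e i \<Longrightarrow> y \<in> X i" by metis
  define d where "d = Min (insert 1 (e ` {..<n})) / 2"
  have "0 < Min (insert 1 (e ` {..<n}))" using e(1) by (subst Min_gr_iff) auto
  then have d: "0 < d" by (simp add: d_def)
  have d_le: "d < e i" if "i < n" for i
  proof -
    have "Min (insert 1 (e ` {..<n})) \<le> e i" using that by (intro Min_le) auto
    then show ?thesis using \<open>0 < Min (insert 1 (e ` {..<n}))\<close> unfolding d_def by linarith
  qed
  have p_in: "p \<in> vecs n" using U(2) V(2) by blast
  have "p + x \<in> K" if x: "x \<in> cube n d" for x
  proof -
    have "(p + x) i \<in> X i" for i
    proof (cases "i < n")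
      case True
      have "\<bar>x i\<bar> \<le> d" using x True by (auto simp: cube_def abs_le_iff minus_le_iff)
      then show ?thesis using d_le[OF True] by (intro e(2)) simp
    next
      case False
      then have "x i = 0" using x by (simp add: cube_def vecs_def)
      then show ?thesis using X(1) by auto
    qed
    then have "p + x \<in> V" using X(3) by auto
    moreover have "p + x \<in> vecs n"
      using x cube_subset by (intro vecs_add p_in) auto
    ultimately show ?thesis using U V by blast
  qed
  then show ?thesis using that d U by blast
qed

lemma convex_body_difference:
  assumes "convex_body n K"
  shows "compact K" "K \<subseteq> vecs n" "convex K" "0 < lvol n K"
    "sym_body n (differences (K \<times> K))"
proof -
  show K: "compact K" "K \<subseteq> vecs n" "convex K"
    using assms by (auto simp: convex_body_def Euclidean_space_def compactin_subtopology
        euclidean_product_topology vecs_def)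
  obtain p d where p: "p \<in> K" "0 < d" "\<And>x. x \<in> cube n d \<Longrightarrow> p + x \<in> K"
    using convex_body_contains_cube[OF assms] by metis
  have p_in: "p \<in> vecs n" using p K by blast
  have "0 < (1::real) ^ n * lvol n (cube n d)" using p(2) by (simp add: measure_cube)
  also have "\<dots> = lvol n ((\<lambda>x. p + 1 *\<^sub>R x) ` cube n d)"
    by (rule measure_leb_affine[OF p_in, symmetric]) (auto simp: cube_subset)
  also have "\<dots> \<le> lvol n K"
    using p by (intro measure_mono_compact K emeasure_leb_affine(1)[OF p_in] cube_borel cube_subset) auto
  finally show "0 < lvol n K" .
  let ?D = "differences (K \<times> K)"
  have "convex ?D"
  proof (rule convexI)
    fix x y :: "nat \<Rightarrow> real" and u v :: real
    assume "x \<in> ?D" "y \<in> ?D" and uv: "0 \<le> u" "0 \<le> v" "u + v = 1"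
    then obtain a b a' b' where *: "a \<in> K" "b \<in> K" "a' \<in> K" "b' \<in> K" "x = a - b" "y = a' - b'"
      by (auto simp: differences_def)
    have "u *\<^sub>R a + v *\<^sub>R a' \<in> K" "u *\<^sub>R b + v *\<^sub>R b' \<in> K"
      using * uv K(3) by (auto intro!: convexD)
    then have "(u *\<^sub>R a + v *\<^sub>R a') - (u *\<^sub>R b + v *\<^sub>R b') \<in> ?D"
      unfolding differences_def by blast
    also have "(u *\<^sub>R a + v *\<^sub>R a') - (u *\<^sub>R b + v *\<^sub>R b') = u *\<^sub>R x + v *\<^sub>R y"
      by (simp add: * scaleR_diff_right)
    finally show "u *\<^sub>R x + v *\<^sub>R y \<in> ?D" .
  qed
  moreover have "- x \<in> ?D" if x: "x \<in> ?D" for x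
  proof -
    obtain a b where *: "a \<in> K" "b \<in> K" "x = a - b" using x by (auto simp: differences_def)
    then have "b - a \<in> ?D" unfolding differences_def by blast
    then show ?thesis using * by simp
  qed
  moreover have "eball n d \<subseteq> ?D"
  proof
    fix x assume "x \<in> eball n d"
    then have "p + x \<in> K" using eball_subset_cube[of d n] p by auto
    then have "(p + x) - p \<in> ?D" using p(1) unfolding differences_def by blast
    then show "x \<in> ?D" by simp
  qed
  ultimately show "sym_body n ?D"
    using compact_differences[OF compact_Times[OF K(1,1)]] differences_subset[of "K \<times> K" n] K(2) p(2)
    unfolding sym_body_def by auto
qed

section \<open>Numerical estimates\<close>

lemma power_le_exp_fact: "real n ^ n \<le> exp (real n) * fact n"
proof -
  have "(\<lambda>i. real n ^ i /\<^sub>R fact i) sums exp (real n)" by (rule exp_converges)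
  then have "(\<Sum>i\<in>{n}. real n ^ i /\<^sub>R fact i) \<le> exp (real n)"
    by (metis (no_types, lifting) sums_unique sums_summable sum_le_suminf finite.emptyI finite.insertI
        scaleR_nonneg_nonneg inverse_nonnegative_iff_nonnegative fact_ge_zero zero_le_power of_nat_0_le_iff)
  then show ?thesis by (simp add: field_simps)
qed

text \<open>
  For the least \<open>k\<close> with \<open>2\<^sup>k \<ge> log\<^sub>2 (4 n)\<close>, the power \<open>2\<^sup>k\<close> exceeds this bound by a factor of at most \<open>2\<close>.
\<close>

lemma ex_iteration_count:
  assumes "2 \<le> n" shows "\<exists>k. 4 * real n \<le> 2 ^ 2 ^ k \<and> 2 ^ k \<le> 12 * ln (real n)"
proof -
  define x where "x = log 2 (4 * real n)"
  have "log 2 8 \<le> x" unfolding x_def using assms by (intro log_mono) auto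
  then have x: "3 \<le> x" using log_pow_cancel[of 2 3] by simp
  define k where "k = nat \<lceil>log 2 x\<rceil>"
  have lx: "0 < log 2 x" using x by (simp add: zero_less_log_cancel_iff)
  have ge: "x \<le> 2 ^ k"
  proof -
    have "log 2 x \<le> real k" unfolding k_def by (rule real_nat_ceiling_ge)
    then have "x \<le> 2 powr real k" using x by (simp add: log_le_iff)
    then show ?thesis by (simp add: powr_realpow)
  qed
  have "real k < log 2 x + 1" using lx unfolding k_def by linarith
  then have "2 powr real k \<le> 2 powr (log 2 x + 1)" by (intro powr_mono) auto
  then have "2 ^ k \<le> x * 2" using x by (simp add: powr_realpow powr_add powr_log_cancel)
  also have "x = 2 + log 2 (real n)"
  proof -
    have "x = log 2 4 + log 2 (real n)" unfolding x_def using assms by (simp add: log_mult)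
    moreover have "log 2 4 = 2" using log_pow_cancel[of 2 2] by simp
    ultimately show ?thesis by simp
  qed
  also have "2 + log 2 (real n) \<le> 3 * log 2 (real n)"
    using log_mono[of 2 2 "real n"] assms by simp
  also have "3 * log 2 (real n) * 2 \<le> 12 * ln (real n)"
  proof -
    have "1 / 2 \<le> ln (2::real)" using ln2_ge_two_thirds by simp
    then have "ln (real n) / ln 2 \<le> ln (real n) / (1 / 2)"
      using assms by (intro divide_left_mono) auto
    then show ?thesis by (simp add: log_def)
  qed
  finally have "2 ^ k \<le> 12 * ln (real n)" by simp
  moreover have "4 * real n \<le> 2 ^ 2 ^ k"
  proof -
    have "4 * real n = 2 powr x" using assms by (simp add: x_def)
    also have "\<dots> \<le> 2 powr real (2 ^ k)" using ge by (intro powr_mono) auto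
    also have "\<dots> = 2 ^ 2 ^ k" by (rule powr_realpow) simp
    finally show ?thesis .
  qed
  ultimately show ?thesis by blast
qed

lemma ln_square_le: "1 \<le> x \<Longrightarrow> (ln x)\<^sup>2 \<le> 4 * x" for x :: real
proof -
  assume x: "1 \<le> x"
  have "ln x = 2 * ln (sqrt x)" using x by (simp add: ln_sqrt)
  also have "ln (sqrt x) < sqrt x" using x by (intro ln_less_self) simp
  finally have "ln x \<le> 2 * sqrt x" by simp
  then have "(ln x)\<^sup>2 \<le> (2 * sqrt x)\<^sup>2" using x by (intro power_mono) auto
  then show ?thesis using x by (simp add: power_mult_distrib)
qed

text \<open>
  The polynomial factors \<open>3 n\<close> of the \<open>k\<close> steps are harmless: \<open>k ln (3 n)\<close> is at most a constant times
  \<open>(ln n)\<^sup>2\<close>, hence at most a constant times \<open>n\<close>. The factors \<open>2\<^sup>n\<close> contribute \<open>(2\<^sup>k)\<^sup>n\<close>, which is the power of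
  the logarithm in the theorem.
\<close>

lemma iteration_loss_le:
  assumes n: "2 \<le> n" and k: "2 ^ k \<le> 12 * ln (real n)"
  shows "(3 * real n * 2 ^ n) ^ k \<le> (exp 144 * (12 * ln (real n))) ^ n"
proof -
  have "real k \<le> 2 ^ k" using of_nat_less_two_power[of k] by (metis less_eq_real_def)
  then have k': "real k \<le> 12 * ln (real n)" using k by linarith
  have "3 * real n \<le> real n ^ 3"
  proof -
    have "(2::real) * 2 \<le> real n * real n" using n by (intro mult_mono) auto
    then have "3 * real n \<le> (real n * real n) * real n" using n by (intro mult_right_mono) auto
    then show ?thesis by (simp add: power3_eq_cube)
  qed
  then have "(3 * real n) ^ k \<le> (real n ^ 3) ^ k" by (intro power_mono) auto
  also have "real n ^ 3 = exp (3 * ln (real n))" using n by (simp add: exp_of_nat_mult[of 3, simplified])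
  also have "exp (3 * ln (real n)) ^ k = exp (real k * (3 * ln (real n)))"
    by (simp add: exp_of_nat_mult)
  also have "\<dots> \<le> exp (144 * real n)"
  proof -
    have "real k * (3 * ln (real n)) \<le> 12 * ln (real n) * (3 * ln (real n))"
      using k' n by (intro mult_right_mono) auto
    also have "\<dots> = 36 * (ln (real n))\<^sup>2" by (simp add: power2_eq_square)
    also have "\<dots> \<le> 144 * real n" using ln_square_le[of "real n"] n by simp
    finally show ?thesis by simp
  qed
  also have "\<dots> = exp 144 ^ n" by (simp add: exp_of_nat_mult[symmetric] mult.commute)
  finally have 1: "(3 * real n) ^ k \<le> exp 144 ^ n" .
  have "((2::real) ^ n) ^ k = (2 ^ k) ^ n" by (simp add: power_mult[symmetric] mult.commute)
  also have "\<dots> \<le> (12 * ln (real n)) ^ n" using k by (intro power_mono) auto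
  finally have 2: "((2::real) ^ n) ^ k \<le> (12 * ln (real n)) ^ n" .
  have "(3 * real n * 2 ^ n) ^ k = (3 * real n) ^ k * (2 ^ n) ^ k" by (rule power_mult_distrib)
  also have "\<dots> \<le> exp 144 ^ n * (12 * ln (real n)) ^ n"
    using 1 2 by (intro mult_mono) auto
  finally show ?thesis by (simp add: power_mult_distrib)
qed

text \<open>
  Here \<open>n\<^sup>n\<close> comes from the volume product and \<open>c \<ge> \<surd>(n!)\<close> is the determinant. By \<open>n! \<ge> (n / e)\<^sup>n\<close> the
  quotient is of order \<open>n\<^sup>n\<^sup>/\<^sup>2\<close> up to \<open>e\<^sup>n\<close>.
\<close>

lemma fact_loss_le:
  assumes n: "2 \<le> n" and c: "0 < c" "fact n \<le> c\<^sup>2"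
  shows "real n ^ n / c \<le> exp 1 ^ n * real n powr ((real n + 1) / 2)"
proof -
  have "(real n ^ n / c)\<^sup>2 = real n ^ n * (real n ^ n / c\<^sup>2)"
    by (simp add: power_divide power2_eq_square)
  also have "\<dots> \<le> real n ^ n * exp (real n)"
  proof (intro mult_left_mono)
    have "real n ^ n \<le> exp (real n) * fact n" by (rule power_le_exp_fact)
    also have "\<dots> \<le> exp (real n) * c\<^sup>2" using c by (intro mult_left_mono) auto
    finally show "real n ^ n / c\<^sup>2 \<le> exp (real n)" using c by (simp add: divide_le_eq)
  qed simp
  also have "\<dots> \<le> real n powr (real n + 1) * (exp 1 ^ n)\<^sup>2"
  proof (intro mult_mono)
    have "real n powr real n \<le> real n powr (real n + 1)" using n by (intro powr_mono) auto
    then show "real n ^ n \<le> real n powr (real n + 1)" using n by (simp add: powr_realpow)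
    have "exp (real n) = exp 1 ^ n" by (simp add: exp_of_nat_mult[symmetric])
    moreover have "(1::real) \<le> exp 1 ^ n" by (intro one_le_power) simp
    ultimately show "exp (real n) \<le> (exp 1 ^ n)\<^sup>2" by (simp add: power2_eq_square)
  qed auto
  also have "\<dots> = (exp 1 ^ n * real n powr ((real n + 1) / 2))\<^sup>2"
    by (simp add: power_mult_distrib power2_eq_square[of "real n powr _"] powr_add[symmetric] mult.commute)
  finally show ?thesis by (rule power2_le_imp_le) simp
qed

section \<open>Simplices of small volume around a convex body\<close>

theorem corollary5p4:
  shows "\<exists>C::real. C > 0 \<and>
    (\<forall>n::nat. \<forall>K. n \<ge> 2 \<longrightarrow> convex_body n K \<longrightarrow>
      (\<exists>S. full_simplex n S \<and> K \<subseteq> S \<and>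
        vol n S \<le> (C * ln (real n)) ^ n * real n powr ((real n + 1) / 2) * vol n K))"
proof -
  \<comment> \<open>The factors come from the difference body, the simplex, the isotropic body (two factors),\<close>
  \<comment> \<open>the iteration of Kuperberg and the bound for the factorial, in this order.\<close>
  define C :: real where "C = 4 * (2 * exp 2) * 2 * (2 * exp (sqrt 2)) * (exp 144 * 12) * exp 1"
  have "\<exists>S. full_simplex n S \<and> K \<subseteq> S \<and>
      vol n S \<le> (C * ln (real n)) ^ n * real n powr ((real n + 1) / 2) * vol n K"
    if n: "2 \<le> n" and body: "convex_body n K" for n K
  proof -
    have n0: "0 < n" using n by simp
    note K = convex_body_difference[OF body]
    let ?D = "differences (K \<times> K)"
    have D: "sym_body n ?D" by (rule K(5))
    have L: "sym_body n (polar n ?D)" by (rule sym_body_polar[OF D])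
    obtain T where T: "lin_iso n T" "isotropic n (T ` polar n ?D)"
      using isotropic_position[OF L] .
    define L' where "L' = T ` polar n ?D"
    have iso: "isotropic n L'" using T(2) by (simp only: L'_def)
    have L': "sym_body n L'" using iso by (simp add: isotropic_def)
    define D' where "D' = polar n L'"
    have D': "sym_body n D'" unfolding D'_def by (rule sym_body_polar[OF L'])
    \<comment> \<open>\<open>A\<close> carries the polar body of \<open>L'\<close> back to the difference body, and \<open>Z\<close> carries the cube to the\<close>
    \<comment> \<open>parallelepiped around that polar body.\<close>
    obtain A :: "rvec \<Rightarrow> rvec" where A: "lin_iso n A"
      "\<And>x y. x \<in> vecs n \<Longrightarrow> y \<in> vecs n \<Longrightarrow> ip n (T x) y = ip n x (A y)"
      using lin_iso_adjoint[OF T(1)] by metis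
    have "A ` polar n (T ` polar n ?D) = polar n (polar n ?D)"
      by (rule polar_image[OF T(1) A(1) _ polar_subset]) (rule A(2))
    then have AD': "A ` D' = ?D" by (simp only: D'_def L'_def bipolar[OF D])
    obtain d where d: "scales n A d" using ex_scales[OF A(1)] by blast
    obtain W c where W: "scales n W c" and c: "fact n \<le> c\<^sup>2" and WD: "W ` D' \<subseteq> cube n 1"
      using large_parallelepiped[OF iso] unfolding D'_def .
    note c0 = scalesD(2)[OF W] and d0 = scalesD(2)[OF d]
    obtain Z :: "rvec \<Rightarrow> rvec" where Z: "lin_iso n Z"
      "\<And>x. x \<in> vecs n \<Longrightarrow> Z (W x) = x" "\<And>x. x \<in> vecs n \<Longrightarrow> W (Z x) = x"
      using lin_iso_inverse[OF scalesD(1)[OF W]] by metis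
    have Zs: "scales n Z (1 / c)" by (rule scales_inverse[OF W Z(1,2)])
    have AZ: "scales n (\<lambda>x. A (Z x)) (d * (1 / c))" by (rule scales_comp[OF Zs d])
    obtain p where p: "p \<in> K" using convex_body_contains_cube[OF body] by blast
    have p_in: "p \<in> vecs n" using p K(2) by blast
    let ?S = "(\<lambda>x. p + A (Z x)) ` corner_simplex n"
    have "full_simplex n ?S"
      by (rule full_simplex_image[OF n0 scalesD(1)[OF AZ] p_in])
    moreover have "K \<subseteq> ?S"
    proof
      fix x assume "x \<in> K"
      then have "x - p \<in> ?D" using p unfolding differences_def by blast
      then obtain y where y: "y \<in> D'" "x - p = A y" using AD' by blast
      have y_in: "y \<in> vecs n" using y(1) sym_bodyD(1)[OF D'] by blast
      have "W y \<in> corner_simplex n" using y(1) WD cube_subset_corner_simplex by blast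
      moreover have "x = p + A (Z (W y))" using y(2) Z(2)[OF y_in] by (simp add: algebra_simps)
      ultimately show "x \<in> ?S" by blast
    qed
    moreover have "vol n ?S \<le> (C * ln (real n)) ^ n * real n powr ((real n + 1) / 2) * vol n K"
    proof -
      let ?Q = "corner_simplex n" and ?AZ = "\<lambda>x. A (Z x)"
      have AZQ: "?AZ ` ?Q \<in> sets borel" "?AZ ` ?Q \<subseteq> vecs n"
        using scalesD(3)[OF AZ corner_simplex_borel corner_simplex_subset]
          lin_isoD(6)[OF scalesD(1)[OF AZ]] corner_simplex_subset by auto
      have S_eq: "?S = (\<lambda>x. p + 1 *\<^sub>R x) ` ?AZ ` ?Q" by (simp add: image_image)
      have S_sub: "?S \<subseteq> vecs n" using AZQ(2) by (auto intro: vecs_add[OF p_in])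
      have S_b: "?S \<in> sets borel"
        unfolding S_eq by (rule emeasure_leb_affine(1)[OF p_in zero_less_one AZQ])
      have "vol n ?S = lvol n ?S" by (rule vol_eq_measure_leb[OF S_sub S_b])
      also have "\<dots> = lvol n (?AZ ` ?Q)"
        unfolding S_eq measure_leb_affine[OF p_in zero_less_one AZQ] by simp
      also have "\<dots> = d * (1 / c) * lvol n ?Q"
        by (rule scalesD(5)[OF AZ corner_simplex_borel corner_simplex_subset])
      finally have vS: "vol n ?S = d / c * lvol n ?Q" by simp
      have vK: "vol n K = lvol n K"
        by (rule vol_eq_measure_leb[OF K(2) borel_compact[OF K(1)]])
      have mD': "0 < lvol n D'" by (rule sym_body_measure_pos[OF D'])
      have "d * lvol n D' = lvol n ?D"
        using scalesD(5)[OF d borel_compact[OF sym_bodyD(2)[OF D']] sym_bodyD(1)[OF D']] by (simp only: AD')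
      also have "\<dots> \<le> 4 ^ n * lvol n K"
        by (rule measure_difference_body[OF K(1,3,2,4)])
      finally have dD: "d \<le> 4 ^ n * lvol n K * (1 / lvol n D')"
        using mD' by (simp add: field_simps)
      obtain k where k: "4 * real n \<le> 2 ^ 2 ^ k" "2 ^ k \<le> 12 * ln (real n)"
        using ex_iteration_count[OF n] by blast
      have "(2 / real n) ^ n \<le> (3 * real n * 2 ^ n) ^ k * vprod n L'"
        using isotropic_subset[OF iso] isotropic_superset[OF iso n] n k(1)
        by (intro vprod_lower_bound[OF L' n0, of 1 "4 * real n"]) auto
      also have "\<dots> \<le> (exp 144 * (12 * ln (real n))) ^ n
          * (2 * (2 * exp (sqrt 2)) ^ n * lvol n D')"
        unfolding vprod_def D'_def[symmetric]
        using iteration_loss_le[OF n k(2)] isotropic_measure_le[OF iso n0] n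
        by (intro mult_mono) auto
      finally have "2 ^ n / lvol n D' \<le> real n ^ n * ((exp 144 * (12 * ln (real n))) ^ n
          * (2 * (2 * exp (sqrt 2)) ^ n))"
        using mD' n0 by (simp add: power_divide field_simps)
      moreover have "1 \<le> (2::real) ^ n" by simp
      ultimately have "1 / lvol n D' \<le> real n ^ n * ((exp 144 * (12 * ln (real n))) ^ n
          * (2 * (2 * exp (sqrt 2)) ^ n))"
        using mD' by (meson divide_right_mono less_imp_le order_trans)
      \<comment> \<open>The single factor \<open>2\<close> is enlarged to \<open>2\<^sup>n\<close> to be absorbed in the constant.\<close>
      moreover have "(2::real) \<le> 2 ^ n" using n power_increasing[of 1 n "2::real"] by simp
      then have "real n ^ n * ((exp 144 * (12 * ln (real n))) ^ n * (2 * (2 * exp (sqrt 2)) ^ n))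
          \<le> real n ^ n * ((exp 144 * (12 * ln (real n))) ^ n * (2 ^ n * (2 * exp (sqrt 2)) ^ n))"
        using n by (intro mult_left_mono mult_right_mono) auto
      ultimately have invD: "1 / lvol n D' \<le>
          real n ^ n * ((exp 144 * (12 * ln (real n))) ^ n * (2 ^ n * (2 * exp (sqrt 2)) ^ n))"
        (is "_ \<le> real n ^ n * ?B") by linarith
      have B0: "0 \<le> ?B" using n by simp
      have "vol n ?S = d * lvol n ?Q / c" using vS by simp
      also have "\<dots> \<le> (4 ^ n * lvol n K * (real n ^ n * ?B)) * (2 * exp 2) ^ n / c"
      proof (intro divide_right_mono mult_mono measure_corner_simplex_le)
        have "4 ^ n * lvol n K * (1 / lvol n D') \<le> 4 ^ n * lvol n K * (real n ^ n * ?B)"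
          by (intro mult_left_mono invD) auto
        with dD show "d \<le> 4 ^ n * lvol n K * (real n ^ n * ?B)" by linarith
      qed (use c0 B0 in auto)
      also have "\<dots> = (4 ^ n * (2 * exp 2) ^ n * ?B) * lvol n K * (real n ^ n / c)"
        by (simp add: mult_ac)
      also have "\<dots> \<le> (4 ^ n * (2 * exp 2) ^ n * ?B) * lvol n K
          * (exp 1 ^ n * real n powr ((real n + 1) / 2))"
        using B0 by (intro mult_left_mono fact_loss_le[OF n c0 c]) auto
      also have "\<dots> = (C * ln (real n)) ^ n * real n powr ((real n + 1) / 2) * vol n K"
        unfolding C_def vK by (simp only: power_mult_distrib mult_ac)
      finally show ?thesis .
    qed
    ultimately show ?thesis by blast
  qed
  moreover have "0 < C" by (simp add: C_def)
  ultimately show ?thesis by blast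
qed

end
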